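(* Let $d\ge3$. For any $\beta\in(0,1]$ and $u\in\mathbb{R}$, as $t\to\infty$ (through real values), respectively $n\to\infty$ (through integers), \[ \mathbb{P}\bigl(\ell^*(t)\le\beta\gamma^{-1}\log t+u\bigr)=\exp\bigl\{-(1+o(1))\,\gamma e^{-\gamma u}\,t^{1-\beta}\bigr\}, \] \[ \mathbb{P}\bigl(\xi^*(n)\le\beta\alpha\log n+u\bigr)\le\exp\bigl\{-(1+o(1))\,c_{\beta,n,u}\,\gamma(1-\gamma)^u\,n^{1-\beta}\bigr\}. \]
   Context: $(S_n)_{n\ge0}$ is the discrete-time simple (nearest-neighbour, symmetric) random walk on $\mathbb{Z}^d$, $d\ge3$, started at $S_0=0$. $(Y_t)_{t\ge0}$ is the continuous-time walk obtained by attaching i.i.d. $\mathrm{Exp}(1)$ holding times (independent of the walk) to $(S_n)$. $\mathbb{P}$ denotes the law governing both walks. Local times: $\xi(n,x)=\sum_{k=0}^n\mathbf 1_{\{S_k=x\}}$, $\ell(t,x)=\int_0^t\mathbf 1_{\{Y_s=x\}}ds$, and $\xi^*(n)=\max_{x\in\mathbb{Z}^d}\xi(n,x)$, $\ell^*(t)=\max_{x\in\mathbb{Z}^d}\ell(t,x)$. Constants: $\gamma=\gamma_d=\mathbb{P}(S_n\ne0\text{ for all }n\ge1)$, $\alpha=\alpha_d=-1/\log(1-\gamma)$, and \[ c_{\beta,n,u}:=n^\beta(1-\gamma)^{-u}(1-\gamma)^{\lfloor\beta\alpha\log n+u\rfloor}\in[1,(1-\gamma)^{-1}). \] *)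

theory Defs
  imports "HOL-Probability.Probability"
begin

text \<open>
  The walks live on an arbitrary probability space carrying the increments \<open>X\<close> of the
  discrete-time walk and the holding times \<open>T\<close>; the lattice is \<open>int ^ 'd\<close>, of dimension
  \<open>CARD('d)\<close>. Independence of the two sequences is that of the generated sigma-algebras,
  since \<open>indep_var\<close> only relates variables of one type.
\<close>

definition unit_steps :: "(int ^ 'd::finite) set" where
  "unit_steps = range (\<lambda>i. axis i 1) \<union> range (\<lambda>i. axis i (- 1))"

locale walk_with_holding_times = prob_space M
  for M :: "'w measure" +
  fixes X :: "nat \<Rightarrow> 'w \<Rightarrow> int ^ 'd::finite"
    and T :: "nat \<Rightarrow> 'w \<Rightarrow> real"
  assumes steps_indep: "indep_vars (\<lambda>_. count_space UNIV) X UNIV"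
    and steps_uniform: "\<And>k. distr M (count_space UNIV) (X k) = measure_pmf (pmf_of_set unit_steps)"
    and holding_indep: "indep_vars (\<lambda>_. borel) T UNIV"
    and holding_exp: "\<And>k. distributed M lborel (T k) (exponential_density 1)"
    and walk_holding_indep:
      "indep_set
         (sets (vimage_algebra (space M) (\<lambda>\<omega> k. X k \<omega>) (Pi\<^sub>M UNIV (\<lambda>_. count_space UNIV))))
         (sets (vimage_algebra (space M) (\<lambda>\<omega> k. T k \<omega>) (Pi\<^sub>M UNIV (\<lambda>_. borel))))"

definition walk :: "(nat \<Rightarrow> 'w \<Rightarrow> int ^ 'd::finite) \<Rightarrow> nat \<Rightarrow> 'w \<Rightarrow> int ^ 'd" where
  "walk X n \<omega> = (\<Sum>k<n. X k \<omega>)"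

text \<open>The walk stays in its \<open>n\<close>-th position for the time \<open>T n\<close>.\<close>

definition jump_time :: "(nat \<Rightarrow> 'w \<Rightarrow> real) \<Rightarrow> nat \<Rightarrow> 'w \<Rightarrow> real" where
  "jump_time T n \<omega> = (\<Sum>k<n. T k \<omega>)"

text \<open>
  Almost surely the holding times are positive with infinite sum; the \<open>LEAST\<close> is then the
  unique \<open>n\<close> with \<open>jump_time T n \<omega> \<le> t < jump_time T (Suc n) \<omega>\<close>, for \<open>t \<ge> 0\<close>.
\<close>

definition ct_walk ::
  "(nat \<Rightarrow> 'w \<Rightarrow> int ^ 'd::finite) \<Rightarrow> (nat \<Rightarrow> 'w \<Rightarrow> real) \<Rightarrow> real \<Rightarrow> 'w \<Rightarrow> int ^ 'd" where
  "ct_walk X T t \<omega> = walk X (LEAST n. t < jump_time T (Suc n) \<omega>) \<omega>"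

definition local_time :: "(nat \<Rightarrow> 'w \<Rightarrow> int ^ 'd::finite) \<Rightarrow> nat \<Rightarrow> int ^ 'd \<Rightarrow> 'w \<Rightarrow> nat" where
  "local_time X n x \<omega> = (\<Sum>k=0..n. indicator {x} (walk X k \<omega>))"

definition ct_local_time ::
  "(nat \<Rightarrow> 'w \<Rightarrow> int ^ 'd::finite) \<Rightarrow> (nat \<Rightarrow> 'w \<Rightarrow> real) \<Rightarrow> real \<Rightarrow> int ^ 'd \<Rightarrow> 'w \<Rightarrow> real" where
  "ct_local_time X T t x \<omega> = (LINT s:{0..t}|lborel. indicator {x} (ct_walk X T s \<omega>))"

text \<open>The range below is a set of numbers between \<open>0\<close> and \<open>n + 1\<close>, hence finite.\<close>

definition max_local_time :: "(nat \<Rightarrow> 'w \<Rightarrow> int ^ 'd::finite) \<Rightarrow> nat \<Rightarrow> 'w \<Rightarrow> nat" where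
  "max_local_time X n \<omega> = Max (range (\<lambda>x. local_time X n x \<omega>))"

text \<open>
  The local times at time \<open>t \<ge> 0\<close> are nonnegative with total mass \<open>t\<close>, so the supremum over
  the infinite lattice is bounded and attained.
\<close>

definition max_ct_local_time ::
  "(nat \<Rightarrow> 'w \<Rightarrow> int ^ 'd::finite) \<Rightarrow> (nat \<Rightarrow> 'w \<Rightarrow> real) \<Rightarrow> real \<Rightarrow> 'w \<Rightarrow> real" where
  "max_ct_local_time X T t \<omega> = (SUP x. ct_local_time X T t x \<omega>)"

definition escape_prob :: "'w measure \<Rightarrow> (nat \<Rightarrow> 'w \<Rightarrow> int ^ 'd::finite) \<Rightarrow> real" where
  "escape_prob M X = \<P>(\<omega> in M. \<forall>n\<ge>1. walk X n \<omega> \<noteq> 0)"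

text \<open>Both constants below take the escape probability \<open>\<gamma>\<close> as an argument.\<close>

definition log_const :: "real \<Rightarrow> real" where
  "log_const \<gamma> = - 1 / ln (1 - \<gamma>)"

definition c_const :: "real \<Rightarrow> real \<Rightarrow> nat \<Rightarrow> real \<Rightarrow> real" where
  "c_const \<gamma> \<beta> n u =
     real n powr \<beta> * (1 - \<gamma>) powr (- u)
       * (1 - \<gamma>) powi \<lfloor>\<beta> * log_const \<gamma> * ln (real n) + u\<rfloor>"

end

(* Upper bounds. The probability p(n) that no point exceeds the level is submultiplicative in the
   number of steps. In a block of polylogarithmic length, inclusion-exclusion shows that some point
   exceeds the level b with probability at least about gamma * length * P(local time at 0 > b): a
   fresh point appears at rate gamma, and the pairs of points are negligible: after each visit to
   {x, y} the walk returns with probability at most rho = 1 - gamma / (2 - gamma), and rho^2 is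
   smaller than the one-point return probability 1 - gamma. Raising to the power n / length gives
   the claim.

   Lower bound. Given the discrete walk, the local times of the continuous walk are independent
   Gamma variables, so the probability is the expectation of the product over x of F(visits to x).
   Jensen's inequality for exp reduces it to the expectation of the sum over x of -ln F(visits to x),
   a first moment. This has no analogue for the discrete local time, where F vanishes.

   Poisson tails link the two cases: Gamma(j) <= b iff a Poisson(b) variable is at least j, so the
   continuous walk has a Poisson threshold at each point where the discrete walk has a constant one.
   The continuous clock deviates from the number of steps with exponentially small probability. *)

theory Submission
  imports Defs "HOL-Real_Asymp.Real_Asymp" "HOL-Combinatorics.Transposition"
begin

text \<open>Blocks have polylogarithmic length because the pair term carries the square of the
  number of points that a block can reach, while thresholds are of order log n: a power of the
  threshold is harmless against the exponential gap \<open>\<rho>^2 < h\<close> (constant threshold)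
  or \<open>\<gamma> < 2 * (1 - \<rho>)\<close> (Poisson threshold), where
  \<open>h = 1 - \<gamma>\<close>; an arbitrary power of n would not be. Inside a block the walk
  only escapes for finitely many steps, so transience has to be quantitative. A return probability
  of order n^(-3/2) makes the Green function G finite, with \<gamma> G = 1, and brings the escape
  probability within O(n^(-1/2)) of \<gamma>. The number \<rho> is what remains when the Green
  function of two points is bounded by (1 + h) G. Stopping times never occur: first-hit and
  last-visit decompositions become inductions on the first step, for statements quantified over the
  starting point. The block bound and the Jensen bound both start from one formula for the mean of a
  sum over visited points, \<open>mean_tsum\<close>.\<close>

section \<open>Finite paths\<close>

text \<open>A path is the list of its steps, and \<open>mean n\<close> averages over the \<open>n\<close>-step paths. All estimates
  for the discrete walk are about finite paths, by induction on the first step.\<close>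

locale step_set =
  fixes U :: "'v::ab_group_add set"
  assumes finite_U: "finite U" and U_nonempty: "U \<noteq> {}"
begin

definition avg :: "('v \<Rightarrow> real) \<Rightarrow> real" where
  "avg f = (\<Sum>e\<in>U. f e) / card U"

lemma card_U_pos: "card U > 0"
  using finite_U U_nonempty by (simp add: card_gt_0_iff)

lemma avg_cong: "(\<And>e. e \<in> U \<Longrightarrow> f e = g e) \<Longrightarrow> avg f = avg g"
  by (simp add: avg_def)

lemma avg_const [simp]: "avg (\<lambda>_. c) = c"
  using card_U_pos by (simp add: avg_def)

lemma avg_mono: "(\<And>e. e \<in> U \<Longrightarrow> f e \<le> g e) \<Longrightarrow> avg f \<le> avg g"
  using card_U_pos by (auto simp: avg_def intro!: divide_right_mono sum_mono)

lemma avg_add: "avg (\<lambda>e. f e + g e) = avg f + avg g"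
  by (simp add: avg_def sum.distrib add_divide_distrib)

lemma avg_cmult: "avg (\<lambda>e. c * f e) = c * avg f"
  by (simp add: avg_def sum_distrib_left)

lemma avg_sum: "avg (\<lambda>e. \<Sum>i\<in>I. f i e) = (\<Sum>i\<in>I. avg (f i))"
  unfolding avg_def by (subst sum.swap) (simp add: sum_divide_distrib)

lemma avg_reindex:
  assumes "bij_betw \<tau> U U"
  shows "avg (\<lambda>e. f (\<tau> e)) = avg f"
  unfolding avg_def using sum.reindex_bij_betw[OF assms, of f] by simp

primrec mean :: "nat \<Rightarrow> ('v list \<Rightarrow> real) \<Rightarrow> real" where
  "mean 0 f = f []"
| "mean (Suc n) f = avg (\<lambda>e. mean n (\<lambda>xs. f (e # xs)))"

lemma mean_mono:
  "(\<And>xs. length xs = n \<Longrightarrow> set xs \<subseteq> U \<Longrightarrow> f xs \<le> g xs) \<Longrightarrow> mean n f \<le> mean n g"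
  by (induction n arbitrary: f g) (auto intro!: avg_mono)

lemma mean_cong:
  "(\<And>xs. length xs = n \<Longrightarrow> set xs \<subseteq> U \<Longrightarrow> f xs = g xs) \<Longrightarrow> mean n f = mean n g"
  by (intro antisym mean_mono) auto

lemma mean_const [simp]: "mean n (\<lambda>_. c) = c"
  by (induction n) auto

lemma mean_nonneg: "(\<And>xs. 0 \<le> f xs) \<Longrightarrow> 0 \<le> mean n f"
  using mean_mono[of n "\<lambda>_. 0" f] by simp

lemma mean_le_1: "(\<And>xs. f xs \<le> 1) \<Longrightarrow> mean n f \<le> 1"
  using mean_mono[of n f "\<lambda>_. 1"] by simp

lemma mean_add: "mean n (\<lambda>xs. f xs + g xs) = mean n f + mean n g"
  by (induction n arbitrary: f g) (auto simp: avg_add)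

lemma mean_cmult: "mean n (\<lambda>xs. c * f xs) = c * mean n f"
  by (induction n arbitrary: f) (auto simp: avg_cmult)

lemma mean_diff: "mean n (\<lambda>xs. f xs - g xs) = mean n f - mean n g"
  using mean_add[of n f "\<lambda>xs. (-1) * g xs"] mean_cmult[of n "-1" g] by simp

lemma mean_sum: "mean n (\<lambda>xs. \<Sum>i\<in>I. f i xs) = (\<Sum>i\<in>I. mean n (f i))"
  by (induction n arbitrary: f) (auto simp: avg_sum)

lemma mean_append: "mean (n + m) f = mean n (\<lambda>xs. mean m (\<lambda>ys. f (xs @ ys)))"
  by (induction n arbitrary: f) auto

lemma mean_jensen: "exp (mean n f) \<le> mean n (\<lambda>xs. exp (f xs))"
proof -
  let ?c = "mean n f"
  have "exp ?c = exp ?c * (1 - ?c) + exp ?c * ?c" by (simp add: algebra_simps)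
  also have "\<dots> = mean n (\<lambda>xs. exp ?c * (1 - ?c) + exp ?c * f xs)"
    by (simp add: mean_add mean_cmult)
  also have "\<dots> \<le> mean n (\<lambda>xs. exp (f xs))"
  proof (rule mean_mono)
    fix xs
    have "exp ?c * (1 + (f xs - ?c)) \<le> exp ?c * exp (f xs - ?c)"
      by (intro mult_left_mono exp_ge_add_one_self) auto
    then show "exp ?c * (1 - ?c) + exp ?c * f xs \<le> exp (f xs)"
      by (simp add: algebra_simps flip: exp_add)
  qed
  finally show ?thesis .
qed

section \<open>Visit counts and hitting probabilities of finite paths\<close>

primrec visits :: "'v set \<Rightarrow> 'v \<Rightarrow> 'v list \<Rightarrow> nat" where
  "visits A a [] = of_bool (a \<in> A)"
| "visits A a (e # xs) = of_bool (a \<in> A) + visits A (a + e) xs"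

definition at_least :: "'v set \<Rightarrow> nat \<Rightarrow> 'v \<Rightarrow> nat \<Rightarrow> real" where
  "at_least A n a j = mean n (\<lambda>xs. of_bool (j \<le> visits A a xs))"

definition exactly :: "'v set \<Rightarrow> nat \<Rightarrow> 'v \<Rightarrow> nat \<Rightarrow> real" where
  "exactly A n a j = mean n (\<lambda>xs. of_bool (visits A a xs = j))"

definition occ :: "'v set \<Rightarrow> nat \<Rightarrow> 'v \<Rightarrow> real" where
  "occ A n a = mean n (\<lambda>xs. of_bool (a + sum_list xs \<in> A))"

text \<open>The start counts as a visit, so exactly one visit to \<open>{0}\<close> means no return
  to the origin within \<open>n\<close> steps.\<close>

definition esc :: "nat \<Rightarrow> real" where "esc n = exactly {0} n 0 1"

lemma at_least_nonneg: "0 \<le> at_least A n a j" and exactly_nonneg: "0 \<le> exactly A n a j"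
  and occ_nonneg: "0 \<le> occ A n a"
  by (auto simp: at_least_def exactly_def occ_def intro!: mean_nonneg)

lemma at_least_le_1: "at_least A n a j \<le> 1" and exactly_le_1: "exactly A n a j \<le> 1"
  by (auto simp: at_least_def exactly_def intro!: mean_le_1)

lemma at_least_0 [simp]: "at_least A n a 0 = 1"
  by (simp add: at_least_def)

lemma at_least_len_0: "at_least A 0 a j = of_bool (j \<le> of_bool (a \<in> A))"
  by (simp add: at_least_def)

lemma exactly_len_0: "exactly A 0 a j = of_bool (j = of_bool (a \<in> A))"
  by (auto simp: exactly_def)

lemma at_least_Suc_notin: "a \<notin> A \<Longrightarrow> at_least A (Suc n) a j = avg (\<lambda>e. at_least A n (a + e) j)"
  and at_least_Suc_in: "a \<in> A \<Longrightarrow> at_least A (Suc n) a (Suc j) = avg (\<lambda>e. at_least A n (a + e) j)"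
  by (simp_all add: at_least_def)

lemma exactly_Suc_notin: "a \<notin> A \<Longrightarrow> exactly A (Suc n) a j = avg (\<lambda>e. exactly A n (a + e) j)"
  and exactly_Suc_in: "a \<in> A \<Longrightarrow> exactly A (Suc n) a (Suc j) = avg (\<lambda>e. exactly A n (a + e) j)"
  by (simp_all add: exactly_def)

lemma occ_Suc: "occ A (Suc n) a = avg (\<lambda>e. occ A n (a + e))"
  by (simp add: occ_def add.assoc)

lemma occ_len_0: "occ A 0 a = of_bool (a \<in> A)"
  by (simp add: occ_def)

lemma at_least_split: "at_least A n a j = exactly A n a j + at_least A n a (Suc j)"
  unfolding at_least_def exactly_def mean_add[symmetric] by (rule mean_cong) auto

lemma at_least_1_in: "a \<in> A \<Longrightarrow> at_least A n a 1 = 1"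
  by (cases n) (auto simp: at_least_len_0 at_least_Suc_in[where j=0, simplified])

lemma visits_append_le: "visits A a xs \<le> visits A a (xs @ ys)"
proof (induction xs arbitrary: a)
  case Nil
  then show ?case by (cases ys) auto
qed auto

lemma at_least_mono_len: "n \<le> m \<Longrightarrow> at_least A n a j \<le> at_least A m a j"
proof -
  assume "n \<le> m"
  then obtain k where m: "m = n + k" using le_Suc_ex by blast
  show ?thesis
    unfolding at_least_def m mean_append
  proof (rule mean_mono)
    fix xs :: "'v list"
    have "mean k (\<lambda>_. of_bool (j \<le> visits A a xs))
        \<le> mean k (\<lambda>ys. of_bool (j \<le> visits A a (xs @ ys)))"
      by (intro mean_mono) (auto intro: order_trans[OF _ visits_append_le])
    then show "of_bool (j \<le> visits A a xs) \<le> mean k (\<lambda>ys. of_bool (j \<le> visits A a (xs @ ys)))"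
      by simp
  qed
qed

lemma esc_eq: "esc n = 1 - at_least {0} n 0 2"
  using at_least_split[of "{0}" n 0 1] at_least_1_in[of 0 "{0}" n] by (simp add: esc_def numeral_2_eq_2)

lemma esc_antimono: "decseq esc"
  by (auto simp: decseq_def esc_eq at_least_mono_len)

lemma esc_nonneg: "0 \<le> esc n" by (simp add: esc_def exactly_nonneg)

text \<open>After each visit another one follows with probability at most \<open>\<rho>\<close>. The
  bound is assumed for every horizon because the time left at a visit is random; the induction on
  the first step replaces the strong Markov property.\<close>

lemma at_least_geometric:
  assumes \<rho>: "\<And>n a. a \<in> A \<Longrightarrow> at_least A n a 2 \<le> \<rho>" "0 \<le> \<rho>"
  shows "at_least A n a (Suc j) \<le> \<rho> ^ j * at_least A n a 1"
proof (induction n arbitrary: a j)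
  case 0
  show ?case by (cases j) (use \<rho>(2) in \<open>auto simp: at_least_len_0\<close>)
next
  case (Suc n)
  show ?case
  proof (cases "a \<in> A")
    case False
    have "avg (\<lambda>e. at_least A n (a + e) (Suc j)) \<le> avg (\<lambda>e. \<rho> ^ j * at_least A n (a + e) 1)"
      by (intro avg_mono Suc)
    then show ?thesis using False by (simp add: at_least_Suc_notin avg_cmult)
  next
    case True
    show ?thesis
    proof (cases j)
      case (Suc i)
      have "at_least A (Suc n) a (Suc j) \<le> avg (\<lambda>e. \<rho> ^ i * at_least A n (a + e) 1)"
        unfolding Suc at_least_Suc_in[OF True] by (intro avg_mono Suc.IH)
      also have "\<dots> = \<rho> ^ i * at_least A (Suc n) a 2"
        using at_least_Suc_in[OF True, of n 1] by (simp add: avg_cmult numeral_2_eq_2)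
      also have "\<dots> \<le> \<rho> ^ i * \<rho>"
        by (intro mult_left_mono \<rho> True) (use \<rho> in auto)
      finally show ?thesis using Suc at_least_1_in[OF True] by (simp add: mult.commute)
    qed auto
  qed
qed

text \<open>Each of the \<open>j\<close> returns gets a window of \<open>s\<close> steps of its own;
  time left over in a window is not lost, since \<open>at_least\<close> grows with the
  horizon.\<close>

lemma at_least_return_lower:
  assumes "s > 0"
  shows "(1 - esc s) ^ j \<le> at_least {0} (j * s) 0 (Suc j)"
proof (induction j)
  case 0
  then show ?case using at_least_1_in[of 0 "{0}" 0] by simp
next
  case (Suc j)
  \<comment> \<open>A walk that hits \<open>0\<close> within \<open>t\<close> steps still has at
    least \<open>j * s\<close> steps for \<open>j\<close> returns, whenever the hit occurs.\<close>
  have "(1 - esc s) ^ j * at_least {0} t a 1 \<le> at_least {0} (t + j * s) a (Suc j)" for t a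
  proof (induction t arbitrary: a)
    case 0
    then show ?case using Suc by (cases "a = 0") (auto simp: at_least_len_0 at_least_nonneg)
  next
    case (Suc t)
    show ?case
    proof (cases "a = 0")
      case True
      have "(1 - esc s) ^ j \<le> at_least {0} (j * s) 0 (Suc j)" by fact
      also have "\<dots> \<le> at_least {0} (Suc t + j * s) 0 (Suc j)" by (rule at_least_mono_len) simp
      finally show ?thesis using True at_least_1_in[of 0 "{0}" "Suc t"] by simp
    next
      case False
      then show ?thesis
        using avg_mono[OF Suc.IH] by (simp add: at_least_Suc_notin avg_cmult)
    qed
  qed
  note * = this
  obtain s' where s': "s = Suc s'" using assms by (cases s) auto
  have "(1 - esc s) ^ Suc j = (1 - esc s) ^ j * avg (\<lambda>e. at_least {0} s' (0 + e) 1)"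
    using at_least_Suc_in[of 0 "{0}" s' 1] by (simp add: esc_eq s' numeral_2_eq_2)
  also have "\<dots> \<le> avg (\<lambda>e. at_least {0} (s' + j * s) (0 + e) (Suc j))"
    unfolding avg_cmult[symmetric] by (intro avg_mono *)
  also have "\<dots> = at_least {0} (Suc j * s) 0 (Suc (Suc j))"
    using at_least_Suc_in[of 0 "{0}" "s' + j * s" "Suc j"] by (simp add: s' add_ac)
  finally show ?case .
qed

text \<open>If visit number \<open>i + 1\<close> happens at time \<open>m\<close>, then it is the
  last one up to time \<open>k\<close> iff the walk escapes during the remaining
  \<open>k - m\<close> steps. For a single \<open>k\<close> this escape probability may be close to
  1; the sum over \<open>k\<close> turns it into the sum of \<open>esc\<close>.\<close>

lemma sum_exactly_le:
  assumes h: "\<And>n. 1 - esc n \<le> h"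
  shows "(\<Sum>k\<le>n. exactly {0} k a (Suc i)) \<le> h ^ i * (\<Sum>k\<le>n. esc k) * at_least {0} n a 1"
proof (induction n arbitrary: a i)
  case 0
  have h0: "0 \<le> h" using h[of 0] by (auto simp: esc_def exactly_len_0)
  then show ?case by (auto simp: esc_def exactly_len_0 at_least_len_0)
next
  case (Suc n)
  have "1 - esc 0 = 0" by (simp add: esc_def exactly_len_0)
  then have h0: "0 \<le> h" using h[of 0] by linarith
  let ?G = "\<Sum>k\<le>n. esc k" and ?G' = "\<Sum>k\<le>Suc n. esc k"
  have G: "0 \<le> ?G" "?G \<le> ?G'" by (auto intro: sum_nonneg esc_nonneg)
  have shift: "(\<Sum>k\<le>Suc n. exactly {0} k a (Suc i)) = exactly {0} 0 a (Suc i) + (\<Sum>k\<le>n. exactly {0} (Suc k) a (Suc i))"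
    by (simp only: sum.atMost_Suc_shift)
  show ?case
  proof (cases "a = 0")
    case False
    have "(\<Sum>k\<le>Suc n. exactly {0} k a (Suc i)) = avg (\<lambda>e. \<Sum>k\<le>n. exactly {0} k (a + e) (Suc i))"
      unfolding shift using False by (simp add: exactly_len_0 exactly_Suc_notin avg_sum)
    also have "\<dots> \<le> avg (\<lambda>e. h ^ i * ?G * at_least {0} n (a + e) 1)"
      by (intro avg_mono Suc)
    also have "\<dots> = h ^ i * ?G * at_least {0} (Suc n) a 1"
      using False by (simp add: avg_cmult at_least_Suc_notin)
    also have "\<dots> \<le> h ^ i * ?G' * at_least {0} (Suc n) a 1"
      by (intro mult_right_mono mult_left_mono G at_least_nonneg) (use h0 in auto)
    finally show ?thesis .
  next
    case True
    show ?thesis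
    proof (cases i)
      case 0
      have "(\<Sum>k\<le>Suc n. exactly {0} k a (Suc i)) = ?G'"
        using True 0 by (simp add: esc_def)
      then show ?thesis using 0 True at_least_1_in[of 0 "{0}"] by simp
    next
      case (Suc l)
      have "(\<Sum>k\<le>Suc n. exactly {0} k a (Suc i)) = avg (\<lambda>e. \<Sum>k\<le>n. exactly {0} k (0 + e) (Suc l))"
        unfolding shift using True Suc by (simp add: exactly_len_0 exactly_Suc_in avg_sum)
      also have "\<dots> \<le> avg (\<lambda>e. h ^ l * ?G * at_least {0} n (0 + e) 1)"
        by (intro avg_mono Suc.IH)
      also have "\<dots> = h ^ l * ?G * at_least {0} (Suc n) 0 2"
        using at_least_Suc_in[of 0 "{0}" n 1] by (simp add: avg_cmult numeral_2_eq_2)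
      also have "\<dots> \<le> h ^ l * ?G' * h"
        by (intro mult_mono G mult_left_mono mult_nonneg_nonneg at_least_nonneg)
           (use h0 h[of "Suc n"] G esc_eq[of "Suc n"] in auto)
      finally show ?thesis using True Suc at_least_1_in[of 0 "{0}"] by (simp add: mult_ac)
    qed
  qed
qed

text \<open>Visit number \<open>i + 1\<close> is the last one with probability \<open>esc\<close> of
  the remaining time, which is at least \<gamma> whatever that time is.\<close>

lemma exactly_ge:
  assumes \<gamma>: "\<And>n. \<gamma> \<le> esc n"
  shows "\<gamma> * at_least {0} n a (Suc i) \<le> exactly {0} n a (Suc i)"
proof (induction n arbitrary: a i)
  case 0
  show ?case using \<gamma>[of 0] by (auto simp: esc_def exactly_len_0 at_least_len_0)
next
  case (Suc n)
  show ?case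
  proof (cases "a = 0")
    case False
    then show ?thesis using avg_mono[OF Suc]
      by (simp add: at_least_Suc_notin exactly_Suc_notin avg_cmult)
  next
    case True
    show ?thesis
    proof (cases i)
      case 0
      then show ?thesis using True \<gamma>[of "Suc n"] at_least_1_in[of 0 "{0}"] by (simp add: esc_def)
    next
      case (Suc l)
      then show ?thesis using True avg_mono[OF Suc.IH]
        by (simp add: at_least_Suc_in exactly_Suc_in avg_cmult)
    qed
  qed
qed

text \<open>Sum over the time \<open>k\<close> of the last visit to \<open>A\<close>. The escape
  probability \<open>e\<close> has to be common to all points of \<open>A\<close>, which a symmetry
  provides when \<open>A\<close> has two points.\<close>

lemma last_visit:
  assumes e: "\<And>n a. a \<in> A \<Longrightarrow> exactly A n a 1 = e n"
  shows "at_least A n a 1 = (\<Sum>k\<le>n. occ A k a * e (n - k))"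
proof (induction n arbitrary: a)
  case 0
  show ?case using e[of a 0] by (auto simp: at_least_len_0 occ_len_0 exactly_len_0)
next
  case (Suc n)
  have "(\<Sum>k\<le>Suc n. occ A k a * e (Suc n - k))
      = of_bool (a \<in> A) * e (Suc n) + (\<Sum>k\<le>n. avg (\<lambda>x. occ A k (a + x)) * e (n - k))"
    by (subst sum.atMost_Suc_shift) (simp add: occ_len_0 occ_Suc)
  also have "(\<Sum>k\<le>n. avg (\<lambda>x. occ A k (a + x)) * e (n - k)) = avg (\<lambda>x. at_least A n (a + x) 1)"
    by (simp add: Suc avg_sum mult.commute[of _ "e _"] avg_cmult del: One_nat_def)
  finally show ?case
    using at_least_split[of A "Suc n" a 1] at_least_1_in[of a A "Suc n"] e[of a "Suc n"]
    by (cases "a \<in> A") (simp_all add: at_least_Suc_notin at_least_Suc_in)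
qed

text \<open>From the first hit of \<open>0\<close> on, the expected number of visits is at most that
  of a walk started at \<open>0\<close> with the full horizon.\<close>

lemma sum_occ_le: "(\<Sum>k\<le>n. occ {0} k a) \<le> at_least {0} n a 1 * (\<Sum>k\<le>n. occ {0} k 0)"
proof (induction n arbitrary: a)
  case 0
  show ?case by (auto simp: occ_len_0 at_least_len_0)
next
  case (Suc n)
  show ?case
  proof (cases "a = 0")
    case True
    then show ?thesis using at_least_1_in[of 0 "{0}"] by simp
  next
    case False
    have "(\<Sum>k\<le>Suc n. occ {0} k a) = avg (\<lambda>e. \<Sum>k\<le>n. occ {0} k (a + e))"
      using False by (subst sum.atMost_Suc_shift) (simp add: occ_len_0 occ_Suc avg_sum)
    also have "\<dots> \<le> avg (\<lambda>e. (\<Sum>k\<le>n. occ {0} k 0) * at_least {0} n (a + e) 1)"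
      using Suc by (intro avg_mono) (simp add: mult.commute del: One_nat_def)
    also have "\<dots> = at_least {0} (Suc n) a 1 * (\<Sum>k\<le>n. occ {0} k 0)"
      using False by (simp add: avg_cmult at_least_Suc_notin)
    also have "\<dots> \<le> at_least {0} (Suc n) a 1 * (\<Sum>k\<le>Suc n. occ {0} k 0)"
      by (intro mult_left_mono at_least_nonneg) (auto simp: occ_nonneg)
    finally show ?thesis .
  qed
qed

section \<open>Symmetries of the step set\<close>

lemma visits_image:
  assumes "\<And>v e. e \<in> U \<Longrightarrow> \<sigma> (v + e) = \<sigma> v + \<tau> e" "inj \<sigma>" "set xs \<subseteq> U"
  shows "visits (\<sigma> ` A) (\<sigma> a) (map \<tau> xs) = visits A a xs"
  using assms(3) by (induction xs arbitrary: a)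
    (simp_all add: inj_image_mem_iff[OF assms(2)] flip: assms(1))

lemma mean_map:
  assumes "bij_betw \<tau> U U"
  shows "mean n (\<lambda>xs. f (map \<tau> xs)) = mean n f"
proof (induction n arbitrary: f)
  case (Suc n)
  show ?case
    using Suc[of "\<lambda>xs. f (e # xs)" for e] avg_reindex[OF assms, of "\<lambda>e. mean n (\<lambda>xs. f (e # xs))"]
    by simp
qed auto

text \<open>\<open>\<sigma>\<close> may be affine: only the map \<open>\<tau>\<close> that it
  induces on steps has to permute \<open>U\<close>. This covers linear symmetries, with
  \<open>\<tau> = \<sigma>\<close>, as well as point reflections, with
  \<open>\<tau> = uminus\<close>.\<close>

lemma mean_visits_image:
  assumes "\<And>v e. e \<in> U \<Longrightarrow> \<sigma> (v + e) = \<sigma> v + \<tau> e" "inj \<sigma>" "bij_betw \<tau> U U"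
  shows "mean n (\<lambda>xs. f (visits (\<sigma> ` A) (\<sigma> a) xs)) = mean n (\<lambda>xs. f (visits A a xs))"
  by (subst mean_map[OF assms(3), symmetric])
    (auto intro!: mean_cong simp: visits_image[OF assms(1,2)])

lemma visits_translate: "visits ((+) c ` A) (c + a) xs = visits A a xs"
  by (induction xs arbitrary: a) (simp_all add: add.assoc image_iff)

lemma visits_single_translate: "visits {x} a xs = visits {x + c} (a + c) xs"
  using visits_translate[of c "{x}" a xs] by (simp add: add.commute)

end

text \<open>Passes to the limit in the last-visit identity. The terms with \<open>k <= N\<close>
  have \<open>e (n - k) <= e (n - N)\<close>, which tends to \<open>l\<close> as \<open>n\<close>
  grows; the rest is at most the tail of \<open>g\<close> beyond \<open>N\<close>.\<close>

lemma convolution_limit_le: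
  fixes g e :: "nat \<Rightarrow> real"
  assumes g: "summable g" "\<And>k. 0 \<le> g k" and e: "decseq e" "e \<longlonglongrightarrow> l" "\<And>k. e k \<le> 1" "\<And>k. 0 \<le> e k"
    and c: "\<And>n. c \<le> (\<Sum>k\<le>n. g k * e (n - k))"
  shows "c \<le> suminf g * l"
proof -
  have 1: "c \<le> suminf g * l + (suminf g - (\<Sum>k\<le>N. g k))" for N
  proof -
    have "\<forall>\<^sub>F n in sequentially. c \<le> suminf g * e (n - N) + (suminf g - (\<Sum>k\<le>N. g k))"
      using eventually_ge_at_top[of N]
    proof eventually_elim
      case (elim n)
      have "c \<le> (\<Sum>k\<le>n. g k * e (n - k))" by (rule c)
      also have "{..n} = {..N} \<union> {N<..n}" using elim by auto
      also have "(\<Sum>k\<in>{..N} \<union> {N<..n}. g k * e (n - k))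
         = (\<Sum>k\<le>N. g k * e (n - k)) + (\<Sum>k\<in>{N<..n}. g k * e (n - k))"
        by (rule sum.union_disjoint) auto
      also have "\<dots> \<le> (\<Sum>k\<le>N. g k * e (n - N)) + (\<Sum>k\<in>{N<..n}. g k)"
        by (intro add_mono sum_mono mult_left_mono decseqD[OF e(1)] g)
          (use e(3) g in \<open>auto intro: mult_left_le\<close>)
      also have "(\<Sum>k\<in>{N<..n}. g k) = (\<Sum>k\<le>n. g k) - (\<Sum>k\<le>N. g k)"
      proof -
        have "{..n} = {..N} \<union> {N<..n}" using elim by auto
        moreover have "sum g ({..N} \<union> {N<..n}) = sum g {..N} + sum g {N<..n}"
          by (rule sum.union_disjoint) auto
        ultimately show ?thesis by simp
      qed
      also have "(\<Sum>k\<le>n. g k) \<le> suminf g" by (intro sum_le_suminf g) auto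
      also have "(\<Sum>k\<le>N. g k * e (n - N)) \<le> suminf g * e (n - N)"
        unfolding sum_distrib_right[symmetric] by (intro mult_right_mono sum_le_suminf g e) auto
      finally show ?case by simp
    qed
    moreover have "(\<lambda>n. suminf g * e (n - N) + (suminf g - (\<Sum>k\<le>N. g k)))
        \<longlonglongrightarrow> suminf g * l + (suminf g - (\<Sum>k\<le>N. g k))"
      by (intro tendsto_intros) (rule LIMSEQ_offset[where k=N], simp add: e(2))
    ultimately show ?thesis
      by (intro tendsto_lowerbound) auto
  qed
  have "(\<lambda>N. suminf g * l + (suminf g - (\<Sum>k\<le>N. g k))) \<longlonglongrightarrow> suminf g * l + (suminf g - suminf g)"
    by (intro tendsto_intros summable_LIMSEQ' g)
  then have "c \<le> suminf g * l + (suminf g - suminf g)"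
    by (rule tendsto_lowerbound) (use 1 in auto)
  then show ?thesis by simp
qed

section \<open>Transience and the two-point escape probability\<close>

text \<open>Telescopes: each term is at most the increment of \<open>- 2 / sqrt x\<close>, an
  antiderivative of \<open>x powr (- 3 / 2)\<close>.\<close>

lemma sum_inverse_three_halves_le:
  assumes "n > 0"
  shows "(\<Sum>k<m. 1 / (real (Suc (n + k)) * sqrt (real (Suc (n + k))))) \<le> 2 / sqrt (real n)"
proof -
  have "(\<Sum>k<m. 1 / (real (Suc (n + k)) * sqrt (real (Suc (n + k)))))
      \<le> 2 / sqrt (real n) - 2 / sqrt (real (n + m))"
  proof (induction m)
    case (Suc m)
    define x where "x = real (n + m)"
    have x: "x > 0" using assms by (simp add: x_def)
    have "sqrt x * sqrt (x + 1) * (sqrt (x + 1) + sqrt x) \<le> sqrt (x + 1) * sqrt (x + 1) * (2 * sqrt (x + 1))"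
      using x by (intro mult_mono) auto
    then have "sqrt x * sqrt (x + 1) * (sqrt (x + 1) + sqrt x) \<le> 2 * ((x + 1) * sqrt (x + 1))"
      using x by (simp add: mult_ac)
    then have "2 / (2 * ((x + 1) * sqrt (x + 1))) \<le> 2 / (sqrt x * sqrt (x + 1) * (sqrt (x + 1) + sqrt x))"
      using x by (intro divide_left_mono mult_pos_pos add_pos_pos) auto
    also have "\<dots> = 2 * ((sqrt (x + 1) + sqrt x) * (sqrt (x + 1) - sqrt x))
        / (sqrt x * sqrt (x + 1) * (sqrt (x + 1) + sqrt x))"
      using x by (simp add: algebra_simps)
    also have "\<dots> = 2 * (sqrt (x + 1) - sqrt x) / (sqrt x * sqrt (x + 1))"
      using x add_pos_pos[of "sqrt (x+1)" "sqrt x"] by simp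
    also have "\<dots> = 2 / sqrt x - 2 / sqrt (x + 1)"
      using x by (simp add: diff_divide_distrib right_diff_distrib)
    finally have "1 / ((x + 1) * sqrt (x + 1)) \<le> 2 / sqrt x - 2 / sqrt (x + 1)" by simp
    then show ?case using Suc by (simp add: x_def algebra_simps)
  qed auto
  also have "\<dots> \<le> 2 / sqrt (real n)" by simp
  finally show ?thesis .
qed

lemma Suc_0_le_of_bool_iff [simp]: "Suc 0 \<le> of_bool P \<longleftrightarrow> P"
  by (cases P) auto

text \<open>The exponent 3/2 is that of dimension three; higher dimensions satisfy the same bound.
  The maps in \<open>transitive\<close> are additive and hence fix the origin, so all steps are
  equivalent starting points for hitting it.\<close>

locale sym_steps = step_set U for U :: "'v::ab_group_add set" +
  fixes K :: real
  assumes neg_in_U: "\<And>e. e \<in> U \<Longrightarrow> - e \<in> U"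
    and transitive: "\<And>e e'. e \<in> U \<Longrightarrow> e' \<in> U \<Longrightarrow>
      \<exists>\<sigma>. (\<forall>v w. \<sigma> (v + w) = \<sigma> v + \<sigma> w) \<and> inj \<sigma> \<and> bij_betw \<sigma> U U \<and> \<sigma> e = e'"
    and heat_kernel: "\<And>n. occ {0} n 0 \<le> K / (real (Suc n) * sqrt (real (Suc n)))"
begin

definition \<gamma> :: real where "\<gamma> = lim esc"

lemma esc_le_1: "esc n \<le> 1"
  by (simp add: esc_def exactly_le_1)

lemma esc_tendsto: "esc \<longlonglongrightarrow> \<gamma>"
proof -
  have "convergent esc"
    by (rule Bseq_monoseq_convergent)
      (auto simp: Bseq_def monoseq_def esc_nonneg esc_le_1 intro!: exI[of _ 1] decseqD[OF esc_antimono])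
  then show ?thesis unfolding \<gamma>_def by (simp add: convergent_LIMSEQ_iff)
qed

lemma \<gamma>_le_esc: "\<gamma> \<le> esc n"
  by (rule decseq_ge[OF esc_antimono esc_tendsto])

section \<open>Green function and escape probability\<close>

lemma K_pos: "0 < K"
proof -
  have "1 \<le> K" using heat_kernel[of 0] by (simp add: occ_len_0)
  then show ?thesis by simp
qed

lemma sum_occ_bound: "(\<Sum>k<n. occ {0} k 0) \<le> 3 * K"
proof (cases n)
  case (Suc m)
  have "(\<Sum>k<n. occ {0} k 0) = 1 + (\<Sum>k<m. occ {0} (Suc k) 0)"
    unfolding Suc by (subst sum.lessThan_Suc_shift) (simp add: occ_len_0)
  also have "(\<Sum>k<m. occ {0} (Suc k) 0) \<le> (\<Sum>k<m. K * (1 / (real (Suc (1 + k)) * sqrt (real (Suc (1 + k))))))"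
    by (intro sum_mono) (use heat_kernel[of "Suc k" for k] in auto)
  also have "\<dots> \<le> K * (2 / sqrt (real 1))"
    unfolding sum_distrib_left[symmetric] using K_pos
    by (intro mult_left_mono sum_inverse_three_halves_le) auto
  also have "1 \<le> K" using heat_kernel[of 0] by (simp add: occ_len_0)
  finally show ?thesis by simp
qed (use K_pos in auto)

lemma summable_occ: "summable (\<lambda>k. occ {0} k 0)"
  using sum_occ_bound occ_nonneg by (intro summableI_nonneg_bounded) auto

text \<open>The Green function at the origin: the expected total number of visits.\<close>

definition G :: real where "G = (\<Sum>k. occ {0} k 0)"

lemma sum_occ_le_G: "(\<Sum>k\<le>n. occ {0} k 0) \<le> G"
  unfolding G_def by (intro sum_le_suminf summable_occ) (auto simp: occ_nonneg)

lemma one_eq_sum_occ_esc: "1 = (\<Sum>k\<le>n. occ {0} k 0 * esc (n - k))"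
  using last_visit[of "{0}" esc n 0] at_least_1_in[of 0 "{0}" n] by (simp add: esc_def)

text \<open>Limit of the last-visit identity, where \<open>esc (n - k)\<close> tends to \<gamma>.
  This half gives transience, \<open>0 < \<gamma>\<close>; the opposite inequality serves the
  two-point bound.\<close>

lemma G_\<gamma>_ge: "1 \<le> G * \<gamma>"
  unfolding G_def using one_eq_sum_occ_esc
  by (intro convolution_limit_le[of _ esc] summable_occ occ_nonneg esc_antimono esc_tendsto esc_le_1
      esc_nonneg) (metis order_refl)

lemma \<gamma>_G_le: "\<gamma> * G \<le> 1"
proof -
  have "\<gamma> * (\<Sum>k\<le>n. occ {0} k 0) \<le> 1" for n
    unfolding one_eq_sum_occ_esc[of n] sum_distrib_left
    by (intro sum_mono) (simp add: mult.commute[of \<gamma>] mult_left_mono occ_nonneg \<gamma>_le_esc)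
  moreover have "(\<lambda>n. \<gamma> * (\<Sum>k\<le>n. occ {0} k 0)) \<longlonglongrightarrow> \<gamma> * G"
    unfolding G_def by (intro tendsto_intros summable_LIMSEQ' summable_occ)
  ultimately show ?thesis by (intro LIMSEQ_le_const2) auto
qed

lemma G_pos: "0 < G"
  using sum_occ_le_G[of 0] by (simp add: occ_len_0)

lemma \<gamma>_pos: "0 < \<gamma>"
  using G_\<gamma>_ge G_pos by (metis less_le_trans zero_less_mult_pos zero_less_one)

lemma at_least_step_eq:
  assumes "e \<in> U" "e' \<in> U"
  shows "at_least {0} n e j = at_least {0} n e' j"
proof -
  obtain \<sigma> where \<sigma>: "\<And>v w. \<sigma> (v + w) = \<sigma> v + \<sigma> w" "inj \<sigma>" "bij_betw \<sigma> U U" "\<sigma> e = e'"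
    using transitive[OF assms] by auto
  have "\<sigma> 0 = 0" using \<sigma>(1)[of 0 0] by simp
  then have "at_least {0} n e' j = mean n (\<lambda>xs. of_bool (j \<le> visits (\<sigma> ` {0}) (\<sigma> e) xs))"
    using \<sigma>(4) by (simp add: at_least_def)
  also have "\<dots> = at_least {0} n e j"
    unfolding at_least_def by (rule mean_visits_image) (use \<sigma> in auto)
  finally show ?thesis by simp
qed

text \<open>By symmetry all terms of the average over the first step coincide, so each equals the
  return probability.\<close>

lemma at_least_step:
  assumes "e \<in> U"
  shows "at_least {0} n e 1 = 1 - esc (Suc n)"
proof -
  have "1 - esc (Suc n) = avg (\<lambda>e'. at_least {0} n e' 1)"
    using at_least_Suc_in[of 0 "{0}" n 1] by (simp add: esc_eq numeral_2_eq_2)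
  also have "\<dots> = avg (\<lambda>_. at_least {0} n e 1)"
    by (intro avg_cong at_least_step_eq assms)
  finally show ?thesis by simp
qed

text \<open>To reach \<open>0\<close> from outside, the walk has to pass through a neighbour of \<open>0\<close>.\<close>

lemma at_least_off_origin_le: "a \<noteq> 0 \<Longrightarrow> at_least {0} n a 1 \<le> 1 - esc (Suc n)"
proof (induction n arbitrary: a)
  case 0
  then show ?case using esc_le_1[of 1] by (simp add: at_least_len_0)
next
  case (Suc n)
  show ?case
  proof (cases "a \<in> U")
    case True
    then show ?thesis by (simp add: at_least_step del: One_nat_def)
  next
    case False
    have "a + e \<noteq> 0" if "e \<in> U" for e
      using neg_in_U[OF that] False by (metis add.inverse_unique minus_minus add.commute)
    then have "avg (\<lambda>e. at_least {0} n (a + e) 1) \<le> avg (\<lambda>_. 1 - esc (Suc n))"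
      by (intro avg_mono Suc.IH)
    also have "\<dots> \<le> 1 - esc (Suc (Suc n))"
      using decseqD[OF esc_antimono, of "Suc n" "Suc (Suc n)"] by simp
    finally show ?thesis using Suc.prems by (simp add: at_least_Suc_notin)
  qed
qed

lemma at_least_off_origin: "a \<noteq> 0 \<Longrightarrow> at_least {0} n a 1 \<le> 1 - \<gamma>"
  using at_least_off_origin_le[of a n] \<gamma>_le_esc[of "Suc n"] by linarith

lemma \<gamma>_less_1: "\<gamma> < 1"
proof -
  obtain e where e: "e \<in> U" using U_nonempty by blast
  have "1 - esc 2 = avg (\<lambda>e'. of_bool (e + e' = 0))"
  proof (cases "e = 0")
    case True
    \<comment> \<open>An additive \<open>\<sigma>\<close> maps \<open>0\<close> to \<open>0\<close>,
      so a zero step would be the only one.\<close>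
    have "\<And>e'. e' \<in> U \<Longrightarrow> e' = 0"
      using transitive[OF e] True
      by (metis add.right_neutral add_cancel_right_right)
    then have "avg (\<lambda>e'. of_bool (e + e' = 0)) = avg (\<lambda>_. 1)"
      using True by (intro avg_cong) auto
    then show ?thesis using True at_least_step[OF e, of 1] at_least_1_in[of 0 "{0}" 1]
      by (simp add: numeral_2_eq_2)
  next
    case False
    then show ?thesis using at_least_step[OF e, of 1] by (simp add: at_least_Suc_notin at_least_len_0 numeral_2_eq_2)
  qed
  \<comment> \<open>Of the average only the step back, \<open>- e\<close>, is kept.\<close>
  also have "\<dots> \<ge> (\<Sum>e'\<in>{-e}. of_bool (e + e' = 0)) / card U"
    unfolding avg_def using e neg_in_U card_U_pos finite_U
    by (intro divide_right_mono sum_mono2) auto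
  finally have "1 - esc 2 > 0" using card_U_pos
    by (smt (verit) divide_pos_pos of_nat_0_less_iff add.right_inverse of_bool_eq(2) sum.infinite
        sum.insert finite.emptyI empty_iff sum.empty finite.insertI)
  then show ?thesis using \<gamma>_le_esc[of 2] by linarith
qed

definition h :: real where "h = 1 - \<gamma>"

lemma h_pos: "0 < h" and h_less_1: "h < 1"
  using \<gamma>_less_1 \<gamma>_pos by (auto simp: h_def)

text \<open>Since \<open>\<gamma> * G = 1\<close> and \<open>2 - \<gamma> = 1 + h\<close>, the
  subtracted term is \<open>1 / ((1 + h) * G)\<close>, a lower bound for the probability of escape
  from two points.\<close>

definition \<rho> :: real where "\<rho> = 1 - \<gamma> / (2 - \<gamma>)"

lemma \<rho>_pos: "0 < \<rho>"
  using \<gamma>_less_1 \<gamma>_pos by (auto simp: \<rho>_def field_simps)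

text \<open>With \<open>\<rho> = 2 * h / (1 + h)\<close> the claim reduces to
  \<open>0 < (1 - h)^2\<close>.\<close>

lemma \<rho>_sq_less: "\<rho>\<^sup>2 < h"
proof -
  have "\<rho> = 2 * h / (1 + h)" using \<gamma>_less_1 by (simp add: \<rho>_def h_def field_simps)
  moreover have "(2 * h)\<^sup>2 < h * (1 + h)\<^sup>2"
  proof -
    have "0 < h * (1 - h)\<^sup>2" using h_pos h_less_1 by simp
    then show ?thesis by (simp add: power2_eq_square algebra_simps)
  qed
  ultimately show ?thesis using h_pos by (simp add: power_divide divide_less_eq)
qed

text \<open>The analogue of \<open>\<rho>_sq_less\<close> for Poisson thresholds of mean
  \<open>b\<close>: a pair contributes \<open>exp (- 2 * b * (1 - \<rho>))\<close>, a single point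
  \<open>exp (- \<gamma> * b)\<close>.\<close>

lemma two_gap: "\<gamma> < 2 * (1 - \<rho>)"
  using \<gamma>_less_1 \<gamma>_pos by (simp add: \<rho>_def field_simps)

text \<open>By the last visit to \<open>{x, y}\<close>, the escape probability from this set is the reciprocal of
  \<open>G(0) + G(y - x)\<close>; transitivity on the steps enters through \<open>G(y - x) \<le> h * G(0)\<close>.\<close>

lemma two_point_return:
  assumes xy: "x \<noteq> y" and a: "a \<in> {x, y}"
  shows "at_least {x, y} n a 2 \<le> \<rho>"
proof -
  let ?A = "{x, y}"
  define e where "e n = exactly ?A n x 1" for n
  have ey: "exactly ?A n y 1 = e n" for n
  proof -
    \<comment> \<open>Reflection in the midpoint exchanges \<open>x\<close> and \<open>y\<close>, so
      both have the same escape probability and \<open>last_visit\<close> applies.\<close>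
    let ?\<sigma> = "\<lambda>v. (x + y) - v"
    have 1: "mean n (\<lambda>xs. of_bool (visits (?\<sigma> ` ?A) (?\<sigma> x) xs = 1))
       = mean n (\<lambda>xs. of_bool (visits ?A x xs = 1))"
    proof (rule mean_visits_image[where \<tau>=uminus])
      show "bij_betw uminus U U"
        by (rule bij_betwI[where g=uminus]) (auto intro: neg_in_U)
    qed (auto simp: inj_def)
    have "?\<sigma> ` ?A = ?A" "?\<sigma> x = y" by auto
    with 1 show ?thesis by (simp add: exactly_def e_def)
  qed
  have e: "exactly ?A n b 1 = e n" if "b \<in> ?A" for n b
    using that ey by (auto simp: e_def)
  have at_least2: "at_least ?A n b 2 = 1 - e n" if "b \<in> ?A" for b n
    using at_least_split[of ?A n b 1] at_least_1_in[OF that] e[OF that] by (simp add: numeral_2_eq_2)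
  have dec: "decseq e"
  proof (rule decseq_SucI)
    fix n
    show "e (Suc n) \<le> e n"
      using at_least2[of x n] at_least2[of x "Suc n"] at_least_mono_len[of n "Suc n" ?A x 2] by simp
  qed
  have e01: "0 \<le> e n" "e n \<le> 1" for n by (auto simp: e_def exactly_nonneg exactly_le_1)
  have "convergent e"
    by (rule Bseq_monoseq_convergent)
      (auto simp: Bseq_def monoseq_def e01 intro!: exI[of _ 1] decseqD[OF dec])
  then obtain l where l: "e \<longlonglongrightarrow> l" by (auto simp: convergent_def)
  have occ_A: "occ ?A k x = occ {0} k 0 + occ {0} k (x - y)" for k
    unfolding occ_def mean_add[symmetric]
    by (rule mean_cong) (use xy in \<open>auto simp: algebra_simps\<close>)
  \<comment> \<open>The Green function at \<open>x - y\<close> is at most the hitting probability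
    times \<open>G\<close>, and hitting \<open>0\<close> from elsewhere has probability at most
    \<open>h\<close>.\<close>
  have off: "(\<Sum>k<n. occ {0} k (x - y)) \<le> h * G" for n
  proof (cases n)
    case (Suc m)
    have "(\<Sum>k\<le>m. occ {0} k (x - y)) \<le> at_least {0} m (x - y) 1 * (\<Sum>k\<le>m. occ {0} k 0)"
      by (rule sum_occ_le)
    also have "\<dots> \<le> h * G"
      using at_least_off_origin[of "x - y" m] xy h_pos
      by (intro mult_mono sum_occ_le_G sum_nonneg occ_nonneg) (auto simp: h_def)
    finally show ?thesis using Suc by (simp add: lessThan_Suc_atMost)
  qed (use h_pos G_pos in auto)
  have sm: "summable (\<lambda>k. occ {0} k (x - y))"
    by (rule summableI_nonneg_bounded[OF occ_nonneg off])
  have "suminf (\<lambda>k. occ {0} k (x - y)) \<le> h * G"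
    by (rule suminf_le_const[OF sm off])
  then have tot: "suminf (\<lambda>k. occ ?A k x) \<le> (1 + h) * G"
    unfolding occ_A by (subst suminf_add[symmetric]) (auto simp: summable_occ sm G_def algebra_simps)
  have "1 \<le> suminf (\<lambda>k. occ ?A k x) * l"
  proof (rule convolution_limit_le)
    show "summable (\<lambda>k. occ ?A k x)" unfolding occ_A by (intro summable_add summable_occ sm)
    show "1 \<le> (\<Sum>k\<le>n. occ ?A k x * e (n - k))" for n
      using last_visit[of ?A e n x, OF e] at_least_1_in[of x ?A n] by simp
  qed (use dec l e01 occ_nonneg in auto)
  also have l0: "0 \<le> l" using l e01 by (intro LIMSEQ_le_const) auto
  then have "suminf (\<lambda>k. occ ?A k x) * l \<le> (1 + h) * G * l" by (intro mult_right_mono tot)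
  finally have "1 \<le> (1 + h) * G * l" .
  then have "\<gamma> * 1 \<le> \<gamma> * ((1 + h) * G * l)" using \<gamma>_pos by (intro mult_left_mono) auto
  also have "\<dots> = (\<gamma> * G) * ((1 + h) * l)" by simp
  also have "\<dots> \<le> 1 * ((1 + h) * l)"
    using \<gamma>_G_le l0 h_pos by (intro mult_right_mono) auto
  finally have "\<gamma> / (2 - \<gamma>) \<le> l" using \<gamma>_less_1 by (simp add: h_def field_simps)
  also have "l \<le> e n" by (rule decseq_ge[OF dec l])
  finally show ?thesis using at_least2[OF a] by (simp add: \<rho>_def)
qed

lemma two_point_tail: "x \<noteq> y \<Longrightarrow> at_least {x, y} n a (Suc j) \<le> \<rho> ^ j"
  using at_least_geometric[of "{x, y}" \<rho> n a j] two_point_return[of x y] \<rho>_pos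
    mult_left_le[OF at_least_le_1[of "{x,y}" n a 1], of "\<rho> ^ j"] by (smt (verit) zero_le_power)

text \<open>From \<open>N\<close> to \<open>N + 1\<close> steps \<open>esc\<close> drops only
  through a first return at time \<open>N + 1\<close>, whose probability is at most that of being at
  the origin then. The claim is the tail sum of these return probabilities.\<close>

lemma esc_rate:
  assumes "n > 0"
  shows "esc n - \<gamma> \<le> 2 * K / sqrt (real n)"
proof -
  have 1: "at_least {0} (Suc N) a 1 \<le> at_least {0} N a 1 + occ {0} (Suc N) a" for N a
  proof (induction N arbitrary: a)
    case 0
    show ?case
    proof (cases "a = 0")
      case True
      then show ?thesis by (simp add: at_least_1_in[of 0 "{0}", simplified] occ_nonneg)
    next
      case False
      then show ?thesis by (simp add: at_least_Suc_notin occ_Suc occ_len_0 at_least_len_0)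
    qed
  next
    case (Suc N)
    show ?case
    proof (cases "a = 0")
      case True
      then show ?thesis by (simp add: at_least_1_in[of 0 "{0}", simplified] occ_nonneg)
    next
      case False
      have "avg (\<lambda>e. at_least {0} (Suc N) (a + e) 1) \<le> avg (\<lambda>e. at_least {0} N (a + e) 1 + occ {0} (Suc N) (a + e))"
        by (intro avg_mono Suc)
      then show ?thesis using False
        by (simp add: at_least_Suc_notin[of a "{0}"] occ_Suc[of _ "Suc N"] avg_add)
    qed
  qed
  have 2: "esc (Suc N) \<le> esc (Suc (Suc N)) + occ {0} (Suc (Suc N)) 0" for N
  proof -
    have "avg (\<lambda>e. at_least {0} (Suc N) (0 + e) 1) \<le> avg (\<lambda>e. at_least {0} N (0 + e) 1 + occ {0} (Suc N) (0 + e))"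
      by (intro avg_mono 1)
    then show ?thesis
      by (simp add: esc_eq numeral_2_eq_2 at_least_Suc_in occ_Suc[of _ "Suc N"] avg_add)
  qed
  have "esc n \<le> esc (n + m) + (\<Sum>k<m. occ {0} (Suc (n + k)) 0)" for m
  proof (induction m)
    case (Suc m)
    show ?case using Suc 2[of "n + m - 1"] assms by simp
  qed auto
  moreover have "(\<Sum>k<m. occ {0} (Suc (n + k)) 0) \<le> K * (2 / sqrt (real n))" for m
  proof -
    have "(\<Sum>k<m. occ {0} (Suc (n + k)) 0)
        \<le> (\<Sum>k<m. K * (1 / (real (Suc (n + k)) * sqrt (real (Suc (n + k))))))"
    proof (intro sum_mono)
      fix k
      let ?x = "real (Suc (n + k))"
      have "occ {0} (Suc (n + k)) 0 \<le> K / (real (Suc (Suc (n + k))) * sqrt (real (Suc (Suc (n + k)))))"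
        by (rule heat_kernel)
      also have "\<dots> \<le> K / (?x * sqrt ?x)"
        using K_pos by (intro divide_left_mono mult_mono mult_pos_pos) auto
      finally show "occ {0} (Suc (n + k)) 0 \<le> K * (1 / (?x * sqrt ?x))" by simp
    qed
    also have "\<dots> \<le> K * (2 / sqrt (real n))"
      unfolding sum_distrib_left[symmetric] using K_pos
      by (intro mult_left_mono sum_inverse_three_halves_le assms) auto
    finally show ?thesis .
  qed
  ultimately have "esc n - K * (2 / sqrt (real n)) \<le> esc (n + m)" for m
    by (smt (verit))
  then have "esc n - K * (2 / sqrt (real n)) \<le> \<gamma>"
    using LIMSEQ_ignore_initial_segment[OF esc_tendsto, of n]
    by (intro LIMSEQ_le_const[of "\<lambda>m. esc (m + n)"]) (auto simp: add.commute)
  then show ?thesis by simp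
qed

end

section \<open>Survival functionals\<close>

text \<open>Second Bonferroni inequality for independent events of probabilities \<open>f x\<close>.
  Summing over ordered pairs costs a factor 2 in the pair term.\<close>

lemma one_minus_prod_ge:
  fixes f :: "'a \<Rightarrow> real"
  assumes "finite S" "\<And>x. x \<in> S \<Longrightarrow> 0 \<le> f x \<and> f x \<le> 1"
  shows "1 - (\<Prod>x\<in>S. 1 - f x) \<ge> (\<Sum>x\<in>S. f x) - (\<Sum>x\<in>S. \<Sum>y\<in>S - {x}. f x * f y)"
  using assms
proof (induction S rule: finite_induct)
  case (insert a S)
  have 1: "(\<Prod>x\<in>S. 1 - f x) \<ge> 1 - (\<Sum>x\<in>S. f x)"
    using insert by (intro Weierstrass_prod_ineq) auto
  have 2: "(\<Sum>x\<in>insert a S. \<Sum>y\<in>insert a S - {x}. f x * f y)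
     = (\<Sum>x\<in>S. \<Sum>y\<in>S - {x}. f x * f y) + 2 * (\<Sum>y\<in>S. f a * f y)"
  proof -
    have "(\<Sum>y\<in>insert a S - {x}. f x * f y) = f x * f a + (\<Sum>y\<in>S - {x}. f x * f y)" if "x \<in> S" for x
    proof -
      have "insert a S - {x} = insert a (S - {x})" using that insert by auto
      then show ?thesis using insert by simp
    qed
    moreover have "insert a S - {a} = S" using insert by auto
    ultimately show ?thesis using insert
      by (simp add: sum.distrib mult.commute)
  qed
  have S0: "0 \<le> (\<Sum>y\<in>S. f a * f y)"
    by (intro sum_nonneg mult_nonneg_nonneg) (use insert in auto)
  have IH: "1 - (\<Prod>x\<in>S. 1 - f x) \<ge> (\<Sum>x\<in>S. f x) - (\<Sum>x\<in>S. \<Sum>y\<in>S - {x}. f x * f y)"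
    using insert by auto
  have "f a * (1 - (\<Sum>x\<in>S. f x)) \<le> f a * (\<Prod>x\<in>S. 1 - f x)"
    using 1 insert by (intro mult_left_mono) auto
  then have "f a - (\<Sum>y\<in>S. f a * f y) \<le> f a * (\<Prod>x\<in>S. 1 - f x)"
    by (simp add: right_diff_distrib sum_distrib_left)
  then show ?case using IH S0 insert unfolding 2 by (simp add: left_diff_distrib)
qed auto

context step_set
begin

section \<open>Sums and products over the visited points\<close>

primrec trail :: "'v \<Rightarrow> 'v list \<Rightarrow> 'v set" where
  "trail a [] = {a}"
| "trail a (e # xs) = insert a (trail (a + e) xs)"

lemma finite_trail [simp]: "finite (trail a xs)"
  by (induction xs arbitrary: a) auto

lemma visits_eq_0: "x \<notin> trail a xs \<Longrightarrow> visits {x} a xs = 0"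
  by (induction xs arbitrary: a) auto

lemma visits_le: "visits A a xs \<le> Suc (length xs)"
proof (induction xs arbitrary: a)
  case (Cons e xs)
  have "of_bool (a \<in> A) \<le> (1::nat)" by simp
  then show ?case using Cons[of "a + e"] by (simp del: One_nat_def)
qed auto

lemma visits_start_pos: "0 < visits {a} a xs"
  by (cases xs) auto

lemma visits_two: "x \<noteq> y \<Longrightarrow> visits {x, y} a xs = visits {x} a xs + visits {y} a xs"
  by (induction xs arbitrary: a) auto

lemma visits_start: "visits {a} a xs = visits {0} 0 xs"
  using visits_single_translate[of 0 0 xs a] by simp

text \<open>When \<open>g 0 = 0\<close> this is the sum over the whole space; the restriction to
  visited points makes it a finite sum.\<close>

definition tsum :: "(nat \<Rightarrow> real) \<Rightarrow> 'v \<Rightarrow> 'v list \<Rightarrow> real" where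
  "tsum g a xs = (\<Sum>x\<in>trail a xs. g (visits {x} a xs))"

lemma tsum_superset:
  assumes "g 0 = 0" "finite B" "trail a xs \<subseteq> B"
  shows "tsum g a xs = (\<Sum>x\<in>B. g (visits {x} a xs))"
  unfolding tsum_def by (rule sum.mono_neutral_left) (use assms visits_eq_0 in auto)

lemma tsum_Cons:
  assumes "g 0 = 0"
  shows "tsum g a (e # xs) = tsum g (a + e) xs
    + (g (visits {0} 0 (e # xs)) - g (visits {0} 0 (e # xs) - 1))"
proof -
  let ?T = "trail (a + e) xs"
  have v: "visits {a} (a + e) xs = visits {0} 0 (e # xs) - 1"
    using visits_start[of a "e # xs"] by simp
  have "tsum g a (e # xs) = (\<Sum>x\<in>insert a ?T. g (visits {x} a (e # xs)))"
    by (simp add: tsum_def)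
  also have "\<dots> = g (visits {a} a (e # xs)) + (\<Sum>x\<in>insert a ?T - {a}. g (visits {x} a (e # xs)))"
    by (subst sum.remove[of _ a]) auto
  also have "(\<Sum>x\<in>insert a ?T - {a}. g (visits {x} a (e # xs)))
      = (\<Sum>x\<in>insert a ?T - {a}. g (visits {x} (a + e) xs))"
    by (rule sum.cong) auto
  also have "(\<Sum>x\<in>insert a ?T - {a}. g (visits {x} (a + e) xs))
      = (\<Sum>x\<in>insert a ?T. g (visits {x} (a + e) xs)) - g (visits {a} (a + e) xs)"
    by (subst sum.remove[of "insert a ?T" a]) auto
  also have "(\<Sum>x\<in>insert a ?T. g (visits {x} (a + e) xs)) = tsum g (a + e) xs"
    by (rule tsum_superset[symmetric]) (use assms in auto)
  finally show ?thesis
    unfolding visits_start[of a] v by simp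
qed

text \<open>Adding a step in front of a path changes only the local time of the starting point.\<close>

lemma mean_tsum_increments:
  assumes "g 0 = 0"
  shows "mean n (tsum g a)
    = (\<Sum>k\<le>n. mean k (\<lambda>xs. g (visits {0} 0 xs) - g (visits {0} 0 xs - 1)))"
proof (induction n arbitrary: a)
  case 0
  show ?case using assms by (simp add: tsum_def)
next
  case (Suc n)
  have "mean (Suc n) (tsum g a) = avg (\<lambda>e. mean n (tsum g (a + e)))
      + mean (Suc n) (\<lambda>xs. g (visits {0} 0 xs) - g (visits {0} 0 xs - 1))"
    by (simp only: mean.simps tsum_Cons[of g, OF assms] mean_add avg_add)
  then show ?case by (simp add: Suc)
qed

text \<open>Peeling off steps from the front leaves a suffix of each length \<open>k\<close>, which
  contributes the increment of \<open>g\<close> at the local time of its own starting point; the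
  terms are then sorted by that local time \<open>i + 1\<close>. The formula is applied to
  \<open>1 - \<phi>\<close> and to \<open>- ln \<phi>\<close>.\<close>

lemma mean_tsum:
  assumes "g 0 = 0"
  shows "mean n (tsum g a)
    = (\<Sum>i\<le>n. (g (Suc i) - g i) * (\<Sum>k\<le>n. exactly {0} k 0 (Suc i)))"
proof -
  have "mean k (\<lambda>xs. g (visits {0} 0 xs) - g (visits {0} 0 xs - 1))
      = (\<Sum>i\<le>n. (g (Suc i) - g i) * exactly {0} k 0 (Suc i))" if "k \<le> n" for k
    unfolding exactly_def mean_cmult[symmetric] mean_sum[symmetric]
  proof (rule mean_cong)
    fix xs :: "'v list"
    assume xs: "length xs = k"
    obtain v where v: "visits {0} 0 xs = Suc v"
      using visits_start_pos[of 0 xs] by (cases "visits {0} 0 xs") auto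
    have "v \<le> n" using visits_le[of "{0}" 0 xs] xs that v by simp
    then show "g (visits {0} 0 xs) - g (visits {0} 0 xs - 1)
        = (\<Sum>i\<le>n. (g (Suc i) - g i) * of_bool (visits {0} 0 xs = Suc i))"
      unfolding v by (simp add: of_bool_def if_distrib cong: if_cong)
  qed
  then have "mean n (tsum g a) = (\<Sum>k\<le>n. \<Sum>i\<le>n. (g (Suc i) - g i) * exactly {0} k 0 (Suc i))"
    by (simp add: mean_tsum_increments[of g, OF assms])
  also have "\<dots> = (\<Sum>i\<le>n. \<Sum>k\<le>n. (g (Suc i) - g i) * exactly {0} k 0 (Suc i))"
    by (rule sum.swap)
  finally show ?thesis by (simp add: sum_distrib_left)
qed

definition surv :: "(nat \<Rightarrow> real) \<Rightarrow> 'v \<Rightarrow> 'v list \<Rightarrow> real" where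
  "surv \<phi> a xs = (\<Prod>x\<in>trail a xs. \<phi> (visits {x} a xs))"

lemma surv_superset:
  assumes "\<phi> 0 = 1" "finite B" "trail a xs \<subseteq> B"
  shows "surv \<phi> a xs = (\<Prod>x\<in>B. \<phi> (visits {x} a xs))"
  unfolding surv_def by (rule prod.mono_neutral_left) (use assms visits_eq_0 in auto)

lemma visits_append: "visits A a (xs @ e # ys) = visits A a xs + visits A (a + sum_list xs + e) ys"
  by (induction xs arbitrary: a) (auto simp: add.assoc)

lemma trail_append: "trail a (xs @ e # ys) = trail a xs \<union> trail (a + sum_list xs + e) ys"
  by (induction xs arbitrary: a) (auto simp: add.assoc)

lemma trail_translate: "trail (a + c) xs = (\<lambda>x. x + c) ` trail a xs"
proof (induction xs arbitrary: a)
  case (Cons e xs)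
  have "a + c + e = (a + e) + c" by (simp add: add_ac)
  then show ?case unfolding trail.simps using Cons[of "a + e"] by (simp only: image_insert)
qed auto

lemma surv_translate: "surv \<phi> (a + c) xs = surv \<phi> a xs"
  unfolding surv_def trail_translate
  by (subst prod.reindex) (auto simp: inj_on_def intro!: prod.cong simp: visits_single_translate[symmetric])

lemma surv_start: "surv \<phi> a xs = surv \<phi> 0 xs"
  using surv_translate[of \<phi> 0 a xs] by simp

end

text \<open>\<open>\<phi> j\<close> is the probability that a point with \<open>j\<close> visits stays below the level.\<close>

locale survival = step_set U for U :: "'v::ab_group_add set" +
  fixes \<phi> :: "nat \<Rightarrow> real"
  assumes \<phi>_0: "\<phi> 0 = 1" and \<phi>_nonneg: "\<And>i. 0 \<le> \<phi> i" and \<phi>_antimono: "decseq \<phi>"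
    and \<phi>_submult: "\<And>i j. \<phi> (i + j) \<le> \<phi> i * \<phi> j"
begin

lemma \<phi>_le_1: "\<phi> i \<le> 1"
  using decseqD[OF \<phi>_antimono, of 0 i] \<phi>_0 by simp

lemma surv_nonneg: "0 \<le> surv \<phi> a xs" and surv_le_1: "surv \<phi> a xs \<le> 1"
  unfolding surv_def by (auto intro: prod_nonneg prod_le_1 \<phi>_nonneg \<phi>_le_1)

text \<open>The joining step \<open>e\<close> belongs to neither piece, so that no time is counted
  twice. A point visited in both pieces is where submultiplicativity of \<open>\<phi>\<close>
  enters.\<close>

lemma surv_append_le: "surv \<phi> a (xs @ e # ys) \<le> surv \<phi> a xs * surv \<phi> 0 ys"
proof -
  let ?b = "a + sum_list xs + e"
  let ?T = "trail a xs \<union> trail ?b ys"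
  have "surv \<phi> a (xs @ e # ys) = (\<Prod>x\<in>?T. \<phi> (visits {x} a xs + visits {x} ?b ys))"
    by (simp add: surv_def trail_append visits_append)
  also have "\<dots> \<le> (\<Prod>x\<in>?T. \<phi> (visits {x} a xs) * \<phi> (visits {x} ?b ys))"
    by (intro prod_mono) (auto simp: \<phi>_nonneg \<phi>_submult)
  also have "\<dots> = surv \<phi> a xs * surv \<phi> ?b ys"
    unfolding prod.distrib by (subst (1 2) surv_superset[of _ ?T]) (auto simp: \<phi>_0)
  finally show ?thesis by (simp add: surv_start[of \<phi> ?b])
qed

section \<open>Decay of the survival probability in the number of steps\<close>

definition p :: "nat \<Rightarrow> real" where "p n = mean n (surv \<phi> 0)"

lemma p_nonneg: "0 \<le> p n" and p_le_1: "p n \<le> 1"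
  by (auto simp: p_def intro!: mean_nonneg mean_le_1 surv_nonneg surv_le_1)

lemma p_submult: "p (n + Suc m) \<le> p n * p m"
proof -
  have "p (n + Suc m) = mean n (\<lambda>xs. avg (\<lambda>e. mean m (\<lambda>ys. surv \<phi> 0 (xs @ e # ys))))"
    by (simp only: p_def mean_append mean.simps)
  also have "\<dots> \<le> mean n (\<lambda>xs. avg (\<lambda>e. mean m (\<lambda>ys. surv \<phi> 0 xs * surv \<phi> 0 ys)))"
    by (intro mean_mono avg_mono surv_append_le)
  also have "\<dots> = mean n (\<lambda>xs. p m * surv \<phi> 0 xs)"
    by (intro mean_cong) (simp add: mean_cmult p_def)
  also have "\<dots> = p m * p n"
    unfolding mean_cmult by (simp only: p_def)
  also have "\<dots> = p n * p m" by simp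
  finally show ?thesis .
qed

lemma p_antimono: "n \<le> m \<Longrightarrow> p m \<le> p n"
proof (induction m rule: dec_induct)
  case (step m)
  have "p (m + Suc 0) \<le> p m * p 0" by (rule p_submult)
  also have "\<dots> \<le> p m" using p_nonneg p_le_1 by (simp add: mult_left_le)
  finally show ?case using step by simp
qed auto

lemma p_power: "p (k * Suc L + L) \<le> p L ^ Suc k"
proof (induction k)
  case (Suc k)
  have "p (Suc k * Suc L + L) = p (L + Suc (k * Suc L + L))" by (simp add: add_ac)
  also have "\<dots> \<le> p L * p (k * Suc L + L)" by (rule p_submult)
  also have "\<dots> \<le> p L * p L ^ Suc k" by (intro mult_left_mono Suc p_nonneg)
  finally show ?case by simp
qed auto

text \<open>A block of \<open>L\<close> steps and the step that joins it to the next take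
  \<open>Suc L\<close> units of time, whence \<open>Suc L\<close> in the hypothesis; the loss
  \<open>real L\<close> accounts for the last, incomplete block.\<close>

lemma p_le_exp:
  assumes c: "c * real (Suc L) \<le> 1 - p L" and "0 \<le> c"
  shows "p n \<le> exp (- (c * (real n - real L)))"
proof (cases "L \<le> n")
  case True
  define q where "q = Suc n div Suc L"
  have q: "q \<noteq> 0" using True by (simp add: q_def div_eq_0_iff)
  then obtain k where k: "q = Suc k" by (cases q) auto
  have "q * Suc L \<le> Suc n" unfolding q_def by (rule div_times_less_eq_dividend)
  then have "k * Suc L + L \<le> n" by (simp add: k)
  then have "p n \<le> p L ^ q" using p_antimono p_power[of k L] by (metis k order_trans)
  also have "p L \<le> exp (- (1 - p L))"
    using exp_ge_add_one_self[of "- (1 - p L)"] by simp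
  then have "p L ^ q \<le> exp (- (1 - p L)) ^ q" by (intro power_mono p_nonneg)
  also have "\<dots> = exp (- ((1 - p L) * real q))" by (simp add: exp_of_nat_mult[symmetric] algebra_simps)
  also have "\<dots> \<le> exp (- (c * (real n - real L)))"
  proof -
    have "Suc n < Suc q * Suc L" unfolding q_def using dividend_less_div_times[of "Suc L" "Suc n"] by simp
    then have "n < q * Suc L + L" by simp
    then have "real n < real q * real (Suc L) + real L"
      by (metis of_nat_add of_nat_less_iff of_nat_mult)
    then have "c * (real n - real L) \<le> c * (real q * real (Suc L))"
      using assms by (intro mult_left_mono) auto
    also have "\<dots> = (c * real (Suc L)) * real q" by simp
    also have "\<dots> \<le> (1 - p L) * real q" by (intro mult_right_mono c) auto
    finally show ?thesis by simp
  qed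
  finally show ?thesis .
next
  case False
  then have "c * (real n - real L) \<le> 0" using assms by (intro mult_nonneg_nonpos) auto
  then show ?thesis using p_le_1[of n] by (smt (verit) one_le_exp_iff)
qed

end

locale sym_survival = sym_steps U K + survival U \<phi>
  for U :: "'v::ab_group_add set" and K \<phi>
begin

text \<open>The law of a random threshold \<open>N\<close>, possibly with mass at infinity, such
  that \<open>\<phi> v\<close> is the probability of \<open>v <= N\<close>: a point mass for the
  discrete walk, the Poisson law for the continuous one.\<close>

definition \<pi> :: "nat \<Rightarrow> real" where "\<pi> i = \<phi> i - \<phi> (Suc i)"

lemma \<pi>_nonneg: "0 \<le> \<pi> i"
  using decseqD[OF \<phi>_antimono, of i "Suc i"] by (simp add: \<pi>_def)

lemma one_minus_\<phi>: "1 - \<phi> v = (\<Sum>i<v. \<pi> i)"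
  by (induction v) (auto simp: \<phi>_0 \<pi>_def)

lemma one_minus_\<phi>_visits:
  "length xs = n \<Longrightarrow> 1 - \<phi> (visits A a xs) = (\<Sum>i\<le>n. \<pi> i * of_bool (i < visits A a xs))"
  unfolding one_minus_\<phi> using visits_le[of A a xs]
  by (intro sum.mono_neutral_cong_left) auto

text \<open>Exceeding thresholds \<open>i\<close> and \<open>j\<close> at two points takes more than
  \<open>i + j\<close> visits to the pair. The bound \<open>\<rho> ^ (i + j)\<close> factorises, so
  the double sum over independent thresholds is a square.\<close>

lemma pair_bound:
  assumes "x \<noteq> y"
  shows "mean n (\<lambda>xs. (1 - \<phi> (visits {x} 0 xs)) * (1 - \<phi> (visits {y} 0 xs)))
    \<le> (\<Sum>i\<le>n. \<pi> i * \<rho> ^ i)\<^sup>2"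
proof -
  have "mean n (\<lambda>xs. (1 - \<phi> (visits {x} 0 xs)) * (1 - \<phi> (visits {y} 0 xs)))
     = mean n (\<lambda>xs. \<Sum>i\<le>n. \<Sum>j\<le>n. (\<pi> i * \<pi> j) *
         of_bool (i < visits {x} 0 xs \<and> j < visits {y} 0 xs))"
    by (rule mean_cong)
      (simp add: one_minus_\<phi>_visits sum_product of_bool_conj mult_ac del: sum_mult_of_bool_eq)
  also have "\<dots> = (\<Sum>i\<le>n. \<Sum>j\<le>n. (\<pi> i * \<pi> j) *
      mean n (\<lambda>xs. of_bool (i < visits {x} 0 xs \<and> j < visits {y} 0 xs)))"
    by (simp only: mean_sum mean_cmult)
  also have "\<dots> \<le> (\<Sum>i\<le>n. \<Sum>j\<le>n. (\<pi> i * \<pi> j) * \<rho> ^ (i + j))"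
  proof (intro sum_mono mult_left_mono mult_nonneg_nonneg \<pi>_nonneg)
    fix i j
    have "mean n (\<lambda>xs. of_bool (i < visits {x} 0 xs \<and> j < visits {y} 0 xs)) \<le> at_least {x, y} n 0 (Suc (i + j))"
      unfolding at_least_def by (rule mean_mono) (auto simp: visits_two[OF assms])
    also have "\<dots> \<le> \<rho> ^ (i + j)" by (rule two_point_tail[OF assms])
    finally show "mean n (\<lambda>xs. of_bool (i < visits {x} 0 xs \<and> j < visits {y} 0 xs)) \<le> \<rho> ^ (i + j)" .
  qed
  also have "\<dots> = (\<Sum>i\<le>n. \<pi> i * \<rho> ^ i)\<^sup>2"
    by (simp add: power2_eq_square sum_product power_add mult_ac)
  finally show ?thesis .
qed

text \<open>In \<open>mean_tsum\<close> only thresholds up to \<open>J\<close> and suffixes longer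
  than \<open>J * s\<close> are kept; such a suffix leaves \<open>s\<close> steps for each return,
  and the final escape contributes the factor \<gamma>.\<close>

lemma one_point_bound:
  assumes "0 < s" "J * s \<le> n"
  shows "\<gamma> * real (n - J * s) * (\<Sum>i\<le>J. \<pi> i * (1 - esc s) ^ i) \<le> mean n (tsum (\<lambda>v. 1 - \<phi> v) 0)"
proof -
  let ?m = "J * s"
  have "J * 1 \<le> J * s" using assms(1) by (intro mult_le_mono) auto
  then have J: "J \<le> n" using assms(2) by linarith
  have "\<gamma> * real (n - ?m) * (\<Sum>i\<le>J. \<pi> i * (1 - esc s) ^ i)
      = (\<Sum>i\<le>J. \<pi> i * (\<Sum>k\<in>{?m<..n}. \<gamma> * (1 - esc s) ^ i))"
    by (simp add: sum_distrib_left mult_ac)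
  also have "\<dots> \<le> (\<Sum>i\<le>J. \<pi> i * (\<Sum>k\<in>{?m<..n}. exactly {0} k 0 (Suc i)))"
  proof (intro sum_mono mult_left_mono \<pi>_nonneg)
    fix i k assume i: "i \<in> {..J}" and k: "k \<in> {?m<..n}"
    have "i * s \<le> J * s" using i by (intro mult_le_mono1) simp
    then have "i * s \<le> k" using k unfolding greaterThanAtMost_iff by linarith
    then have "(1 - esc s) ^ i \<le> at_least {0} k 0 (Suc i)"
      using at_least_return_lower[OF assms(1), of i] at_least_mono_len by (metis order_trans)
    then have "\<gamma> * (1 - esc s) ^ i \<le> \<gamma> * at_least {0} k 0 (Suc i)"
      using \<gamma>_pos by (intro mult_left_mono) auto
    also have "\<dots> \<le> exactly {0} k 0 (Suc i)" by (intro exactly_ge \<gamma>_le_esc)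
    finally show "\<gamma> * (1 - esc s) ^ i \<le> exactly {0} k 0 (Suc i)" .
  qed
  also have "\<dots> \<le> (\<Sum>i\<le>J. \<pi> i * (\<Sum>k\<le>n. exactly {0} k 0 (Suc i)))"
    by (intro sum_mono mult_left_mono \<pi>_nonneg sum_mono2) (auto simp: exactly_nonneg)
  also have "\<dots> \<le> (\<Sum>i\<le>n. \<pi> i * (\<Sum>k\<le>n. exactly {0} k 0 (Suc i)))"
    using J by (intro sum_mono2) (auto intro!: mult_nonneg_nonneg sum_nonneg \<pi>_nonneg exactly_nonneg)
  also have "\<dots> = mean n (tsum (\<lambda>v. 1 - \<phi> v) 0)"
    by (subst mean_tsum) (simp_all add: \<phi>_0 \<pi>_def)
  finally show ?thesis .
qed

text \<open>The pair bound does not decay with the distance, so it is multiplied by the number of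
  pairs in a finite set \<open>B\<close> that contains every path of the block.\<close>

lemma block_bound:
  assumes "0 < s" "J * s \<le> n" and B: "finite B" "\<And>xs. length xs = n \<Longrightarrow> set xs \<subseteq> U \<Longrightarrow> trail 0 xs \<subseteq> B"
  shows "\<gamma> * real (n - J * s) * (\<Sum>i\<le>J. \<pi> i * (1 - esc s) ^ i)
      - (real (card B))\<^sup>2 * (\<Sum>i\<le>n. \<pi> i * \<rho> ^ i)\<^sup>2 \<le> 1 - p n"
proof -
  let ?\<psi> = "\<lambda>x xs. 1 - \<phi> (visits {x} 0 xs)"
  let ?R = "(\<Sum>i\<le>n. \<pi> i * \<rho> ^ i)\<^sup>2"
  have "mean n (\<lambda>xs. \<Sum>x\<in>B. \<Sum>y\<in>B - {x}. ?\<psi> x xs * ?\<psi> y xs) \<le> (\<Sum>x\<in>B. \<Sum>y\<in>B - {x}. ?R)"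
    unfolding mean_sum by (intro sum_mono pair_bound) auto
  also have "\<dots> \<le> (\<Sum>x\<in>B. \<Sum>y\<in>B. ?R)"
    by (intro sum_mono sum_mono2 B) auto
  also have "\<dots> = (real (card B))\<^sup>2 * ?R" by (simp add: power2_eq_square)
  finally have pairs: "mean n (\<lambda>xs. \<Sum>x\<in>B. \<Sum>y\<in>B - {x}. ?\<psi> x xs * ?\<psi> y xs) \<le> (real (card B))\<^sup>2 * ?R" .
  have "mean n (\<lambda>xs. tsum (\<lambda>v. 1 - \<phi> v) 0 xs - (\<Sum>x\<in>B. \<Sum>y\<in>B - {x}. ?\<psi> x xs * ?\<psi> y xs))
      \<le> mean n (\<lambda>xs. 1 - surv \<phi> 0 xs)"
  proof (rule mean_mono)
    fix xs :: "'v list"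
    assume "length xs = n" "set xs \<subseteq> U"
    then have tB: "trail 0 xs \<subseteq> B" by (rule B)
    show "tsum (\<lambda>v. 1 - \<phi> v) 0 xs - (\<Sum>x\<in>B. \<Sum>y\<in>B - {x}. ?\<psi> x xs * ?\<psi> y xs) \<le> 1 - surv \<phi> 0 xs"
      using one_minus_prod_ge[OF B(1), of "\<lambda>x. ?\<psi> x xs"] \<phi>_nonneg \<phi>_le_1
        tsum_superset[OF _ B(1) tB, of "\<lambda>v. 1 - \<phi> v"] surv_superset[of \<phi>, OF \<phi>_0 B(1) tB] \<phi>_0
      by simp
  qed
  then have "mean n (tsum (\<lambda>v. 1 - \<phi> v) 0)
       - mean n (\<lambda>xs. \<Sum>x\<in>B. \<Sum>y\<in>B - {x}. ?\<psi> x xs * ?\<psi> y xs) \<le> 1 - p n"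
    by (simp add: mean_diff p_def)
  then show ?thesis using pairs one_point_bound[OF assms(1,2)] by linarith
qed

text \<open>\<open>sum_exactly_le\<close> bounds the first moment from above: \<open>h ^ i\<close>
  stands for the \<open>i\<close> returns and the sum of \<open>esc\<close> for the last escape. The
  logarithms require \<open>\<phi>\<close> to be positive.\<close>

lemma p_ge_exp:
  assumes pos: "\<And>i. 0 < \<phi> i"
  shows "exp (- ((\<Sum>k\<le>n. esc k) * (\<Sum>i\<le>n. (ln (\<phi> i) - ln (\<phi> (Suc i))) * h ^ i))) \<le> p n"
proof -
  let ?f = "\<lambda>v. - ln (\<phi> v)"
  have "mean n (tsum ?f 0) \<le> (\<Sum>i\<le>n. (?f (Suc i) - ?f i) * (h ^ i * (\<Sum>k\<le>n. esc k)))"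
  proof (subst mean_tsum, simp add: \<phi>_0, intro sum_mono mult_left_mono)
    fix i
    have "(\<Sum>k\<le>n. exactly {0} k 0 (Suc i)) \<le> h ^ i * (\<Sum>k\<le>n. esc k) * at_least {0} n 0 1"
      by (rule sum_exactly_le) (simp add: h_def \<gamma>_le_esc)
    then show "(\<Sum>k\<le>n. exactly {0} k 0 (Suc i)) \<le> h ^ i * (\<Sum>k\<le>n. esc k)"
      using at_least_1_in[of 0 "{0}" n] by simp
    show "0 \<le> - ln (\<phi> (Suc i)) - - ln (\<phi> i)"
      using decseqD[OF \<phi>_antimono, of i "Suc i"] pos by simp
  qed
  also have "\<dots> = (\<Sum>k\<le>n. esc k) * (\<Sum>i\<le>n. (ln (\<phi> i) - ln (\<phi> (Suc i))) * h ^ i)"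
    unfolding sum_distrib_left[of "\<Sum>k\<le>n. esc k"] by (intro sum.cong) auto
  finally have "mean n (tsum ?f 0) \<le> (\<Sum>k\<le>n. esc k) * (\<Sum>i\<le>n. (ln (\<phi> i) - ln (\<phi> (Suc i))) * h ^ i)" .
  then have "exp (- ((\<Sum>k\<le>n. esc k) * (\<Sum>i\<le>n. (ln (\<phi> i) - ln (\<phi> (Suc i))) * h ^ i)))
      \<le> exp (mean n (\<lambda>xs. - tsum ?f 0 xs))"
    using mean_cmult[of n "-1" "tsum ?f 0"] by simp
  also have "\<dots> \<le> mean n (\<lambda>xs. exp (- tsum ?f 0 xs))" by (rule mean_jensen)
  also have "\<dots> = p n"
    unfolding p_def
    by (rule mean_cong) (simp add: surv_def tsum_def sum_negf exp_sum exp_ln[OF pos])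
  finally show ?thesis .
qed

end

section \<open>Asymptotics of the survival probability\<close>

locale lattice_steps = sym_steps U K for U :: "'v::ab_group_add set" and K +
  fixes D :: nat
  assumes growth: "\<exists>B. finite B \<and> card B \<le> (2 * n + 1) ^ D \<and>
    (\<forall>xs. length xs = n \<longrightarrow> set xs \<subseteq> U \<longrightarrow> trail 0 xs \<subseteq> B)"
begin

text \<open>With \<open>\<kappa> ^ 3\<close> steps for a return, \<open>1 - esc\<close> differs from
  \<open>h\<close> by a relative error of order \<open>\<kappa> powr (- 3 / 2)\<close>; by
  Bernoulli's inequality up to \<open>\<kappa>\<close> such factors lose at most order
  \<open>1 / sqrt \<kappa>\<close>.\<close>

lemma esc_power_ge:
  assumes "0 < \<kappa>" "i \<le> \<kappa>"
  shows "h ^ i * (1 - 2 * K / (h * sqrt (real \<kappa>))) \<le> (1 - esc (\<kappa> ^ 3)) ^ i"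
proof -
  define x where "x = (esc (\<kappa> ^ 3) - \<gamma>) / h"
  have esch: "1 - esc (\<kappa> ^ 3) = h * (1 - x)"
  proof -
    have "h * x = esc (\<kappa> ^ 3) - \<gamma>" using h_pos by (simp add: x_def)
    then show ?thesis by (simp add: right_diff_distrib) (simp add: h_def)
  qed
  have "0 \<le> h * (1 - x)" unfolding esch[symmetric] using esc_le_1 by simp
  then have x1: "x \<le> 1" using h_pos by (simp add: zero_le_mult_iff)
  have x0: "0 \<le> x" using \<gamma>_le_esc h_pos by (simp add: x_def)
  have "real i * x \<le> real \<kappa> * x" using assms x0 by (intro mult_right_mono) auto
  also have "\<dots> \<le> real \<kappa> * ((2 * K / sqrt (real (\<kappa> ^ 3))) / h)"
    unfolding x_def using h_pos assms by (intro mult_left_mono divide_right_mono esc_rate) auto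
  also have "sqrt (real (\<kappa> ^ 3)) = real \<kappa> * sqrt (real \<kappa>)"
    by (simp add: power3_eq_cube real_sqrt_mult)
  also have "real \<kappa> * ((2 * K / (real \<kappa> * sqrt (real \<kappa>))) / h) = 2 * K / (h * sqrt (real \<kappa>))"
    using assms by simp
  finally have "1 - 2 * K / (h * sqrt (real \<kappa>)) \<le> 1 + real i * (- x)" by simp
  also have "\<dots> \<le> (1 + (- x)) ^ i"
    using x1 by (intro Bernoulli_inequality) auto
  finally have "h ^ i * (1 - 2 * K / (h * sqrt (real \<kappa>))) \<le> h ^ i * (1 - x) ^ i"
    using h_pos by (intro mult_left_mono) auto
  then show ?thesis unfolding esch power_mult_distrib .
qed

text \<open>Blocks of length \<open>\<kappa> ^ 5\<close>, in which a point is given the time \<open>\<kappa> ^ 4\<close> to collect its local time.\<close>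

lemma p_upper_asymp:
  fixes \<phi> :: "'b \<Rightarrow> nat \<Rightarrow> real" and Q R :: "'b \<Rightarrow> real" and \<kappa> :: "'b \<Rightarrow> nat"
  assumes surv: "\<forall>\<^sub>F b in F. survival U (\<phi> b)"
    and \<kappa>: "filterlim \<kappa> at_top F"
    and Q: "\<forall>\<^sub>F b in F. 0 < Q b"
    and main: "\<And>\<epsilon>. 0 < \<epsilon> \<Longrightarrow>
      \<forall>\<^sub>F b in F. (1 - \<epsilon>) * Q b \<le> (\<Sum>i\<le>\<kappa> b. (\<phi> b i - \<phi> b (Suc i)) * h ^ i)"
    and R: "\<forall>\<^sub>F b in F. \<forall>n. (\<Sum>i\<le>n. (\<phi> b i - \<phi> b (Suc i)) * \<rho> ^ i) \<le> R b"
    and RQ: "\<And>N. ((\<lambda>b. real (\<kappa> b) ^ N * (R b)\<^sup>2 / Q b) \<longlongrightarrow> 0) F"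
    and \<epsilon>: "0 < \<epsilon>" "\<epsilon> < 1"
  shows "\<forall>\<^sub>F b in F. \<forall>n.
    mean n (surv (\<phi> b) 0) \<le> exp (- ((1 - \<epsilon>) * \<gamma> * Q b * (real n - real (\<kappa> b ^ 5))))"
proof -
  define C where "C = 2 * K / h"
  \<comment> \<open>The share of a block that counts: \<open>k ^ 4\<close> of its
    \<open>k ^ 5\<close> steps leave too little time for the returns, the factor with
    \<open>C\<close> is the loss in \<open>esc_power_ge\<close>, and \<open>k ^ 5 + 1\<close> is the
    block with its joining step.\<close>
  define r where "r k = (k ^ 5 - k ^ 4) * (1 - C / sqrt k) / (k ^ 5 + 1)" for k :: real
  have "(r \<longlongrightarrow> 1) at_top" unfolding r_def by real_asymp
  then have "((\<lambda>b. r (real (\<kappa> b))) \<longlongrightarrow> 1) F"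
    by (rule filterlim_compose) (rule filterlim_compose[OF filterlim_real_sequentially \<kappa>])
  then have "\<forall>\<^sub>F b in F. r (real (\<kappa> b)) > 1 - \<epsilon> / 3"
    by (rule order_tendstoD) (use \<epsilon> in auto)
  \<comment> \<open>The paths of \<open>k ^ 5\<close> steps stay in a set of at most
    \<open>(2 * k ^ 5 + 1) ^ D <= k ^ (6 * D)\<close> points, and pairs square this number.\<close>
  moreover have "\<forall>\<^sub>F b in F. real (\<kappa> b) ^ (12 * D) * (R b)\<^sup>2 / Q b < \<epsilon> / 3 * \<gamma>"
    using RQ by (rule order_tendstoD) (use \<epsilon> \<gamma>_pos in auto)
  moreover have "\<forall>\<^sub>F b in F. 3 \<le> \<kappa> b" "\<forall>\<^sub>F b in F. nat \<lceil>C\<^sup>2\<rceil> \<le> \<kappa> b"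
    using \<kappa> unfolding filterlim_at_top by blast+
  moreover have "\<forall>\<^sub>F b in F. (1 - \<epsilon> / 3) * Q b \<le> (\<Sum>i\<le>\<kappa> b. (\<phi> b i - \<phi> b (Suc i)) * h ^ i)"
    using main[of "\<epsilon> / 3"] \<epsilon> by simp
  ultimately show ?thesis using surv Q R
  proof eventually_elim
    case (elim b)
    interpret survival U "\<phi> b" by (rule elim)
    interpret sym_survival U K "\<phi> b" ..
    define k where "k = \<kappa> b"
    define L where "L = k ^ 5"
    have k3: "3 \<le> k" using elim by (simp add: k_def)
    have sk: "0 \<le> 1 - C / sqrt (real k)"
    proof -
      have "C\<^sup>2 \<le> real k" using elim unfolding k_def by linarith
      then have "C \<le> sqrt (real k)" by (rule real_le_rsqrt)
      then show ?thesis using k3 by simp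
    qed
    have "k ^ 4 \<le> L" unfolding L_def using k3 by (intro power_increasing) auto
    have sum_esc: "(1 - \<epsilon> / 3) * Q b * (1 - C / sqrt (real k)) \<le> (\<Sum>i\<le>k. \<pi> i * (1 - esc (k ^ 3)) ^ i)"
    proof -
      have "(1 - \<epsilon> / 3) * Q b * (1 - C / sqrt (real k)) \<le> (\<Sum>i\<le>k. \<pi> i * h ^ i) * (1 - C / sqrt (real k))"
        using elim sk by (intro mult_right_mono) (auto simp: \<pi>_def k_def)
      also have "\<dots> = (\<Sum>i\<le>k. \<pi> i * (h ^ i * (1 - 2 * K / (h * sqrt (real k)))))"
        by (simp add: sum_distrib_right C_def mult.assoc)
      also have "\<dots> \<le> (\<Sum>i\<le>k. \<pi> i * (1 - esc (k ^ 3)) ^ i)"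
        using k3 by (intro sum_mono mult_left_mono esc_power_ge \<pi>_nonneg) auto
      finally show ?thesis .
    qed
    obtain B where B: "finite B" "card B \<le> (2 * L + 1) ^ D"
      "\<And>xs. length xs = L \<Longrightarrow> set xs \<subseteq> U \<Longrightarrow> trail 0 xs \<subseteq> B"
      using growth[of L] by metis
    have "k * k ^ 3 = k ^ 4" by (simp add: power_Suc[symmetric] del: power_Suc)
    have block: "\<gamma> * real (L - k ^ 4) * (\<Sum>i\<le>k. \<pi> i * (1 - esc (k ^ 3)) ^ i)
        - (real (card B))\<^sup>2 * (\<Sum>i\<le>L. \<pi> i * \<rho> ^ i)\<^sup>2 \<le> 1 - p L"
      using block_bound[of "k ^ 3" k L B] \<open>k * k ^ 3 = k ^ 4\<close> \<open>k ^ 4 \<le> L\<close> k3 B by simp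
    have "card B \<le> k ^ (6 * D)"
    proof -
      have "2 * k ^ 5 + 1 \<le> 3 * k ^ 5" using k3 by simp
      also have "\<dots> \<le> k * k ^ 5" using k3 by (intro mult_right_mono) auto
      also have "\<dots> = k ^ 6" by (simp add: power_Suc[symmetric] del: power_Suc)
      finally have "(2 * L + 1) ^ D \<le> (k ^ 6) ^ D" unfolding L_def by (intro power_mono) auto
      then show ?thesis using B(2) by (simp add: power_mult)
    qed
    then have "(real (card B))\<^sup>2 \<le> (real (k ^ (6 * D)))\<^sup>2" by (intro power_mono) auto
    also have "\<dots> = real k ^ (12 * D)" by (simp flip: power_mult)
    finally have cardB: "(real (card B))\<^sup>2 \<le> real k ^ (12 * D)" .
    have "(real (card B))\<^sup>2 * (\<Sum>i\<le>L. \<pi> i * \<rho> ^ i)\<^sup>2 \<le> real k ^ (12 * D) * (R b)\<^sup>2"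
      using cardB elim(8) \<pi>_nonneg \<rho>_pos
      by (intro mult_mono power_mono sum_nonneg) (auto simp: \<pi>_def intro!: mult_nonneg_nonneg)
    also have "\<dots> \<le> \<epsilon> / 3 * \<gamma> * Q b"
      using elim(2,7) by (simp add: k_def field_simps)
    finally have pairs: "(real (card B))\<^sup>2 * (\<Sum>i\<le>L. \<pi> i * \<rho> ^ i)\<^sup>2 \<le> \<epsilon> / 3 * \<gamma> * Q b" .
    \<comment> \<open>One third of \<epsilon> each goes to \<open>main\<close>, to the factor
      \<open>r\<close> and to the pairs.\<close>
    have "(1 - \<epsilon>) * \<gamma> * Q b * real (Suc L) \<le> ((1 - \<epsilon> / 3) * (1 - \<epsilon> / 3) - \<epsilon> / 3) * \<gamma> * Q b * real (Suc L)"
      using \<epsilon> \<gamma>_pos elim(7) by (intro mult_right_mono) (auto simp: field_simps)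
    also have "\<dots> = (1 - \<epsilon> / 3) * (\<gamma> * Q b) * ((1 - \<epsilon> / 3) * real (Suc L)) - \<epsilon> / 3 * \<gamma> * Q b * real (Suc L)"
      by (simp add: algebra_simps)
    also have "\<dots> \<le> (1 - \<epsilon> / 3) * (\<gamma> * Q b) * (r (real k) * real (Suc L)) - \<epsilon> / 3 * \<gamma> * Q b"
    proof (intro diff_mono mult_left_mono mult_right_mono)
      show "1 - \<epsilon> / 3 \<le> r (real k)" using elim(1) by (simp add: k_def)
      show "\<epsilon> / 3 * \<gamma> * Q b \<le> \<epsilon> / 3 * \<gamma> * Q b * real (Suc L)"
        using \<epsilon> \<gamma>_pos elim(7) mult_left_mono[of 1 "real (Suc L)" "\<epsilon> / 3 * \<gamma> * Q b"] by simp
    qed (use \<epsilon> \<gamma>_pos elim(7) in auto)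
    also have "r (real k) * real (Suc L) = (real L - real (k ^ 4)) * (1 - C / sqrt (real k))"
    proof -
      have "real k ^ 5 + 1 > 0" by (simp add: add_nonneg_pos)
      then show ?thesis by (simp add: r_def L_def add.commute)
    qed
    also have "real L - real (k ^ 4) = real (L - k ^ 4)"
      using \<open>k ^ 4 \<le> L\<close> by (simp only: of_nat_diff)
    also have "(1 - \<epsilon> / 3) * (\<gamma> * Q b) * (real (L - k ^ 4) * (1 - C / sqrt (real k)))
       = \<gamma> * real (L - k ^ 4) * ((1 - \<epsilon> / 3) * Q b * (1 - C / sqrt (real k)))"
      by (simp add: mult_ac)
    also have "\<dots> \<le> \<gamma> * real (L - k ^ 4) * (\<Sum>i\<le>k. \<pi> i * (1 - esc (k ^ 3)) ^ i)"
      using \<gamma>_pos by (intro mult_left_mono sum_esc) auto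
    also have "\<dots> - \<epsilon> / 3 * \<gamma> * Q b \<le> 1 - p L"
      using block pairs by linarith
    finally have "(1 - \<epsilon>) * \<gamma> * Q b * real (Suc L) \<le> 1 - p L" by simp
    then have "p n \<le> exp (- ((1 - \<epsilon>) * \<gamma> * Q b * (real n - real L)))" for n
      using \<epsilon> \<gamma>_pos elim(7) by (intro p_le_exp) auto
    then show ?case by (simp add: p_def L_def k_def)
  qed
qed

text \<open>The parameter is the threshold itself: one point contributes \<open>h ^ k\<close>, a
  pair \<open>\<rho> ^ (2 * k)\<close>, and by \<open>\<rho>_sq_less\<close> their ratio decays
  faster than powers of \<open>k\<close> grow.\<close>

lemma unit_upper:
  assumes \<epsilon>: "0 < \<epsilon>" "\<epsilon> < 1"
  shows "\<forall>\<^sub>F k in sequentially. \<forall>n.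
    mean n (surv (\<lambda>j. of_bool (j \<le> k)) 0) \<le> exp (- ((1 - \<epsilon>) * \<gamma> * h ^ k * (real n - real (k ^ 5))))"
proof (rule p_upper_asymp[where R="\<lambda>k. \<rho> ^ k"])
  have inc: "of_bool (i \<le> k) - of_bool (Suc i \<le> k) = (of_bool (i = k) :: real)" for i k :: nat
    by auto
  show "\<forall>\<^sub>F k in sequentially. survival U (\<lambda>j. of_bool (j \<le> k))"
    by (intro always_eventually allI) (unfold_locales, auto simp: decseq_def)
  show "\<forall>\<^sub>F k in sequentially. 0 < h ^ k" using h_pos by simp
  show "\<forall>\<^sub>F k in sequentially. (1 - \<epsilon>) * h ^ k
      \<le> (\<Sum>i\<le>k. (of_bool (i \<le> k) - of_bool (Suc i \<le> k)) * h ^ i)" if "0 < \<epsilon>" for \<epsilon>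
    unfolding inc using that h_pos by (auto simp: algebra_simps)
  show "\<forall>\<^sub>F k in sequentially. \<forall>n. (\<Sum>i\<le>n. (of_bool (i \<le> k) - of_bool (Suc i \<le> k)) * \<rho> ^ i) \<le> \<rho> ^ k"
  proof (intro always_eventually allI)
    fix k n :: nat
    have "{..n} \<inter> {i. i = k} = (if k \<le> n then {k} else {})" by auto
    then show "(\<Sum>i\<le>n. (of_bool (i \<le> k) - of_bool (Suc i \<le> k)) * \<rho> ^ i) \<le> \<rho> ^ k"
      unfolding inc using \<rho>_pos by simp
  qed
  show "(\<lambda>k. real k ^ N * (\<rho> ^ k)\<^sup>2 / h ^ k) \<longlonglongrightarrow> 0" for N
  proof -
    define q where "q = \<rho>\<^sup>2 / h"
    have q: "0 < q" "q < 1" using \<rho>_pos h_pos \<rho>_sq_less by (auto simp: q_def)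
    have "(\<lambda>k. real k ^ N * exp (real k * ln q)) \<longlonglongrightarrow> 0"
      using q by (real_asymp)
    moreover have "real k ^ N * (\<rho> ^ k)\<^sup>2 / h ^ k = real k ^ N * exp (real k * ln q)" for k
      using q by (simp add: exp_of_nat_mult q_def power_divide power_mult[symmetric] mult.commute)
    ultimately show ?thesis by simp
  qed
qed (use \<epsilon> in \<open>auto simp: filterlim_ident\<close>)


text \<open>The Cesaro means of \<open>esc\<close> have the same limit \<gamma>.\<close>

lemma sum_esc_upper:
  assumes "0 < \<epsilon>"
  shows "\<forall>\<^sub>F n in sequentially. (\<Sum>k\<le>n. esc k) \<le> (1 + \<epsilon>) * \<gamma> * real n"
proof -
  have "0 < \<epsilon> * \<gamma> / 2" using assms \<gamma>_pos by simp
  define c where "c = \<gamma> + \<epsilon> * \<gamma> / 2"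
  have "0 < c" using \<open>0 < \<epsilon> * \<gamma> / 2\<close> \<gamma>_pos by (simp add: c_def)
  then have "\<forall>\<^sub>F n in sequentially. esc n < c"
    using order_tendstoD(2)[OF esc_tendsto, of c] \<open>0 < \<epsilon> * \<gamma> / 2\<close> by (simp add: c_def)
  then obtain N where N: "\<And>n. n \<ge> N \<Longrightarrow> esc n < c"
    by (auto simp: eventually_sequentially)
  have bound: "(\<Sum>k\<le>n. esc k) \<le> real N + c * (real n + 1)" for n
  proof (induction n)
    case 0
    show ?case
    proof (cases "N = 0")
      case True
      then show ?thesis using N[of 0] by simp
    next
      case False
      then have "1 \<le> real N" by simp
      then show ?thesis using esc_le_1[of 0] \<open>0 < c\<close> by simp
    qed
  next
    case (Suc n)
    show ?case
    proof (cases "N \<le> Suc n")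
      case True
      then show ?thesis using N[OF True] Suc by (simp add: algebra_simps)
    next
      case False
      have "(\<Sum>k\<le>Suc n. esc k) \<le> (\<Sum>k\<le>Suc n. 1)" by (intro sum_mono esc_le_1)
      also have "\<dots> \<le> real N" using False by simp
      also have "\<dots> \<le> real N + c * (real (Suc n) + 1)"
        using \<open>0 < c\<close> by simp
      finally show ?thesis .
    qed
  qed
  define B where "B = real N + c"
  have "\<forall>\<^sub>F n in sequentially. B \<le> (\<epsilon> * \<gamma> / 2) * real n"
  proof -
    have "\<forall>\<^sub>F n in sequentially. B / (\<epsilon> * \<gamma> / 2) \<le> real n"
      using filterlim_real_sequentially by (auto simp: filterlim_at_top)
    then show ?thesis
      using \<open>0 < \<epsilon> * \<gamma> / 2\<close> by (auto elim!: eventually_mono simp: field_simps)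
  qed
  then show ?thesis
  proof eventually_elim
    case (elim n)
    have "(1 + \<epsilon>) * \<gamma> * real n = c * real n + (\<epsilon> * \<gamma> / 2) * real n"
      by (simp add: c_def field_simps)
    moreover have "c * (real n + 1) = c * real n + c" by (simp add: distrib_left)
    ultimately show ?case using bound[of n] elim unfolding B_def by linarith
  qed
qed

end

section \<open>Poisson weights and their large deviations\<close>

definition poisson_tail :: "real \<Rightarrow> nat \<Rightarrow> real" where
  "poisson_tail b j = 1 - (\<Sum>i<j. exp (- b) * b ^ i / fact i)"

lemma poisson_tail_diff: "poisson_tail b i - poisson_tail b (Suc i) = exp (- b) * b ^ i / fact i"
  by (simp add: poisson_tail_def)

lemma exp_series: "(\<lambda>i. x ^ i / fact i) sums exp (x :: real)"
  using exp_converges[of x] by (simp add: field_simps)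

text \<open>The generating function of the Poisson law. At \<open>x = h\<close> and
  \<open>x = \<rho>\<close> it averages the return bounds over the threshold; at
  \<open>x = c\<close> it is the exponential moment of the Chernoff bounds.\<close>

lemma poisson_series_le:
  assumes "0 \<le> b" "0 \<le> (x :: real)"
  shows "(\<Sum>i\<in>{..<j}. exp (- b) * b ^ i / fact i * x ^ i) \<le> exp (- (b * (1 - x)))"
proof -
  have "(\<Sum>i<j. exp (- b) * b ^ i / fact i * x ^ i) = exp (- b) * (\<Sum>i<j. (b * x) ^ i / fact i)"
    unfolding sum_distrib_left by (intro sum.cong) (simp_all add: power_mult_distrib)
  also have "(\<Sum>i<j. (b * x) ^ i / fact i) \<le> exp (b * x)"
    using assms exp_series[of "b * x"] by (subst sums_unique[OF exp_series])
      (intro sum_le_suminf, auto simp: sums_iff)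
  also have "exp (- b) * exp (b * x) = exp (- (b * (1 - x)))"
    by (simp add: algebra_simps flip: exp_add)
  finally show ?thesis by simp
qed

lemma poisson_tail_pos:
  assumes "0 < b"
  shows "0 < poisson_tail b j"
proof -
  have "(\<Sum>i<Suc j. exp (- b) * b ^ i / fact i) \<le> 1"
    using poisson_series_le[of b 1 "Suc j"] assms by simp
  moreover have "0 < exp (- b) * b ^ j / fact j" using assms by simp
  ultimately show ?thesis by (simp add: poisson_tail_def)
qed

lemma one_minus_poisson_tail_le:
  assumes "0 < b" "0 < c" "c < 1" "real j \<le> c * b"
  shows "1 - poisson_tail b j \<le> exp (- (b * (1 - c + c * ln c)))"
proof -
  \<comment> \<open>Chernoff bound: for \<open>i < j\<close> and \<open>c < 1\<close> the inserted
    factor \<open>c ^ i * (1 / c) ^ j\<close> is at least 1.\<close>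
  have "1 - poisson_tail b j \<le> (\<Sum>i<j. exp (- b) * b ^ i / fact i * (c ^ i * (1 / c) ^ j))"
    unfolding poisson_tail_def
  proof (simp, intro sum_mono)
    fix i assume "i \<in> {..<j}"
    then have "j = i + (j - i)" by simp
    then have "(1 / c) ^ j = (1 / c) ^ i * (1 / c) ^ (j - i)" by (metis power_add)
    moreover have "1 \<le> (1 / c) ^ (j - i)" using assms by (intro one_le_power) simp
    ultimately have "1 \<le> c ^ i * (1 / c) ^ j" using assms by (simp add: power_divide)
    then have "exp (- b) * b ^ i / fact i * 1 \<le> exp (- b) * b ^ i / fact i * (c ^ i * (1 / c) ^ j)"
      using assms by (intro mult_left_mono) auto
    then show "exp (- b) * b ^ i / fact i \<le> exp (- b) * b ^ i * (c ^ i * (1 / c) ^ j) / fact i"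
      by simp
  qed
  also have "\<dots> = (\<Sum>i<j. exp (- b) * b ^ i / fact i * c ^ i) * (1 / c) ^ j"
    unfolding sum_distrib_right by (intro sum.cong) (simp_all add: mult_ac)
  also have "\<dots> \<le> exp (- (b * (1 - c))) * (1 / c) ^ j"
    using assms by (intro mult_right_mono poisson_series_le) auto
  also have "(1 / c) ^ j = exp (real j * ln (1 / c))"
    using assms by (simp add: exp_of_nat_mult)
  also have "\<dots> \<le> exp ((c * b) * ln (1 / c))"
    using assms by (subst exp_le_cancel_iff, intro mult_right_mono) auto
  also have "exp (- (b * (1 - c))) * exp ((c * b) * ln (1 / c)) = exp (- (b * (1 - c + c * ln c)))"
    using assms by (simp add: ln_div algebra_simps flip: exp_add)
  finally show ?thesis by simp
qed

text \<open>The expression is the large-deviation rate, per unit of mean, of a Poisson variable at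
  \<open>c\<close> times its mean; it vanishes only at \<open>c = 1\<close>.\<close>

lemma one_minus_add_ln_pos:
  assumes "0 < c" "c \<noteq> (1 :: real)"
  shows "0 < 1 - c + c * ln c"
proof -
  have "ln (1 / c) < 1 / c - 1"
    using ln_le_minus_one[of "1 / c"] ln_eq_minus_one[of "1 / c"] assms by fastforce
  then have "c * ln (1 / c) < c * (1 / c - 1)" using assms by (intro mult_strict_left_mono)
  then show ?thesis using assms by (simp add: ln_div algebra_simps)
qed

context lattice_steps
begin

text \<open>Submultiplicativity is a hypothesis here; exponential holding times supply it in
  \<open>poisson_tail_submult\<close>.\<close>

lemma survival_poisson_tail:
  assumes "0 < b" "\<And>i j. poisson_tail b (i + j) \<le> poisson_tail b i * poisson_tail b j"
  shows "survival U (poisson_tail b)"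
proof unfold_locales
  show "decseq (poisson_tail b)"
  proof (rule decseq_SucI)
    fix n
    have "0 \<le> exp (- b) * b ^ n / fact n" using assms(1) by simp
    then show "poisson_tail b (Suc n) \<le> poisson_tail b n"
      using poisson_tail_diff[of b n] by linarith
  qed
qed (use assms in \<open>auto simp: less_imp_le[OF poisson_tail_pos]\<close>, simp add: poisson_tail_def)

lemma poisson_upper:
  assumes sub: "\<And>b i j. 0 < b \<Longrightarrow> poisson_tail b (i + j) \<le> poisson_tail b i * poisson_tail b j"
    and \<epsilon>: "0 < \<epsilon>" "\<epsilon> < 1"
  shows "\<forall>\<^sub>F b in at_top. \<forall>n. mean n (surv (poisson_tail b) 0)
    \<le> exp (- ((1 - \<epsilon>) * \<gamma> * exp (- (\<gamma> * b)) * (real n - real (nat \<lceil>4 * b\<rceil> ^ 5))))"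
proof (rule p_upper_asymp[where R="\<lambda>b. exp (- (b * (1 - \<rho>)))"])
  have pos: "\<forall>\<^sub>F b in at_top. 0 < (b :: real)" by (rule eventually_gt_at_top)
  show "\<forall>\<^sub>F b in at_top. survival U (poisson_tail b)"
    using pos by eventually_elim (intro survival_poisson_tail sub)
  \<comment> \<open>Thresholds beyond \<open>4 * b\<close> can be cut off: their share of the
    generating function at \<open>h\<close> is at most \<open>exp (- b)\<close>.\<close>
  show "filterlim (\<lambda>b. nat \<lceil>4 * b\<rceil>) at_top (at_top :: real filter)"
    by real_asymp
  show "\<forall>\<^sub>F b in at_top. 0 < exp (- (\<gamma> * b))" by simp
  show "\<forall>\<^sub>F b in at_top. \<forall>n. (\<Sum>i\<le>n. (poisson_tail b i - poisson_tail b (Suc i)) * \<rho> ^ i) \<le> exp (- (b * (1 - \<rho>)))"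
    using pos
  proof (eventually_elim, intro allI)
    fix b :: real and n assume "0 < b"
    then show "(\<Sum>i\<le>n. (poisson_tail b i - poisson_tail b (Suc i)) * \<rho> ^ i) \<le> exp (- (b * (1 - \<rho>)))"
      unfolding poisson_tail_diff lessThan_Suc_atMost[symmetric]
      using \<rho>_pos by (intro poisson_series_le) auto
  qed
  show "((\<lambda>b. real (nat \<lceil>4 * b\<rceil>) ^ N * (exp (- (b * (1 - \<rho>))))\<^sup>2 / exp (- (\<gamma> * b))) \<longlongrightarrow> 0) at_top" for N
  proof -
    define g where "g = 2 * (1 - \<rho>) - \<gamma>"
    have g: "0 < g" using two_gap by (simp add: g_def)
    have "((\<lambda>b. (4 * b + 1) ^ N * exp (- (g * b))) \<longlongrightarrow> 0) at_top"
      using g by real_asymp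
    moreover have "\<forall>\<^sub>F b in at_top. norm (real (nat \<lceil>4 * b\<rceil>) ^ N * (exp (- (b * (1 - \<rho>))))\<^sup>2 / exp (- (\<gamma> * b)))
        \<le> (4 * b + 1) ^ N * exp (- (g * b))"
      using pos
    proof eventually_elim
      case (elim b)
      have "(exp (- (b * (1 - \<rho>))))\<^sup>2 / exp (- (\<gamma> * b)) = exp (- (g * b))"
        by (simp add: g_def power2_eq_square algebra_simps flip: exp_add exp_diff)
      moreover have "real (nat \<lceil>4 * b\<rceil>) ^ N \<le> (4 * b + 1) ^ N"
        using elim by (intro power_mono) linarith+
      ultimately show ?case
        by (simp add: mult.assoc[symmetric] times_divide_eq_right[symmetric] del: times_divide_eq_right)
    qed
    ultimately show ?thesis by (rule Lim_null_comparison[rotated])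
  qed
  show "\<forall>\<^sub>F b in at_top. (1 - \<epsilon>) * exp (- (\<gamma> * b))
      \<le> (\<Sum>i\<le>nat \<lceil>4 * b\<rceil>. (poisson_tail b i - poisson_tail b (Suc i)) * h ^ i)" if "0 < \<epsilon>" for \<epsilon>
  proof -
    have "((\<lambda>b. exp (- (b :: real))) \<longlongrightarrow> 0) at_top" by real_asymp
    then have "\<forall>\<^sub>F b in at_top. exp (- b) < \<epsilon>" by (rule order_tendstoD) (rule that)
    then show ?thesis using pos
    proof eventually_elim
      case (elim b)
      define k where "k = nat \<lceil>4 * b\<rceil>"
      let ?t = "\<lambda>i. (b * h) ^ i / fact i"
      have s: "summable ?t" "suminf ?t = exp (b * h)"
        using exp_series[of "b * h"] by (auto simp: sums_iff)
      \<comment> \<open>Tilting by \<open>exp 1\<close>: beyond \<open>4 * b\<close> the factor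
        \<open>exp (i + Suc k) * exp (- 4 * b)\<close> is at least 1, and the tilted series sums to
        at most \<open>exp (b * h * exp 1)\<close>.\<close>
      have "(\<Sum>i. ?t (i + Suc k)) \<le> (\<Sum>i. (b * h * exp 1) ^ (i + Suc k) / fact (i + Suc k) * exp (- (4 * b)))"
      proof (rule suminf_le)
        fix i
        have "4 * b \<le> real (i + Suc k)" unfolding k_def by linarith
        then have "1 \<le> exp (real (i + Suc k)) * exp (- (4 * b))"
          by (simp flip: exp_add)
        then have "?t (i + Suc k) * 1 \<le> ?t (i + Suc k) * (exp (real (i + Suc k)) * exp (- (4 * b)))"
          using elim h_pos by (intro mult_left_mono) auto
        also have "exp (real (i + Suc k)) = exp 1 ^ (i + Suc k)"
          by (metis exp_of_nat_mult mult.right_neutral)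
        finally show "?t (i + Suc k) \<le> (b * h * exp 1) ^ (i + Suc k) / fact (i + Suc k) * exp (- (4 * b))"
          by (simp add: power_mult_distrib mult_ac)
        show "summable (\<lambda>i. ?t (i + Suc k))"
          using s(1) by (rule summable_ignore_initial_segment)
        show "summable (\<lambda>i. (b * h * exp 1) ^ (i + Suc k) / fact (i + Suc k) * exp (- (4 * b)))"
          using exp_series[of "b * h * exp 1"]
          by (intro summable_mult2 summable_ignore_initial_segment[of "\<lambda>i. (b * h * exp 1) ^ i / fact i"])
            (simp add: sums_iff)
      qed
      also have "\<dots> = (\<Sum>i. (b * h * exp 1) ^ (i + Suc k) / fact (i + Suc k)) * exp (- (4 * b))"
        using exp_series[of "b * h * exp 1"]
        by (intro suminf_mult2[symmetric] summable_ignore_initial_segment[of "\<lambda>i. (b * h * exp 1) ^ i / fact i"])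
          (simp add: sums_iff)
      also have "(\<Sum>i. (b * h * exp 1) ^ (i + Suc k) / fact (i + Suc k)) \<le> exp (b * h * exp 1)"
      proof -
        let ?u = "\<lambda>i. (b * h * exp 1) ^ i / fact i"
        have u: "summable ?u" "suminf ?u = exp (b * h * exp 1)"
          using exp_series[of "b * h * exp 1"] by (auto simp: sums_iff)
        have "0 \<le> (\<Sum>i<Suc k. ?u i)" using elim h_pos by (intro sum_nonneg) auto
        then show ?thesis using suminf_minus_initial_segment[OF u(1), of "Suc k"] u(2) by simp
      qed
      also have "exp (b * h * exp 1) * exp (- (4 * b)) \<le> exp (b * h) * exp (- b)"
      proof -
        have "h * (exp 1 - 1) \<le> 1 * (3 - 1)" using h_pos h_less_1 exp_le by (intro mult_mono) auto
        then have "b * (h * (exp 1 - 1)) \<le> b * 3" using elim by (intro mult_left_mono) auto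
        then show ?thesis by (simp add: algebra_simps flip: exp_add)
      qed
      finally have tail: "(\<Sum>i. ?t (i + Suc k)) \<le> exp (b * h) * exp (- b)" by simp
      have "(\<Sum>i\<le>k. ?t i) = exp (b * h) - (\<Sum>i. ?t (i + Suc k))"
        using suminf_minus_initial_segment[OF s(1), of "Suc k"] s(2) by (simp add: lessThan_Suc_atMost)
      also have "\<dots> \<ge> exp (b * h) * (1 - \<epsilon>)"
      proof -
        have "exp (b * h) * exp (- b) \<le> exp (b * h) * \<epsilon>" using elim by (intro mult_left_mono) auto
        then show ?thesis using tail unfolding right_diff_distrib by linarith
      qed
      finally have "exp (- b) * (exp (b * h) * (1 - \<epsilon>)) \<le> exp (- b) * (\<Sum>i\<le>k. ?t i)"
        by (intro mult_left_mono) auto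
      also have "exp (- b) * (exp (b * h) * (1 - \<epsilon>)) = (1 - \<epsilon>) * exp (- (\<gamma> * b))"
        by (simp add: h_def algebra_simps flip: exp_add)
      also have "exp (- b) * (\<Sum>i\<le>k. ?t i) = (\<Sum>i\<le>k. exp (- b) * b ^ i / fact i * h ^ i)"
        unfolding sum_distrib_left by (intro sum.cong) (simp_all add: power_mult_distrib)
      finally show ?case by (simp add: poisson_tail_diff k_def)
    qed
  qed
qed (use \<epsilon> in auto)

text \<open>Controls the first moment in the Jensen bound: summed against \<open>h ^ i\<close>, the
  increments of \<open>- ln \<phi>\<close> cost no more than the Poisson weights themselves, up to
  the factor \<open>1 + \<epsilon>\<close>.\<close>

lemma poisson_increments:
  assumes "0 < \<epsilon>"
  shows "\<forall>\<^sub>F b in at_top. \<forall>n. (\<Sum>i\<le>n. (ln (poisson_tail b i) - ln (poisson_tail b (Suc i))) * h ^ i)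
    \<le> (1 + \<epsilon>) * exp (- (\<gamma> * b))"
proof -
  \<comment> \<open>Since \<open>\<gamma> = 1 - h < - ln h\<close>, there is room for
    \<open>t\<close> strictly between; then \<open>c < 1\<close> can still satisfy
    \<open>\<gamma> < c * t\<close>.\<close>
  define t where "t = (\<gamma> + - ln h) / 2"
  define c where "c = (\<gamma> / t + 1) / 2"
  have "ln h < h - 1" using ln_le_minus_one[OF h_pos] ln_eq_minus_one[OF h_pos] h_less_1 by fastforce
  then have t: "\<gamma> < t" "t < - ln h" by (auto simp: t_def h_def)
  have c: "0 < c" "c < 1" "\<gamma> < c * t"
    using t \<gamma>_pos by (auto simp: c_def field_simps)
  define x where "x = h * exp t"
  have x: "0 < x" "x < 1"
  proof -
    have "h * exp t < h * exp (- ln h)" using t h_pos by simp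
    also have "\<dots> = 1" using h_pos by (simp add: exp_minus)
    finally show "x < 1" by (simp add: x_def)
  qed (use h_pos in \<open>simp add: x_def\<close>)
  define C where "C = 1 / (1 - x)\<^sup>2 * exp t"
  have geo: "(\<Sum>i\<in>I. real (Suc i) * x ^ i) \<le> 1 / (1 - x)\<^sup>2" if "finite I" for I
  proof -
    have "(\<lambda>n. real (Suc n) * x ^ n) sums (1 / (1 - x)\<^sup>2)"
      using geometric_deriv_sums[of x] x by simp
    then show ?thesis using that x by (auto simp: sums_iff intro!: sum_le_suminf[THEN order_trans])
  qed
  define d where "d = 1 - c + c * ln c"
  have d: "0 < d" unfolding d_def by (rule one_minus_add_ln_pos) (use c in auto)
  have "((\<lambda>b. 1 / (1 - exp (- (b * d))) + C * exp (- (b * (c * t - \<gamma>)))) \<longlongrightarrow> 1 / (1 - 0) + C * 0) at_top"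
  proof (intro tendsto_intros)
    show "((\<lambda>b. exp (- (b * d))) \<longlongrightarrow> 0) at_top" using d by real_asymp
    have "0 < c * t - \<gamma>" using c by simp
    then show "((\<lambda>b. exp (- (b * (c * t - \<gamma>)))) \<longlongrightarrow> 0) at_top" by real_asymp
  qed auto
  then have "\<forall>\<^sub>F b in at_top. 1 / (1 - exp (- (b * d))) + C * exp (- (b * (c * t - \<gamma>))) < 1 + \<epsilon>"
    by (rule order_tendstoD) (use assms in auto)
  then show ?thesis using eventually_ge_at_top[of 1]
  proof (eventually_elim, intro allI)
    fix b :: real and n :: nat
    assume le: "1 / (1 - exp (- (b * d))) + C * exp (- (b * (c * t - \<gamma>))) < 1 + \<epsilon>" and b: "1 \<le> b"
    let ?\<phi> = "poisson_tail b"
    let ?d = "\<lambda>i. ln (?\<phi> i) - ln (?\<phi> (Suc i))"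
    define \<eta> where "\<eta> = exp (- (b * d))"
    have \<eta>: "\<eta> < 1" using b d by (simp add: \<eta>_def)
    have pos: "0 < ?\<phi> i" for i using b by (intro poisson_tail_pos) auto
    have d_le: "?d i \<le> (?\<phi> i - ?\<phi> (Suc i)) / ?\<phi> (Suc i)" for i
      using ln_le_minus_one[of "?\<phi> i / ?\<phi> (Suc i)"] pos[of i] pos[of "Suc i"]
      by (simp add: ln_div diff_divide_distrib)
    \<comment> \<open>Below \<open>c b\<close> the survival probability is close to \<open>1\<close>; above, \<open>h ^ i\<close> is already
      negligible against \<open>exp (- \<gamma> b)\<close>, because \<open>c t > \<gamma>\<close>.\<close>
    have small: "?d i * h ^ i \<le> (1 / (1 - \<eta>)) * (exp (- b) * b ^ i / fact i * h ^ i)"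
      if "real (Suc i) \<le> c * b" for i
    proof -
      have "1 - \<eta> \<le> ?\<phi> (Suc i)"
        using one_minus_poisson_tail_le[of b c "Suc i"] that b c by (simp add: \<eta>_def d_def)
      then have "(?\<phi> i - ?\<phi> (Suc i)) / ?\<phi> (Suc i) \<le> (?\<phi> i - ?\<phi> (Suc i)) / (1 - \<eta>)"
        using \<eta> pos b unfolding poisson_tail_diff by (intro divide_left_mono) auto
      then have "?d i \<le> 1 / (1 - \<eta>) * (exp (- b) * b ^ i / fact i)"
        using d_le[of i] unfolding poisson_tail_diff by (simp add: mult.commute)
      then have "?d i * h ^ i \<le> 1 / (1 - \<eta>) * (exp (- b) * b ^ i / fact i) * h ^ i"
        using h_pos by (intro mult_right_mono) auto
      then show ?thesis by simp
    qed
    have large: "?d i * h ^ i \<le> exp (t * (1 - c * b)) * (real (Suc i) * x ^ i)"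
      if "\<not> real (Suc i) \<le> c * b" for i
    proof -
      \<comment> \<open>The tail is at least its first term, and consecutive Poisson weights have
        ratio \<open>Suc i / b\<close>, so the increment grows at most linearly in
        \<open>i\<close>.\<close>
      have "exp (- b) * b ^ Suc i / fact (Suc i) \<le> ?\<phi> (Suc i)"
        using poisson_tail_diff[of b "Suc i"] pos[of "Suc (Suc i)"] by simp
      moreover have "0 < exp (- b) * b ^ Suc i / fact (Suc i)" using b by simp
      ultimately have "(?\<phi> i - ?\<phi> (Suc i)) / ?\<phi> (Suc i)
          \<le> (?\<phi> i - ?\<phi> (Suc i)) / (exp (- b) * b ^ Suc i / fact (Suc i))"
        using b unfolding poisson_tail_diff by (intro divide_left_mono mult_pos_pos pos) auto
      also have "\<dots> = real (Suc i) / b"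
        unfolding poisson_tail_diff using b by (simp add: divide_simps)
      also have "\<dots> \<le> real (Suc i) / 1" using b by (intro divide_left_mono) auto
      finally have "?d i \<le> real (Suc i)" using d_le[of i] by simp
      then have "?d i * h ^ i \<le> real (Suc i) * h ^ i" using h_pos by (intro mult_right_mono) auto
      also have "\<dots> = real (Suc i) * (exp (- (t * real i)) * x ^ i)"
      proof -
        have "exp t ^ i = exp (t * real i)" by (metis exp_of_nat_mult mult.commute)
        then show ?thesis by (simp add: x_def power_mult_distrib exp_minus)
      qed
      also have "\<dots> \<le> real (Suc i) * (exp (t * (1 - c * b)) * x ^ i)"
      proof -
        have "t * (c * b - 1) \<le> t * real i" using that t \<gamma>_pos by (intro mult_left_mono) auto
        then show ?thesis using x by (intro mult_left_mono mult_right_mono) (auto simp: algebra_simps)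
      qed
      finally show ?thesis by (simp add: mult_ac)
    qed
    let ?I = "{i. i \<le> n \<and> real (Suc i) \<le> c * b}" and ?J = "{i. i \<le> n \<and> \<not> real (Suc i) \<le> c * b}"
    have fin: "finite ?I" "finite ?J" by auto
    have "{..n} = ?I \<union> ?J" by auto
    then have "(\<Sum>i\<le>n. ?d i * h ^ i) = (\<Sum>i\<in>?I. ?d i * h ^ i) + (\<Sum>i\<in>?J. ?d i * h ^ i)"
      by (simp only:) (rule sum.union_disjoint, auto)
    also have "(\<Sum>i\<in>?I. ?d i * h ^ i) \<le> 1 / (1 - \<eta>) * (\<Sum>i\<in>?I. exp (- b) * b ^ i / fact i * h ^ i)"
      unfolding sum_distrib_left by (intro sum_mono small) auto
    also have "(\<Sum>i\<in>?I. exp (- b) * b ^ i / fact i * h ^ i) \<le> (\<Sum>i<Suc n. exp (- b) * b ^ i / fact i * h ^ i)"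
      using b h_pos by (intro sum_mono2) auto
    also have "\<dots> \<le> exp (- (b * (1 - h)))"
      using b h_pos by (intro poisson_series_le) auto
    also have "(\<Sum>i\<in>?J. ?d i * h ^ i) \<le> exp (t * (1 - c * b)) * (\<Sum>i\<in>?J. real (Suc i) * x ^ i)"
      unfolding sum_distrib_left by (intro sum_mono large) auto
    also have "(\<Sum>i\<in>?J. real (Suc i) * x ^ i) \<le> 1 / (1 - x)\<^sup>2" by (rule geo) simp
    finally have "(\<Sum>i\<le>n. ?d i * h ^ i)
        \<le> 1 / (1 - \<eta>) * exp (- (b * (1 - h))) + exp (t * (1 - c * b)) * (1 / (1 - x)\<^sup>2)"
      using \<eta> by (simp add: mult_left_mono divide_right_mono)
    also have "\<dots> = (1 / (1 - \<eta>) + C * exp (- (b * (c * t - \<gamma>)))) * exp (- (\<gamma> * b))"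
    proof -
      have "exp (t * (1 - c * b)) = exp t * exp (- (b * (c * t - \<gamma>))) * exp (- (\<gamma> * b))"
        by (simp add: algebra_simps flip: exp_add)
      then show ?thesis by (simp add: C_def h_def algebra_simps)
    qed
    also have "\<dots> \<le> (1 + \<epsilon>) * exp (- (\<gamma> * b))"
      using le by (intro mult_right_mono) (auto simp: \<eta>_def)
    finally show "(\<Sum>i\<le>n. ?d i * h ^ i) \<le> (1 + \<epsilon>) * exp (- (\<gamma> * b))" .
  qed
qed

text \<open>\<open>N\<close> depends only on how fast the means of \<open>esc\<close> converge and
  not on \<open>b\<close>, so that \<open>n\<close> and \<open>b\<close> may later both be functions
  of \<open>t\<close>.\<close>

lemma poisson_lower:
  assumes sub: "\<And>b i j. 0 < b \<Longrightarrow> poisson_tail b (i + j) \<le> poisson_tail b i * poisson_tail b j"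
    and \<epsilon>: "0 < \<epsilon>"
  shows "\<exists>N. \<forall>\<^sub>F b in at_top. \<forall>n\<ge>N.
    exp (- ((1 + \<epsilon>) * \<gamma> * exp (- (\<gamma> * b)) * real n)) \<le> mean n (surv (poisson_tail b) 0)"
proof -
  \<comment> \<open>One factor \<open>1 + \<delta>\<close> is for the mean of \<open>esc\<close>,
    one for \<open>poisson_increments\<close>.\<close>
  define \<delta> where "\<delta> = sqrt (1 + \<epsilon>) - 1"
  have \<delta>: "0 < \<delta>" "(1 + \<delta>) * (1 + \<delta>) = 1 + \<epsilon>" using \<epsilon> by (auto simp: \<delta>_def)
  obtain N where N: "\<And>n. n \<ge> N \<Longrightarrow> (\<Sum>k\<le>n. esc k) \<le> (1 + \<delta>) * \<gamma> * real n"
    using sum_esc_upper[OF \<delta>(1)] by (auto simp: eventually_sequentially)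
  have "\<forall>\<^sub>F b in at_top. \<forall>n\<ge>N.
    exp (- ((1 + \<epsilon>) * \<gamma> * exp (- (\<gamma> * b)) * real n)) \<le> mean n (surv (poisson_tail b) 0)"
    using poisson_increments[OF \<delta>(1)] eventually_gt_at_top[of 0]
  proof (eventually_elim, intro allI impI)
    fix b :: real and n
    assume b: "0 < b" and n: "N \<le> n" and inc:
      "\<forall>n. (\<Sum>i\<le>n. (ln (poisson_tail b i) - ln (poisson_tail b (Suc i))) * h ^ i) \<le> (1 + \<delta>) * exp (- (\<gamma> * b))"
    interpret survival U "poisson_tail b" by (rule survival_poisson_tail[OF b sub[OF b]])
    interpret sym_survival U K "poisson_tail b" ..
    have "(\<Sum>k\<le>n. esc k) * (\<Sum>i\<le>n. (ln (poisson_tail b i) - ln (poisson_tail b (Suc i))) * h ^ i)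
        \<le> (\<Sum>k\<le>n. esc k) * ((1 + \<delta>) * exp (- (\<gamma> * b)))"
      using inc by (intro mult_left_mono sum_nonneg esc_nonneg) auto
    also have "\<dots> \<le> ((1 + \<delta>) * \<gamma> * real n) * ((1 + \<delta>) * exp (- (\<gamma> * b)))"
      using N[OF n] \<delta> by (intro mult_right_mono) auto
    also have "\<dots> = (1 + \<epsilon>) * \<gamma> * exp (- (\<gamma> * b)) * real n"
      by (simp add: \<delta>(2)[symmetric])
    finally have "exp (- ((1 + \<epsilon>) * \<gamma> * exp (- (\<gamma> * b)) * real n))
      \<le> exp (- ((\<Sum>k\<le>n. esc k) * (\<Sum>i\<le>n. (ln (poisson_tail b i) - ln (poisson_tail b (Suc i))) * h ^ i)))"
      by simp
    also have "\<dots> \<le> p n" by (intro p_ge_exp poisson_tail_pos b)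
    finally show "exp (- ((1 + \<epsilon>) * \<gamma> * exp (- (\<gamma> * b)) * real n)) \<le> mean n (surv (poisson_tail b) 0)"
      by (simp add: p_def)
  qed
  then show ?thesis by blast
qed

end

section \<open>The nearest-neighbour walk on the lattice\<close>

fun line_return :: "nat \<Rightarrow> int \<Rightarrow> real" where
  "line_return 0 z = of_bool (z = 0)"
| "line_return (Suc k) z = (line_return k (z + 1) + line_return k (z - 1)) / 2"

lemma line_return_nonneg: "0 \<le> line_return k z"
  by (induction k arbitrary: z) auto

lemma line_return_far: "z < - int k \<Longrightarrow> line_return k z = 0"
  by (induction k arbitrary: z) auto

lemma line_return_odd: "odd (z + int k) \<Longrightarrow> line_return k z = 0"
  by (induction k arbitrary: z) auto

text \<open>With starting point \<open>2 * j - k\<close> the recursion becomes Pascal's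
  rule.\<close>

lemma line_return_binomial: "line_return k (2 * int j - int k) = real (k choose j) / 2 ^ k"
proof (induction k arbitrary: j)
  case 0
  then show ?case by (cases j) auto
next
  case (Suc k)
  have "2 * int j - int (Suc k) + 1 = 2 * int j - int k" by simp
  then have 1: "line_return k (2 * int j - int (Suc k) + 1) = real (k choose j) / 2 ^ k"
    by (simp only: Suc)
  show ?case
  proof (cases j)
    case 0
    then show ?thesis using 1 line_return_far[of "- int (Suc k) - 1" k] by simp
  next
    case (Suc i)
    then have "2 * int j - int (Suc k) - 1 = 2 * int i - int k" by simp
    then have "line_return k (2 * int j - int (Suc k) - 1) = real (k choose i) / 2 ^ k"
      by (simp only: Suc.IH)
    then show ?thesis using 1 Suc by (simp add: add_divide_distrib)
  qed
qed

text \<open>The square of the left side times \<open>2 * m + 1\<close> decreases in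
  \<open>m\<close>, because \<open>(2 * m + 1) * (2 * m + 3) <= (2 * m + 2)^2\<close>.\<close>

lemma central_binomial_bound: "real (2 * m choose m) / 4 ^ m \<le> 1 / sqrt (real (2 * m + 1))"
proof -
  define c where "c m = real (2 * m choose m) / 4 ^ m" for m
  have step: "c (Suc m) = c m * ((2 * m + 1) / (2 * m + 2))" for m
  proof -
    have c: "c m = fact (2 * m) / (fact m * fact m * 4 ^ m)" for m
      using binomial_fact[of m "2 * m", where ?'a = real] by (simp add: c_def)
    have "2 * Suc m = Suc (Suc (2 * m))" by simp
    then show ?thesis unfolding c by (simp only: fact_Suc) (simp add: divide_simps, simp add: algebra_simps)
  qed
  have c0: "0 \<le> c m" for m by (simp add: c_def)
  have "(c m)\<^sup>2 * (2 * m + 1) \<le> 1"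
  proof (induction m)
    case (Suc m)
    have "(c (Suc m))\<^sup>2 * (2 * real (Suc m) + 1)
        = ((c m)\<^sup>2 * (2 * m + 1)) * (real ((2 * m + 1) * (2 * m + 3)) / real ((2 * m + 2)\<^sup>2))"
      unfolding step by (simp add: power2_eq_square field_simps)
    also have "\<dots> \<le> 1 * 1"
    proof (intro mult_mono)
      have "real ((2 * m + 1) * (2 * m + 3)) \<le> real ((2 * m + 2)\<^sup>2)"
        unfolding of_nat_le_iff by (simp add: power2_eq_square algebra_simps)
      then show "real ((2 * m + 1) * (2 * m + 3)) / real ((2 * m + 2)\<^sup>2) \<le> 1"
        by (subst divide_le_eq_1_pos) auto
    qed (use Suc in auto)
    finally show ?case by simp
  qed (simp add: c_def)
  then have "(c m)\<^sup>2 \<le> (1 / sqrt (real (2 * m + 1)))\<^sup>2"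
    by (simp add: power_divide field_simps)
  then show ?thesis unfolding c_def[symmetric] by (rule power2_le_imp_le) simp
qed

lemma line_return_le: "line_return k 0 \<le> 1 / sqrt (real (k + 1))"
proof (cases "even k")
  case True
  then obtain m where m: "k = 2 * m" by blast
  have "line_return k 0 = real (2 * m choose m) / 4 ^ m"
    using line_return_binomial[of k m] by (simp add: m power_mult)
  then show ?thesis using central_binomial_bound[of m] by (simp add: m)
next
  case False
  then show ?thesis using line_return_odd[of 0 k] by simp
qed

lemma axis_nth_int: "axis i c $ j = (if j = i then c else 0)"
  by (simp add: axis_def)

lemma axis_pm_neq: "axis i (1::int) \<noteq> axis j (-1)"
  by (metis axis_nth_int one_neq_neg_one zero_neq_one)

lemma finite_unit_steps: "finite unit_steps"
  by (simp add: unit_steps_def)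

lemma axis_in_unit_steps [simp]: "axis i 1 \<in> unit_steps" "axis i (-1) \<in> unit_steps"
  by (auto simp: unit_steps_def)

lemma unit_stepsE:
  assumes "e \<in> unit_steps"
  obtains i c where "e = axis i c" "c = 1 \<or> c = -1"
  using assms by (auto simp: unit_steps_def)

lemma sum_unit_steps: "(\<Sum>e\<in>unit_steps. f e) = (\<Sum>i\<in>UNIV. f (axis i 1) + f (axis i (- 1)))"
  unfolding unit_steps_def
  by (subst sum.union_disjoint)
    (auto simp: sum.reindex inj_on_def axis_eq_axis axis_pm_neq sum.distrib)

lemma card_unit_steps: "card (unit_steps :: (int ^ 'd) set) = 2 * CARD('d::finite)"
  using sum_unit_steps[of "\<lambda>_::int ^ 'd. 1 :: nat"] by (simp add: mult.commute)

interpretation lattice: step_set "unit_steps :: (int ^ 'd::finite) set"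
proof
  show "unit_steps \<noteq> ({} :: (int ^ 'd) set)" by (auto simp: unit_steps_def)
qed (rule finite_unit_steps)

lemma lattice_avg:
  "lattice.avg f = (\<Sum>j\<in>UNIV. f (axis j 1) + f (axis j (- 1))) / (2 * real CARD('d))"
  for f :: "int ^ 'd::finite \<Rightarrow> real"
  by (simp add: lattice.avg_def sum_unit_steps card_unit_steps)

section \<open>Number of steps along one axis, a binomial variable\<close>

definition dir_count :: "'d \<Rightarrow> (int ^ 'd::finite) list \<Rightarrow> nat" where
  "dir_count i xs = length (filter (\<lambda>e. e $ i \<noteq> 0) xs)"

lemma dir_count_Nil [simp]: "dir_count i [] = 0"
  and dir_count_Cons [simp]: "dir_count i (e # xs) = of_bool (e $ i \<noteq> 0) + dir_count i xs"
  by (auto simp: dir_count_def)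

text \<open>Given the directions of the steps, the coordinates are independent one-dimensional walks.\<close>

lemma mean_prod_coordinates:
  fixes z :: "int ^ 'd::finite" and S :: "'d set"
  shows "lattice.mean n (\<lambda>xs. \<Prod>i\<in>S. of_bool (z $ i + sum_list xs $ i = 0))
     = lattice.mean n (\<lambda>xs. \<Prod>i\<in>S. line_return (dir_count i xs) (z $ i))"
proof (induction n arbitrary: z)
  case (Suc n)
  \<comment> \<open>Averaging a step along axis \<open>j\<close> over its two signs is one step of
    \<open>line_return\<close> in coordinate \<open>j\<close>; the other coordinates stay.\<close>
  have pm: "(\<Prod>i\<in>S. line_return (c i) ((z + axis j 1) $ i)) + (\<Prod>i\<in>S. line_return (c i) ((z + axis j (- 1)) $ i))
      = (\<Prod>i\<in>S. line_return (of_bool (axis j (1::int) $ i \<noteq> 0) + c i) (z $ i))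
      + (\<Prod>i\<in>S. line_return (of_bool (axis j (- 1 ::int) $ i \<noteq> 0) + c i) (z $ i))" for j c
  proof (cases "j \<in> S")
    case True
    have *: "prod f S = f j * prod f (S - {j})" for f :: "'d \<Rightarrow> real"
      using True by (simp add: prod.remove)
    show ?thesis unfolding * by (simp add: axis_nth_int field_simps)
  next
    case False
    then have "axis j c $ i = 0" if "i \<in> S" for i and c :: int using that by (auto simp: axis_nth_int)
    then show ?thesis by simp
  qed
  have "lattice.mean (Suc n) (\<lambda>xs. \<Prod>i\<in>S. of_bool (z $ i + sum_list xs $ i = 0))
    = lattice.avg (\<lambda>e. lattice.mean n (\<lambda>xs. \<Prod>i\<in>S. of_bool ((z + e) $ i + sum_list xs $ i = 0)))"
    by (simp add: add.assoc)
  also have "\<dots> = lattice.avg (\<lambda>e. lattice.mean n (\<lambda>xs. \<Prod>i\<in>S. line_return (dir_count i xs) ((z + e) $ i)))"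
    unfolding Suc ..
  also have "\<dots> = lattice.mean (Suc n) (\<lambda>xs. \<Prod>i\<in>S. line_return (dir_count i xs) (z $ i))"
    unfolding lattice.mean.simps lattice_avg lattice.mean_add[symmetric] dir_count_Cons
    by (simp only: pm)
  finally show ?case .
qed simp

lemma mean_dir_count_Suc:
  fixes i :: "'d::finite"
  defines "d \<equiv> real CARD('d)"
  shows "lattice.mean (Suc n) (\<lambda>xs. f (dir_count i xs))
    = 1 / d * lattice.mean n (\<lambda>xs. f (Suc (dir_count i xs)))
      + (1 - 1 / d) * lattice.mean n (\<lambda>xs. f (dir_count i xs))"
proof -
  have d: "d \<noteq> 0" by (simp add: d_def)
  let ?a = "lattice.mean n (\<lambda>xs. f (Suc (dir_count i xs)))"
  let ?b = "lattice.mean n (\<lambda>xs. f (dir_count i xs))"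
  have s: "lattice.mean n (\<lambda>xs. f (of_bool (axis j c $ i \<noteq> 0) + dir_count i xs)) = (if j = i then ?a else ?b)"
    if "c \<noteq> 0" for j and c :: int
    using that by (simp add: axis_nth_int)
  have "lattice.mean (Suc n) (\<lambda>xs. f (dir_count i xs)) = (\<Sum>j\<in>UNIV. 2 * (if j = i then ?a else ?b)) / (2 * d)"
    unfolding lattice.mean.simps lattice_avg dir_count_Cons by (simp add: s d_def)
  also have "(\<Sum>j\<in>UNIV. 2 * (if j = i then ?a else ?b)) = 2 * ?a + 2 * (d - 1) * ?b"
    by (subst sum.remove[of UNIV i]) (simp_all add: d_def)
  finally show ?thesis using d unfolding d_def by (simp add: field_simps)
qed

text \<open>Size-biasing the binomial variable \<open>dir_count\<close> yields its inverse moments.\<close>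

lemma mean_dir_count_size_bias:
  fixes i :: "'d::finite"
  shows "lattice.mean (Suc n) (\<lambda>xs. real (dir_count i xs) * g (dir_count i xs - 1))
    = real (Suc n) / real CARD('d) * lattice.mean n (\<lambda>xs. g (dir_count i xs))"
proof (induction n arbitrary: g)
  case 0
  show ?case by (simp only: mean_dir_count_Suc[of 0 "\<lambda>c. real c * g (c - 1)"]) simp
next
  case (Suc n)
  define p where "p = 1 / real CARD('d)"
  let ?A = "\<lambda>n g. lattice.mean n (\<lambda>xs. g (dir_count i xs))"
  have IH: "?A (Suc n) (\<lambda>c. real c * g (c - 1)) = real (Suc n) * p * ?A n g" for g
    using Suc[of g] by (simp add: p_def)
  have rec: "?A (Suc n) f = p * ?A n (\<lambda>c. f (Suc c)) + (1 - p) * ?A n f" for n f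
    unfolding p_def by (rule mean_dir_count_Suc)
  have "?A (Suc (Suc n)) (\<lambda>c. real c * g (c - 1))
      = p * ?A (Suc n) (\<lambda>c. g c + real c * g c) + (1 - p) * ?A (Suc n) (\<lambda>c. real c * g (c - 1))"
    by (subst rec) (simp add: algebra_simps)
  also have "?A (Suc n) (\<lambda>c. g c + real c * g c) = ?A (Suc n) g + ?A (Suc n) (\<lambda>c. real c * g (Suc (c - 1)))"
    unfolding lattice.mean_add[symmetric]
  proof (rule lattice.mean_cong)
    fix xs :: "(int ^ 'd) list"
    show "g (dir_count i xs) + real (dir_count i xs) * g (dir_count i xs)
        = g (dir_count i xs) + real (dir_count i xs) * g (Suc (dir_count i xs - 1))"
      by (cases "dir_count i xs") auto
  qed
  also have "?A (Suc n) (\<lambda>c. real c * g (Suc (c - 1))) = real (Suc n) * p * ?A n (\<lambda>c. g (Suc c))"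
    using IH[of "\<lambda>c. g (Suc c)"] .
  also have "?A (Suc n) (\<lambda>c. real c * g (c - 1)) = real (Suc n) * p * ?A n g" by (rule IH)
  also have "p * (?A (Suc n) g + real (Suc n) * p * ?A n (\<lambda>c. g (Suc c))) + (1 - p) * (real (Suc n) * p * ?A n g)
     = p * ?A (Suc n) g + real (Suc n) * p * (p * ?A n (\<lambda>c. g (Suc c)) + (1 - p) * ?A n g)"
    by (simp add: algebra_simps)
  also have "\<dots> = real (Suc (Suc n)) * p * ?A (Suc n) g"
    unfolding rec[symmetric] by (simp add: algebra_simps)
  finally show ?case by (simp add: p_def)
qed

text \<open>Size-biasing with \<open>g c = 1 / (c + 1)\<close> leaves the indicator of a positive
  count, which is at most 1.\<close>

lemma mean_inverse_dir_count:
  fixes i :: "'d::finite"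
  shows "lattice.mean n (\<lambda>xs. 1 / real (Suc (dir_count i xs))) \<le> real CARD('d) / real (Suc n)"
proof -
  have "real (Suc n) / real CARD('d) * lattice.mean n (\<lambda>xs. 1 / real (Suc (dir_count i xs))) \<le> 1"
    unfolding mean_dir_count_size_bias[symmetric, where g = "\<lambda>c. 1 / real (Suc c)"]
    by (intro lattice.mean_le_1) auto
  then show ?thesis by (simp add: field_simps)
qed

text \<open>Here \<open>g c = 1 / ((c + 1) * (c + 2))\<close> reduces the second inverse moment to
  the first; \<open>2 * g c\<close> dominates \<open>1 / (c + 1)^2\<close>.\<close>

lemma mean_inverse_square_dir_count:
  fixes i :: "'d::finite"
  shows "lattice.mean n (\<lambda>xs. 1 / (real (Suc (dir_count i xs)))\<^sup>2) \<le> 2 * (real CARD('d) / real (Suc n))\<^sup>2"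
proof -
  let ?d = "real CARD('d)"
  let ?g = "\<lambda>c. 1 / (real (Suc c) * real (Suc (Suc c)))"
  have "real (Suc n) / ?d * lattice.mean n (\<lambda>xs. ?g (dir_count i xs))
      = lattice.mean (Suc n) (\<lambda>xs. real (dir_count i xs) * ?g (dir_count i xs - 1))"
    by (rule mean_dir_count_size_bias[symmetric])
  also have "\<dots> \<le> lattice.mean (Suc n) (\<lambda>xs. 1 / real (Suc (dir_count i xs)))"
  proof (intro lattice.mean_mono)
    fix xs :: "(int ^ 'd) list"
    show "real (dir_count i xs) * ?g (dir_count i xs - 1) \<le> 1 / real (Suc (dir_count i xs))"
      by (cases "dir_count i xs") auto
  qed
  also have "\<dots> \<le> ?d / real (Suc (Suc n))" by (rule mean_inverse_dir_count)
  also have "\<dots> \<le> ?d / real (Suc n)" by (intro divide_left_mono) auto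
  finally have "(?d / real (Suc n)) * (real (Suc n) / ?d * lattice.mean n (\<lambda>xs. ?g (dir_count i xs)))
      \<le> (?d / real (Suc n)) * (?d / real (Suc n))"
    by (intro mult_left_mono) auto
  then have "lattice.mean n (\<lambda>xs. ?g (dir_count i xs)) \<le> (?d / real (Suc n))\<^sup>2"
    by (simp add: power2_eq_square)
  moreover have "lattice.mean n (\<lambda>xs. 1 / (real (Suc (dir_count i xs)))\<^sup>2)
      \<le> lattice.mean n (\<lambda>xs. 2 * ?g (dir_count i xs))"
  proof (intro lattice.mean_mono)
    fix xs :: "(int ^ 'd) list"
    define c where "c = real (dir_count i xs)"
    have "0 \<le> c" by (simp add: c_def)
    then have "1 / (1 + c)\<^sup>2 \<le> 2 / ((1 + c) * (2 + c))"
      by (simp add: divide_simps power2_eq_square)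
    then show "1 / (real (Suc (dir_count i xs)))\<^sup>2 \<le> 2 * ?g (dir_count i xs)"
      by (simp add: c_def)
  qed
  ultimately show ?thesis unfolding lattice.mean_cmult by linarith
qed

lemma amgm3:
  fixes a b c :: real
  assumes "0 \<le> a" "0 \<le> b" "0 \<le> c"
  shows "3 * (a * b * c) \<le> a ^ 3 + b ^ 3 + c ^ 3"
proof -
  have "0 \<le> (a + b + c) * ((a - b)\<^sup>2 + (b - c)\<^sup>2 + (a - c)\<^sup>2) / 2"
    using assms by (intro divide_nonneg_pos mult_nonneg_nonneg add_nonneg_nonneg) auto
  also have "\<dots> = a ^ 3 + b ^ 3 + c ^ 3 - 3 * (a * b * c)"
    by (simp add: power2_eq_square power3_eq_cube field_simps)
  finally show ?thesis by simp
qed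

text \<open>Three coordinates suffice. Given the directions, the return probability is at most a
  product of three factors of order \<open>count powr (- 1 / 2)\<close>. The counts are dependent,
  but the inequality between the means replaces the product by single cubes, which leaves the moment
  of order -3/2 of one count.\<close>

lemma lattice_heat_kernel:
  assumes "3 \<le> CARD('d::finite)"
  shows "lattice.occ {0 :: int ^ 'd} n 0
     \<le> (2 * (real CARD('d))\<^sup>2 + real CARD('d)) / (real (Suc n) * sqrt (real (Suc n)))"
proof -
  let ?d = "real CARD('d)"
  define N where "N = real (Suc n)"
  have N: "0 < N" by (simp add: N_def)
  obtain S :: "'d set" where "card S = 3"
    using assms obtain_subset_with_card_n by blast
  then obtain i j k where S: "S = {i, j, k}" "i \<noteq> j" "j \<noteq> k" "i \<noteq> k"
    by (auto simp: card_3_iff)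
  define w where "w i xs = 1 / sqrt (real (Suc (dir_count i xs)))" for i :: 'd and xs
  have w0: "0 \<le> w i xs" for i xs by (simp add: w_def)
  have one: "lattice.mean n (\<lambda>xs. w i xs ^ 3) \<le> (2 * ?d\<^sup>2 + ?d) / (N * sqrt N)" for i
  proof -
    \<comment> \<open>The moment of order -3/2 is interpolated between those of orders -1 and -2;
      the weight \<open>sqrt N\<close> balances them, as the count is of order
      \<open>N\<close>.\<close>
    have "w i xs ^ 3 \<le> (sqrt N * (1 / (real (Suc (dir_count i xs)))\<^sup>2)
        + 1 / sqrt N * (1 / real (Suc (dir_count i xs)))) / 2" for xs
    proof -
      define y where "y = 1 / real (Suc (dir_count i xs))"
      have y: "0 < y" by (simp add: y_def)
      have "w i xs = sqrt y" by (simp add: w_def y_def real_sqrt_divide)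
      have "0 \<le> (sqrt (sqrt N * y) - sqrt (1 / sqrt N))\<^sup>2" by simp
      also have "\<dots> = sqrt N * y + 1 / sqrt N - 2 * (sqrt (sqrt N * y) * sqrt (1 / sqrt N))"
        using y N by (simp add: power2_diff)
      also have "sqrt (sqrt N * y) * sqrt (1 / sqrt N) = sqrt y"
        unfolding real_sqrt_mult[symmetric] using N by simp
      finally have "y * (2 * sqrt y) \<le> y * (sqrt N * y + 1 / sqrt N)"
        using y by (intro mult_left_mono) auto
      moreover have "sqrt y ^ 3 = y * sqrt y" using y by (simp add: power3_eq_cube)
      moreover have "1 / (real (Suc (dir_count i xs)))\<^sup>2 = y * y"
        by (simp add: y_def power2_eq_square)
      ultimately show ?thesis unfolding \<open>w i xs = sqrt y\<close> y_def[symmetric] by (simp add: algebra_simps)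
    qed
    then have "lattice.mean n (\<lambda>xs. w i xs ^ 3)
      \<le> lattice.mean n (\<lambda>xs. sqrt N / 2 * (1 / (real (Suc (dir_count i xs)))\<^sup>2)
        + 1 / (2 * sqrt N) * (1 / real (Suc (dir_count i xs))))"
      by (intro lattice.mean_mono) (simp add: add_divide_distrib mult_ac)
    also have "\<dots> \<le> sqrt N / 2 * (2 * (?d / N)\<^sup>2) + 1 / (2 * sqrt N) * (?d / N)"
      unfolding lattice.mean_add lattice.mean_cmult N_def
      by (intro add_mono mult_left_mono mean_inverse_dir_count mean_inverse_square_dir_count) auto
    also have "\<dots> = (?d\<^sup>2 + ?d / 2) / (N * sqrt N)"
    proof -
      have "sqrt N / N\<^sup>2 = 1 / (N * sqrt N)" using N
        by (simp add: field_simps power2_eq_square)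
      then have "sqrt N / 2 * (2 * (?d / N)\<^sup>2) = ?d\<^sup>2 * (1 / (N * sqrt N))"
        unfolding power_divide by (metis (no_types, lifting) mult.commute mult.left_commute
          nonzero_mult_div_cancel_left times_divide_eq_left times_divide_eq_right zero_neq_numeral)
      then show ?thesis using N by (simp add: field_simps)
    qed
    also have "\<dots> \<le> (2 * ?d\<^sup>2 + ?d) / (N * sqrt N)"
      using N by (intro divide_right_mono) auto
    finally show ?thesis .
  qed
  have "lattice.occ {0 :: int ^ 'd} n 0
      \<le> lattice.mean n (\<lambda>xs. \<Prod>i\<in>S. of_bool ((0 :: int ^ 'd) $ i + sum_list xs $ i = 0))"
    unfolding lattice.occ_def
  proof (rule lattice.mean_mono)
    fix xs :: "(int ^ 'd) list"
    show "of_bool (0 + sum_list xs \<in> {0}) \<le> (\<Prod>i\<in>S. of_bool ((0 :: int ^ 'd) $ i + sum_list xs $ i = 0) :: real)"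
      by (cases "sum_list xs = 0") (auto intro!: prod_nonneg)
  qed
  also have "\<dots> = lattice.mean n (\<lambda>xs. \<Prod>i\<in>S. line_return (dir_count i xs) 0)"
    by (subst mean_prod_coordinates) simp
  also have "\<dots> \<le> lattice.mean n (\<lambda>xs. \<Prod>i\<in>S. w i xs)"
    using line_return_le by (intro lattice.mean_mono prod_mono) (auto simp: line_return_nonneg w_def)
  also have "\<dots> \<le> lattice.mean n (\<lambda>xs. 1 / 3 * w i xs ^ 3 + 1 / 3 * w j xs ^ 3 + 1 / 3 * w k xs ^ 3)"
  proof (rule lattice.mean_mono)
    fix xs :: "(int ^ 'd) list"
    show "(\<Prod>i\<in>S. w i xs) \<le> 1 / 3 * w i xs ^ 3 + 1 / 3 * w j xs ^ 3 + 1 / 3 * w k xs ^ 3"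
      using amgm3[OF w0[of i xs] w0[of j xs] w0[of k xs]] S by (simp add: mult.assoc)
  qed
  also have "\<dots> \<le> (2 * ?d\<^sup>2 + ?d) / (N * sqrt N)"
    unfolding lattice.mean_add lattice.mean_cmult using one[of i] one[of j] one[of k] by linarith
  finally show ?thesis by (simp add: N_def)
qed

text \<open>A transposition of coordinates times a sign, hence an involution; the sign
  \<open>a * b\<close> turns the entry \<open>a\<close> into \<open>b\<close> because
  \<open>a^2 = 1\<close>.\<close>

lemma unit_steps_transitive:
  fixes e e' :: "int ^ 'd::finite"
  assumes "e \<in> unit_steps" "e' \<in> unit_steps"
  shows "\<exists>\<sigma>. (\<forall>v w. \<sigma> (v + w) = \<sigma> v + \<sigma> w) \<and> inj \<sigma> \<and> bij_betw \<sigma> unit_steps unit_steps \<and> \<sigma> e = e'"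
proof -
  obtain i a where e: "e = axis i a" "a = 1 \<or> a = -1" using assms(1) by (rule unit_stepsE)
  obtain j b where e': "e' = axis j b" "b = 1 \<or> b = -1" using assms(2) by (rule unit_stepsE)
  define s where "s = a * b"
  have s: "s = 1 \<or> s = -1" "s * s = 1" using e e' by (auto simp: s_def)
  define \<sigma> where "\<sigma> v = (\<chi> k. s * v $ (Transposition.transpose i j k))" for v :: "int ^ 'd"
  have axis: "\<sigma> (axis k c) = axis (Transposition.transpose i j k) (s * c)" for k c
    by (auto simp: \<sigma>_def vec_eq_iff axis_nth_int transpose_eq_iff)
  have inv: "\<sigma> (\<sigma> v) = v" for v
    using s by (auto simp: \<sigma>_def vec_eq_iff mult.assoc[symmetric])
  have inj: "inj \<sigma>" by (rule inj_on_inverseI[where g=\<sigma>]) (rule inv)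
  have sub: "\<sigma> f \<in> unit_steps" if "f \<in> unit_steps" for f
    using that s(1) by (elim unit_stepsE) (auto simp: axis)
  have "bij_betw \<sigma> unit_steps unit_steps"
    by (rule bij_betwI[where g=\<sigma>]) (auto simp: sub inv)
  moreover have "\<sigma> e = e'" using e e' by (auto simp: axis s_def)
  moreover have "\<sigma> (v + w) = \<sigma> v + \<sigma> w" for v w
    by (simp add: \<sigma>_def vec_eq_iff distrib_left)
  ultimately show ?thesis using inj by blast
qed

lemma trail_box:
  fixes a :: "int ^ 'd::finite"
  assumes "set xs \<subseteq> unit_steps" "x \<in> lattice.trail a xs"
  shows "\<bar>x $ i - a $ i\<bar> \<le> int (length xs)"
  using assms
proof (induction xs arbitrary: a)
  case (Cons e xs)
  have e: "\<bar>e $ i\<bar> \<le> 1" using Cons.prems by (auto elim!: unit_stepsE simp: axis_nth_int)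
  show ?case
  proof (cases "x = a")
    case False
    then have "\<bar>x $ i - (a + e) $ i\<bar> \<le> int (length xs)"
      using Cons.prems by (intro Cons.IH) auto
    then show ?thesis using e by simp
  qed auto
qed auto

lemma lattice_growth:
  "\<exists>B. finite B \<and> card B \<le> (2 * n + 1) ^ CARD('d) \<and>
    (\<forall>xs. length xs = n \<longrightarrow> set xs \<subseteq> unit_steps \<longrightarrow> lattice.trail (0 :: int ^ 'd::finite) xs \<subseteq> B)"
proof -
  define B :: "(int ^ 'd) set" where "B = vec_lambda ` (PiE UNIV (\<lambda>_. {- int n..int n}))"
  have "card B \<le> card (PiE (UNIV :: 'd set) (\<lambda>_. {- int n..int n}))"
    unfolding B_def by (intro card_image_le finite_PiE) auto
  also have "\<dots> = (2 * n + 1) ^ CARD('d)" by (simp add: card_PiE nat_add_distrib nat_mult_distrib)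
  finally have "card B \<le> (2 * n + 1) ^ CARD('d)" .
  moreover have "lattice.trail 0 xs \<subseteq> B" if "length xs = n" "set xs \<subseteq> unit_steps" for xs
  proof
    fix x assume x: "x \<in> lattice.trail 0 xs"
    have "x = vec_lambda (\<lambda>i. x $ i)" by simp
    moreover have "(\<lambda>i. x $ i) \<in> PiE UNIV (\<lambda>_. {- int n..int n})"
      using trail_box[OF that(2) x] that(1) by (auto simp: abs_le_iff) (smt (verit))
    ultimately show "x \<in> B" unfolding B_def by (rule image_eqI)
  qed
  moreover have "finite B" unfolding B_def by (intro finite_imageI finite_PiE) auto
  ultimately show ?thesis by blast
qed

lemma lattice_steps_unit_steps:
  assumes "3 \<le> CARD('d::finite)"
  shows "lattice_steps (unit_steps :: (int ^ 'd) set) (2 * (real CARD('d))\<^sup>2 + real CARD('d)) CARD('d)"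
proof unfold_locales
  fix e :: "int ^ 'd" assume "e \<in> unit_steps"
  then obtain i c where e: "e = axis i c" "c = 1 \<or> c = -1" by (rule unit_stepsE)
  have "- e = axis i (- c)" by (simp add: e vec_eq_iff axis_nth_int)
  then show "- e \<in> unit_steps" using e by auto
qed (rule lattice_heat_kernel[OF assms] unit_steps_transitive lattice_growth; assumption)+

section \<open>The random walk and its holding times\<close>

context step_set
begin

lemma mean_eq_sum:
  "mean n f = (\<Sum>xs\<in>{xs. set xs \<subseteq> U \<and> length xs = n}. f xs * (1 / real (card U)) ^ n)"
proof (induction n arbitrary: f)
  case 0
  have "{xs. set xs \<subseteq> U \<and> length xs = 0} = {[]}" by auto
  then show ?case by simp
next
  case (Suc n)
  let ?L = "\<lambda>n. {xs. set xs \<subseteq> U \<and> length xs = n}"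
  have inj: "inj_on (\<lambda>(xs, e). e # xs) (?L n \<times> U)" by (auto simp: inj_on_def)
  have "(\<Sum>xs\<in>?L (Suc n). f xs * (1 / real (card U)) ^ Suc n)
     = (\<Sum>(xs, e)\<in>?L n \<times> U. f (e # xs) * (1 / real (card U)) ^ Suc n)"
    unfolding lists_length_Suc_eq sum.reindex[OF inj] by (auto intro!: sum.cong)
  also have "\<dots> = (\<Sum>e\<in>U. \<Sum>xs\<in>?L n. f (e # xs) * (1 / real (card U)) ^ Suc n)"
    unfolding sum.cartesian_product[symmetric] by (rule sum.swap)
  also have "\<dots> = (\<Sum>e\<in>U. (\<Sum>xs\<in>?L n. f (e # xs) * (1 / real (card U)) ^ n) / real (card U))"
    unfolding sum_divide_distrib by (intro sum.cong) auto
  also have "\<dots> = mean (Suc n) f"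
    by (simp add: Suc avg_def sum_divide_distrib)
  finally show ?case by simp
qed

lemma visits_card: "visits {x} a xs = card {k. k \<le> length xs \<and> a + sum_list (take k xs) = x}"
proof (induction xs arbitrary: a)
  case Nil
  have "{k. k = 0 \<and> a = x} = (if a = x then {0} else {})" by auto
  then show ?case by simp
next
  case (Cons e xs)
  let ?I = "\<lambda>a xs. {k. k \<le> length xs \<and> a + sum_list (take k xs) = x}"
  have fin: "finite (?I a xs)" for a xs by (rule finite_subset[of _ "{..length xs}"]) auto
  have "?I a (e # xs) = (if a = x then {0} else {}) \<union> Suc ` ?I (a + e) xs"
  proof (intro equalityI subsetI)
    fix k assume "k \<in> ?I a (e # xs)"
    then show "k \<in> (if a = x then {0} else {}) \<union> Suc ` ?I (a + e) xs"
      by (cases k) (auto simp: add.assoc)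
  qed (auto simp: add.assoc split: if_splits)
  moreover have "card ((if a = x then {0} else {}) \<union> Suc ` ?I (a + e) xs)
      = of_bool (a = x) + card (?I (a + e) xs)"
    using fin[of xs "a + e"] by (subst card_Un_disjoint) (auto simp: card_image)
  ultimately show ?case using Cons by simp
qed

lemma trail_eq: "trail a xs = {a + sum_list (take k xs) | k. k \<le> length xs}"
proof (induction xs arbitrary: a)
  case (Cons e xs)
  show ?case
  proof (intro equalityI subsetI)
    fix x assume "x \<in> trail a (e # xs)"
    then consider "x = a" | k where "k \<le> length xs" "x = a + e + sum_list (take k xs)"
      using Cons by auto
    then show "x \<in> {a + sum_list (take k (e # xs)) | k. k \<le> length (e # xs)}"
    proof cases
      case 1
      then show ?thesis by (auto intro!: exI[of _ 0])
    next
      case (2 k)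
      then show ?thesis by (auto simp: add.assoc intro!: exI[of _ "Suc k"])
    qed
  next
    fix x assume "x \<in> {a + sum_list (take k (e # xs)) | k. k \<le> length (e # xs)}"
    then obtain k where k: "k \<le> Suc (length xs)" "x = a + sum_list (take k (e # xs))" by auto
    then show "x \<in> trail a (e # xs)"
      by (cases k) (auto simp: Cons add.assoc)
  qed
qed auto

end

context walk_with_holding_times
begin

lemma step_measurable [measurable]: "X k \<in> measurable M (count_space UNIV)"
  using steps_indep by (auto simp: indep_vars_def)

lemma holding_measurable [measurable]: "T k \<in> borel_measurable M"
  using holding_indep by (auto simp: indep_vars_def)

lemma step_prob:
  assumes "e \<in> unit_steps"
  shows "prob (X k -` {e} \<inter> space M) = 1 / real (card (unit_steps :: (int ^ 'd) set))"
proof -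
  have ne: "unit_steps \<noteq> ({} :: (int ^ 'd) set)" using assms by auto
  have "prob (X k -` {e} \<inter> space M) = measure (distr M (count_space UNIV) (X k)) {e}"
    by (subst measure_distr) auto
  also have "\<dots> = pmf (pmf_of_set unit_steps) e"
    unfolding steps_uniform by (simp add: measure_pmf_single)
  finally show ?thesis using assms ne finite_unit_steps[where ?'a='d] by simp
qed

lemma step_AE: "AE \<omega> in M. X k \<omega> \<in> unit_steps"
proof -
  have ne: "unit_steps \<noteq> ({} :: (int ^ 'd) set)" by (auto simp: unit_steps_def)
  have "AE x in measure_pmf (pmf_of_set (unit_steps :: (int ^ 'd) set)). x \<in> unit_steps"
    using ne finite_unit_steps[where ?'a='d] by (simp add: AE_measure_pmf_iff set_pmf_of_set)
  then have "AE x in distr M (count_space UNIV) (X k). x \<in> unit_steps"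
    unfolding steps_uniform .
  then show ?thesis by (subst (asm) AE_distr_iff) auto
qed

section \<open>Law of the step list and its independence of the holding times\<close>

definition steps :: "nat \<Rightarrow> 'w \<Rightarrow> (int ^ 'd) list" where
  "steps n \<omega> = map (\<lambda>k. X k \<omega>) [0..<n]"

lemma length_steps [simp]: "length (steps n \<omega>) = n"
  by (simp add: steps_def)

lemma steps_eq_iff: "length xs = n \<Longrightarrow> steps n \<omega> = xs \<longleftrightarrow> (\<forall>k<n. X k \<omega> = xs ! k)"
  by (auto simp: steps_def list_eq_iff_nth_eq)

lemma walk_steps: "k \<le> n \<Longrightarrow> walk X k \<omega> = sum_list (take k (steps n \<omega>))"
  by (simp add: walk_def steps_def take_map interv_sum_list_conv_sum_set_nat atLeast0LessThan)

abbreviation "step_sigma \<equiv>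
  vimage_algebra (space M) (\<lambda>\<omega> k. X k \<omega>) (Pi\<^sub>M UNIV (\<lambda>_. count_space UNIV))"

abbreviation "holding_sigma \<equiv>
  vimage_algebra (space M) (\<lambda>\<omega> k. T k \<omega>) (Pi\<^sub>M UNIV (\<lambda>_. borel))"

lemma holding_sigma_sets: "A \<in> sets holding_sigma \<Longrightarrow> A \<in> events"
  using indep_setD_ev2[OF walk_holding_indep] by auto

lemma steps_event:
  assumes "length xs = n"
  shows "{\<omega>\<in>space M. steps n \<omega> = xs} \<in> sets step_sigma"
proof -
  have "{f \<in> space (Pi\<^sub>M UNIV (\<lambda>_. count_space UNIV)). \<forall>k\<in>{..<n}. f k = xs ! k}
      \<in> sets (Pi\<^sub>M UNIV (\<lambda>_. count_space (UNIV :: (int ^ 'd) set)))"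
    by measurable
  then have "(\<lambda>\<omega> k. X k \<omega>) -` {f \<in> space (Pi\<^sub>M UNIV (\<lambda>_. count_space UNIV)). \<forall>k\<in>{..<n}. f k = xs ! k}
      \<inter> space M \<in> sets step_sigma"
    by (rule in_vimage_algebra)
  also have "(\<lambda>\<omega> k. X k \<omega>) -` {f \<in> space (Pi\<^sub>M UNIV (\<lambda>_. count_space UNIV)). \<forall>k\<in>{..<n}. f k = xs ! k}
      \<inter> space M = {\<omega>\<in>space M. steps n \<omega> = xs}"
    using steps_eq_iff[OF assms] by (auto simp: space_PiM)
  finally show ?thesis .
qed

lemma steps_prob:
  assumes "length xs = n" "set xs \<subseteq> unit_steps"
  shows "prob {\<omega>\<in>space M. steps n \<omega> = xs} = (1 / real (card (unit_steps :: (int ^ 'd) set))) ^ n"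
proof (cases "n = 0")
  case True
  then show ?thesis using assms by (simp add: steps_def prob_space)
next
  case False
  have "{\<omega>\<in>space M. steps n \<omega> = xs} = (\<Inter>k\<in>{..<n}. X k -` {xs ! k} \<inter> space M)"
    using steps_eq_iff[OF assms(1)] False by auto
  also have "prob \<dots> = (\<Prod>k\<in>{..<n}. prob (X k -` {xs ! k} \<inter> space M))"
    using False by (intro indep_varsD[OF steps_indep]) auto
  also have "\<dots> = (\<Prod>k\<in>{..<n}. 1 / real (card (unit_steps :: (int ^ 'd) set)))"
    using assms by (intro prod.cong step_prob) (auto simp: subset_iff)
  finally show ?thesis by simp
qed

text \<open>Conditioning on the steps in elementary form: almost surely the step list is one of
  finitely many, and for each of them \<open>B xs\<close> is independent of the steps.\<close>

lemma prob_steps_holding: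
  assumes B: "\<And>xs. B xs \<in> sets holding_sigma"
  shows "{\<omega>\<in>space M. \<omega> \<in> B (steps n \<omega>)} \<in> events"
    and "prob {\<omega>\<in>space M. \<omega> \<in> B (steps n \<omega>)} = lattice.mean n (\<lambda>xs. prob (B xs))"
proof -
  let ?L = "{xs :: (int ^ 'd) list. set xs \<subseteq> unit_steps \<and> length xs = n}"
  let ?E = "\<lambda>xs. {\<omega>\<in>space M. steps n \<omega> = xs}"
  have ev: "?E xs \<in> events" for xs
  proof (cases "length xs = n")
    case True
    then show ?thesis using steps_event indep_setD_ev1[OF walk_holding_indep] by blast
  next
    case False
    then have *: "?E xs = {}" by auto
    show ?thesis unfolding * by simp
  qed
  have EB: "?E xs \<inter> B xs \<in> events" for xs
    by (rule sets.Int[OF ev holding_sigma_sets[OF B]])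
  have eq: "{\<omega>\<in>space M. \<omega> \<in> B (steps n \<omega>)} = (\<Union>xs\<in>UNIV. ?E xs \<inter> B xs)"
    by auto
  show meas: "{\<omega>\<in>space M. \<omega> \<in> B (steps n \<omega>)} \<in> events"
    unfolding eq by (rule sets.countable_UN') (use EB in auto)
  have fin: "finite ?L" by (rule finite_lists_length_eq) (rule finite_unit_steps)
  have "AE \<omega> in M. \<forall>k. X k \<omega> \<in> unit_steps"
    using step_AE by (simp add: AE_all_countable)
  then have "AE \<omega> in M. steps n \<omega> \<in> ?L"
    by (auto simp: steps_def elim!: eventually_mono)
  then have "AE \<omega> in M. \<omega> \<in> {\<omega>\<in>space M. \<omega> \<in> B (steps n \<omega>)} \<longleftrightarrow> \<omega> \<in> (\<Union>xs\<in>?L. ?E xs \<inter> B xs)"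
    by (auto elim!: eventually_mono)
  then have "prob {\<omega>\<in>space M. \<omega> \<in> B (steps n \<omega>)} = prob (\<Union>xs\<in>?L. ?E xs \<inter> B xs)"
    by (intro measure_eq_AE meas sets.finite_UN fin EB)
  also have "\<dots> = (\<Sum>xs\<in>?L. prob (?E xs \<inter> B xs))"
    by (intro finite_measure_finite_Union fin)
      (auto simp: disjoint_family_on_def intro!: EB)
  also have "\<dots> = (\<Sum>xs\<in>?L. prob (?E xs) * prob (B xs))"
    by (intro sum.cong refl indep_setD[OF walk_holding_indep] steps_event B) auto
  also have "\<dots> = lattice.mean n (\<lambda>xs. prob (B xs))"
    unfolding lattice.mean_eq_sum by (intro sum.cong) (auto simp: steps_prob mult.commute)
  finally show "prob {\<omega>\<in>space M. \<omega> \<in> B (steps n \<omega>)} = lattice.mean n (\<lambda>xs. prob (B xs))" .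
qed

lemma prob_steps:
  shows "{\<omega>\<in>space M. P (steps n \<omega>)} \<in> events"
    and "prob {\<omega>\<in>space M. P (steps n \<omega>)} = lattice.mean n (\<lambda>xs. of_bool (P xs))"
proof -
  define B where "B xs = (if P xs then space M else {})" for xs
  have B: "B xs \<in> sets holding_sigma" for xs
    using sets.top[of holding_sigma] by (auto simp: B_def)
  have eq: "{\<omega>\<in>space M. \<omega> \<in> B (steps n \<omega>)} = {\<omega>\<in>space M. P (steps n \<omega>)}"
    by (auto simp: B_def split: if_splits)
  have "(\<lambda>xs. prob (B xs)) = (\<lambda>xs. of_bool (P xs))"
    by (auto simp: B_def prob_space)
  then show "{\<omega>\<in>space M. P (steps n \<omega>)} \<in> events"
    "prob {\<omega>\<in>space M. P (steps n \<omega>)} = lattice.mean n (\<lambda>xs. of_bool (P xs))"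
    using prob_steps_holding[of B n, OF B] unfolding eq by simp_all
qed

section \<open>Sums of holding times over sets of visits\<close>

lemma holding_sum_le:
  assumes "finite K" "0 < b"
  shows "prob {\<omega>\<in>space M. (\<Sum>k\<in>K. T k \<omega>) \<le> b} = poisson_tail b (card K)"
proof (cases "K = {}")
  case True
  then show ?thesis using assms by (simp add: prob_space poisson_tail_def)
next
  case False
  \<comment> \<open>\<open>erlang_density k\<close> belongs to a sum of \<open>k + 1\<close>
    exponential variables, hence \<open>card K - 1\<close> and the separate empty case.\<close>
  have "distributed M lborel (\<lambda>\<omega>. \<Sum>k\<in>K. T k \<omega>) (erlang_density (card K - 1) 1)"
    using assms False holding_exp by (intro exponential_distributed_sum indep_vars_subset[OF holding_indep]) auto
  then have "prob {\<omega>\<in>space M. (\<Sum>k\<in>K. T k \<omega>) \<le> b} = erlang_CDF (card K - 1) 1 b"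
    using assms by (intro erlang_distributed_le) auto
  moreover obtain m where "card K = Suc m"
    using False assms by (cases "card K") auto
  then have "{..card K - 1} = {..<card K}" by (simp add: lessThan_Suc_atMost)
  ultimately show ?thesis using assms by (simp add: erlang_CDF_def poisson_tail_def mult.commute)
qed

lemma holding_sums_le:
  assumes R: "finite R" and K: "\<And>x. x \<in> R \<Longrightarrow> finite (K x)" "disjoint_family_on K R" and b: "0 < b"
  shows "prob {\<omega>\<in>space M. \<forall>x\<in>R. (\<Sum>k\<in>K x. T k \<omega>) \<le> b} = (\<Prod>x\<in>R. poisson_tail b (card (K x)))"
proof (cases "R = {}")
  case True
  then show ?thesis by (simp add: prob_space)
next
  case False
  have "indep_vars (\<lambda>_. borel) (\<lambda>x \<omega>. \<Sum>k\<in>K x. restrict (\<lambda>k. T k \<omega>) (K x) k) R"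
    by (rule indep_vars_compose2[OF indep_vars_restrict[OF holding_indep _ K(2)]]) auto
  then have ind: "indep_vars (\<lambda>_. borel) (\<lambda>x \<omega>. \<Sum>k\<in>K x. T k \<omega>) R"
    by simp
  have "{\<omega>\<in>space M. \<forall>x\<in>R. (\<Sum>k\<in>K x. T k \<omega>) \<le> b} = (\<Inter>x\<in>R. (\<lambda>\<omega>. \<Sum>k\<in>K x. T k \<omega>) -` {..b} \<inter> space M)"
    using False by auto
  also have "prob \<dots> = (\<Prod>x\<in>R. prob ((\<lambda>\<omega>. \<Sum>k\<in>K x. T k \<omega>) -` {..b} \<inter> space M))"
    by (rule indep_varsD_finite[OF ind]) (use False R in auto)
  also have "\<dots> = (\<Prod>x\<in>R. poisson_tail b (card (K x)))"
  proof (rule prod.cong)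
    fix x assume "x \<in> R"
    have "(\<lambda>\<omega>. \<Sum>k\<in>K x. T k \<omega>) -` {..b} \<inter> space M = {\<omega>\<in>space M. (\<Sum>k\<in>K x. T k \<omega>) \<le> b}" by auto
    then show "prob ((\<lambda>\<omega>. \<Sum>k\<in>K x. T k \<omega>) -` {..b} \<inter> space M) = poisson_tail b (card (K x))"
      using holding_sum_le[OF K(1)[OF \<open>x \<in> R\<close>] b] by simp
  qed simp
  finally show ?thesis .
qed

lemma holding_pos_AE: "AE \<omega> in M. \<forall>k. 0 < T k \<omega>"
proof -
  have "AE \<omega> in M. 0 < T k \<omega>" for k
  proof -
    have "prob {\<omega>\<in>space M. T k \<omega> \<le> 0} = 0"
      using exponential_distributedD_le[OF holding_exp, of 0] by simp
    then have "AE \<omega> in M. \<omega> \<notin> {\<omega>\<in>space M. T k \<omega> \<le> 0}"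
      by (subst (asm) prob_eq_0) auto
    then show ?thesis by (rule AE_mp) (auto simp: not_le)
  qed
  then show ?thesis by (simp add: AE_all_countable)
qed

text \<open>Probabilistic proof: if \<open>i + j\<close> holding times sum to at most
  \<open>b\<close>, then so do the first \<open>i\<close> and the last \<open>j\<close>, and these
  two events are independent.\<close>

lemma poisson_tail_submult:
  assumes "0 < b"
  shows "poisson_tail b (i + j) \<le> poisson_tail b i * poisson_tail b j"
proof -
  define K where "K x = (if x then {..<i} else {i..<i + j})" for x
  have "poisson_tail b (i + j) = prob {\<omega>\<in>space M. (\<Sum>k\<in>{..<i+j}. T k \<omega>) \<le> b}"
    using holding_sum_le[of "{..<i+j}" b] assms by simp
  also have "\<dots> \<le> prob {\<omega>\<in>space M. \<forall>x\<in>UNIV. (\<Sum>k\<in>K x. T k \<omega>) \<le> b}"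
  proof (rule finite_measure_mono_AE)
    show "AE \<omega> in M. \<omega> \<in> {\<omega>\<in>space M. (\<Sum>k\<in>{..<i+j}. T k \<omega>) \<le> b} \<longrightarrow>
        \<omega> \<in> {\<omega>\<in>space M. \<forall>x\<in>UNIV. (\<Sum>k\<in>K x. T k \<omega>) \<le> b}"
      using holding_pos_AE
    proof eventually_elim
      case (elim \<omega>)
      have "(\<Sum>k\<in>K x. T k \<omega>) \<le> (\<Sum>k\<in>{..<i+j}. T k \<omega>)" for x
        using elim by (intro sum_mono2) (auto simp: K_def less_imp_le)
      then show ?case by (auto intro: order_trans)
    qed
  qed auto
  also have "\<dots> = (\<Prod>x\<in>UNIV. poisson_tail b (card (K x)))"
    by (rule holding_sums_le) (use assms in \<open>auto simp: K_def disjoint_family_on_def\<close>)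
  finally show ?thesis by (simp add: UNIV_bool K_def mult.commute)
qed

text \<open>Local time of the continuous walk stopped at the end of stay number \<open>n\<close>
  instead of at a fixed time. Given the steps, its values at distinct points are sums over disjoint
  sets of holding times, hence independent.\<close>

definition weighted_time :: "nat \<Rightarrow> int ^ 'd \<Rightarrow> 'w \<Rightarrow> real" where
  "weighted_time n x \<omega> = (\<Sum>k\<le>n. T k \<omega> * of_bool (walk X k \<omega> = x))"

lemma weighted_time_prob:
  assumes b: "0 < b"
  shows "{\<omega>\<in>space M. \<forall>x. weighted_time n x \<omega> \<le> b} \<in> events"
    and "prob {\<omega>\<in>space M. \<forall>x. weighted_time n x \<omega> \<le> b}
      = lattice.mean n (lattice.surv (poisson_tail b) (0 :: int ^ 'd))"
proof -
  define K where "K xs x = {k. k \<le> length xs \<and> 0 + sum_list (take k xs) = x}"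
    for xs :: "(int ^ 'd) list" and x
  define B where "B xs = {\<omega>\<in>space M. \<forall>x\<in>lattice.trail 0 xs. (\<Sum>k\<in>K xs x. T k \<omega>) \<le> b}" for xs
  have finK: "finite (K xs x)" for xs x
    by (rule finite_subset[of _ "{..length xs}"]) (auto simp: K_def)
  have Bs: "B xs \<in> sets holding_sigma" for xs
  proof -
    let ?P = "Pi\<^sub>M UNIV (\<lambda>_::nat. borel :: real measure)"
    let ?S = "{f \<in> space ?P. \<forall>x\<in>lattice.trail 0 xs. (\<Sum>k\<in>K xs x. f k) \<le> b}"
    have "?S \<in> sets ?P"
      by (intro sets.sets_Collect_finite_All lattice.finite_trail) measurable
    then have "(\<lambda>\<omega> k. T k \<omega>) -` ?S \<inter> space M \<in> sets holding_sigma"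
      by (rule in_vimage_algebra)
    also have "(\<lambda>\<omega> k. T k \<omega>) -` ?S \<inter> space M = B xs"
      by (auto simp: B_def space_PiM)
    finally show ?thesis .
  qed
  have wt: "weighted_time n x \<omega> = (\<Sum>k\<in>K (steps n \<omega>) x. T k \<omega>)" for x \<omega>
    unfolding weighted_time_def
    by (rule sum.mono_neutral_cong_right) (auto simp: K_def walk_steps)
  have "K (steps n \<omega>) x = {}" if "x \<notin> lattice.trail 0 (steps n \<omega>)" for x \<omega>
    using that unfolding lattice.trail_eq K_def by auto
  then have eq: "{\<omega>\<in>space M. \<forall>x. weighted_time n x \<omega> \<le> b} = {\<omega>\<in>space M. \<omega> \<in> B (steps n \<omega>)}"
    using b unfolding wt B_def by auto
  show "{\<omega>\<in>space M. \<forall>x. weighted_time n x \<omega> \<le> b} \<in> events"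
    unfolding eq by (rule prob_steps_holding) (rule Bs)
  have "prob (B xs) = lattice.surv (poisson_tail b) 0 xs" for xs
    unfolding B_def lattice.surv_def lattice.visits_card K_def[symmetric]
    by (rule holding_sums_le) (use b finK in \<open>auto simp: disjoint_family_on_def K_def\<close>)
  then show "prob {\<omega>\<in>space M. \<forall>x. weighted_time n x \<omega> \<le> b}
      = lattice.mean n (lattice.surv (poisson_tail b) (0 :: int ^ 'd))"
    unfolding eq prob_steps_holding(2)[of B, OF Bs] by simp
qed

section \<open>Discrete local times and the escape probability\<close>

lemma local_time_visits: "local_time X n x \<omega> = lattice.visits {x} 0 (steps n \<omega>)"
proof -
  have "local_time X n x \<omega> = (\<Sum>k\<in>{0..n}. of_bool (0 + sum_list (take k (steps n \<omega>)) = x))"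
    unfolding local_time_def
    by (rule sum.cong) (auto simp: walk_steps indicator_def)
  also have "\<dots> = card {k. k \<le> n \<and> 0 + sum_list (take k (steps n \<omega>)) = x}"
    by (simp add: Collect_conj_eq atMost_def[symmetric] atLeast0AtMost)
  finally show ?thesis by (simp add: lattice.visits_card)
qed

lemma max_local_time_le_iff: "max_local_time X n \<omega> \<le> k \<longleftrightarrow> (\<forall>x. local_time X n x \<omega> \<le> k)"
proof -
  have "range (\<lambda>x. local_time X n x \<omega>) \<subseteq> {..Suc n}"
    using lattice.visits_le[of _ 0 "steps n \<omega>"] by (auto simp: local_time_visits)
  then have "finite (range (\<lambda>x. local_time X n x \<omega>))" by (rule finite_subset) simp
  then show ?thesis unfolding max_local_time_def by (subst Max_le_iff) auto
qed

lemma max_local_time_prob: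
  "prob {\<omega>\<in>space M. max_local_time X n \<omega> \<le> k} = lattice.mean n (lattice.surv (\<lambda>j. of_bool (j \<le> k)) (0 :: int ^ 'd))"
proof -
  have "lattice.surv (\<lambda>j. of_bool (j \<le> k)) (0 :: int ^ 'd) xs = of_bool (\<forall>x. lattice.visits {x} 0 xs \<le> k)" for xs
  proof -
    have "(\<forall>x. lattice.visits {x} 0 xs \<le> k) \<longleftrightarrow> (\<forall>x\<in>lattice.trail 0 xs. lattice.visits {x} 0 xs \<le> k)"
      by (metis lattice.visits_eq_0 zero_le)
    then show ?thesis
      unfolding lattice.surv_def by (auto simp: prod_zero_iff)
  qed
  then show ?thesis
    unfolding max_local_time_le_iff local_time_visits
      prob_steps(2)[where n=n and P="\<lambda>xs. \<forall>x. lattice.visits {x} 0 xs \<le> k"]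
    by (intro lattice.mean_cong) simp
qed

text \<open>Continuity from above along the decreasing events of no return within \<open>n\<close>
  steps; it identifies the limit of the path averages with the escape probability of the given
  walk.\<close>

lemma esc_tendsto_escape_prob: "step_set.esc (unit_steps :: (int ^ 'd) set) \<longlonglongrightarrow> escape_prob M X"
proof -
  define A where "A n = {\<omega>\<in>space M. lattice.visits {0} 0 (steps n \<omega>) = 1}" for n
  have A: "A n = {\<omega>\<in>space M. \<forall>k\<in>{1..n}. walk X k \<omega> \<noteq> 0}" for n
  proof -
    have "lattice.visits {0} 0 (steps n \<omega>) = 1 \<longleftrightarrow> (\<forall>k\<in>{1..n}. walk X k \<omega> \<noteq> 0)" for \<omega>
    proof -
      define I where "I = {k. k \<le> n \<and> walk X k \<omega> = 0}"
      have "lattice.visits {0} 0 (steps n \<omega>) = card I"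
        unfolding lattice.visits_card I_def by (rule arg_cong[of _ _ card]) (auto simp: walk_steps)
      moreover have I0: "0 \<in> I" by (simp add: I_def walk_def)
      moreover have "card I = 1 \<longleftrightarrow> (\<forall>k\<in>I. k = 0)"
      proof
        assume "card I = 1"
        then obtain x where "I = {x}" by (rule card_1_singletonE)
        then show "\<forall>k\<in>I. k = 0" using I0 by simp
      next
        assume "\<forall>k\<in>I. k = 0"
        then have "I = {0}" using I0 by blast
        then show "card I = 1" by simp
      qed
      moreover have "(\<forall>k\<in>I. k = 0) \<longleftrightarrow> (\<forall>k\<in>{1..n}. walk X k \<omega> \<noteq> 0)"
      proof
        assume "\<forall>k\<in>{1..n}. walk X k \<omega> \<noteq> 0"
        then show "\<forall>k\<in>I. k = 0" by (auto simp: I_def intro: ccontr)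
      qed (auto simp: I_def)
      ultimately show ?thesis by simp
    qed
    then show ?thesis unfolding A_def by simp
  qed
  have meas: "range A \<subseteq> events" using prob_steps(1) by (auto simp: A_def)
  have "(\<lambda>n. prob (A n)) \<longlonglongrightarrow> prob (\<Inter>n. A n)"
    by (rule finite_Lim_measure_decseq[OF meas]) (auto simp: decseq_def A)
  moreover have "(\<Inter>n. A n) = {\<omega>\<in>space M. \<forall>n\<ge>1. walk X n \<omega> \<noteq> 0}"
    unfolding A by (auto, metis One_nat_def atLeastAtMost_iff order_refl)
  moreover have "prob (A n) = step_set.esc (unit_steps :: (int ^ 'd) set) n" for n
    unfolding A_def using prob_steps(2)[where n=n and P="\<lambda>xs. lattice.visits {0} 0 xs = 1"]
    by (simp add: lattice.esc_def lattice.exactly_def)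
  ultimately show ?thesis by (simp add: escape_prob_def)
qed

end

text \<open>Chernoff bound for \<open>c > 1\<close>, with the same rate as
  \<open>one_minus_poisson_tail_le\<close>. The weights are summed over finite ranges
  \<open>{j..<N + j}\<close> before passing to the limit.\<close>

lemma poisson_tail_le:
  assumes "0 < b" "1 < c" "c * b \<le> real j"
  shows "poisson_tail b j \<le> exp (- (b * (1 - c + c * ln c)))"
proof -
  let ?t = "\<lambda>i. exp (- b) * b ^ i / fact i"
  have "(\<lambda>N. \<Sum>i<N + j. ?t i) \<longlonglongrightarrow> exp (- b) * exp b"
    using LIMSEQ_ignore_initial_segment[OF sums_mult[OF exp_series[of b], of "exp (- b)", unfolded sums_def], of j]
    by simp
  then have lim: "(\<lambda>N. (\<Sum>i<N + j. ?t i) - (\<Sum>i<j. ?t i)) \<longlonglongrightarrow> poisson_tail b j"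
    unfolding poisson_tail_def by (intro tendsto_diff tendsto_const) (simp add: exp_minus)
  have "(\<Sum>i<N + j. ?t i) - (\<Sum>i<j. ?t i) \<le> exp (- (b * (1 - c + c * ln c)))" for N
  proof -
    have "(\<Sum>i<N + j. ?t i) - (\<Sum>i<j. ?t i) = (\<Sum>i\<in>{j..<N + j}. ?t i)"
      using sum.atLeastLessThan_concat[of 0 j "N + j" ?t] by (simp add: atLeast0LessThan)
    also have "\<dots> \<le> (\<Sum>i\<in>{j..<N + j}. ?t i * c ^ i * (1 / c) ^ j)"
    proof (intro sum_mono)
      fix i assume "i \<in> {j..<N + j}"
      then have "c ^ j \<le> c ^ i" using assms by (intro power_increasing) auto
      then have "1 \<le> c ^ i * (1 / c) ^ j" using assms by (simp add: power_divide)
      then have "?t i * 1 \<le> ?t i * (c ^ i * (1 / c) ^ j)" using assms by (intro mult_left_mono) auto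
      then show "?t i \<le> ?t i * c ^ i * (1 / c) ^ j" by (simp add: mult.assoc)
    qed
    also have "\<dots> \<le> (\<Sum>i\<in>{..<N + j}. ?t i * c ^ i * (1 / c) ^ j)"
      using assms by (intro sum_mono2) auto
    also have "\<dots> = (\<Sum>i\<in>{..<N + j}. ?t i * c ^ i) * (1 / c) ^ j"
      by (simp add: sum_distrib_right)
    also have "\<dots> \<le> exp (- (b * (1 - c))) * (1 / c) ^ j"
      using assms by (intro mult_right_mono poisson_series_le) auto
    also have "(1 / c) ^ j = exp (real j * ln (1 / c))"
      using assms by (simp add: exp_of_nat_mult)
    also have "\<dots> \<le> exp ((c * b) * ln (1 / c))"
      using assms by (subst exp_le_cancel_iff, intro mult_right_mono_neg) (auto simp: ln_div)
    also have "exp (- (b * (1 - c))) * exp ((c * b) * ln (1 / c)) = exp (- (b * (1 - c + c * ln c)))"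
      using assms by (simp add: ln_div algebra_simps flip: exp_add)
    finally show ?thesis by simp
  qed
  then show ?thesis by (intro LIMSEQ_le_const2[OF lim]) auto
qed

context walk_with_holding_times
begin

section \<open>Measurability of the continuous-time local times\<close>

lemma walk_measurable [measurable]: "walk X k \<in> measurable M (count_space UNIV)"
proof (subst measurable_count_space_eq2_countable, safe)
  fix x
  have "walk X k -` {x} \<inter> space M = {\<omega>\<in>space M. sum_list (steps k \<omega>) = x}"
    using walk_steps[of k k] by auto
  also have "\<dots> \<in> events" by (rule prob_steps(1))
  finally show "walk X k -` {x} \<inter> space M \<in> events" .
qed auto

lemma jump_time_measurable [measurable]: "jump_time T n \<in> borel_measurable M"
  unfolding jump_time_def by measurable

text \<open>Joint measurability in the sample point and the time makes the local time, an integral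
  over time, a random variable. The jump index takes countably many values.\<close>

lemma ct_walk_measurable:
  "(\<lambda>(\<omega>, s). ct_walk X T s \<omega>) \<in> measurable (M \<Otimes>\<^sub>M lborel) (count_space UNIV)"
proof -
  have [measurable]: "(\<lambda>p. LEAST n. snd p < jump_time T (Suc n) (fst p)) \<in> measurable (M \<Otimes>\<^sub>M lborel) (count_space UNIV)"
    by measurable
  have "(\<lambda>p. walk X (LEAST n. snd p < jump_time T (Suc n) (fst p)) (fst p))
      \<in> measurable (M \<Otimes>\<^sub>M lborel) (count_space UNIV)"
    by (rule measurable_compose_countable[where f="\<lambda>k p. walk X k (fst p)"]) measurable
  then show ?thesis by (simp add: ct_walk_def case_prod_beta')
qed

definition occupied :: "real \<Rightarrow> int ^ 'd \<Rightarrow> 'w \<Rightarrow> real \<Rightarrow> real" where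
  "occupied t x \<omega> s = indicator {0..t} s * indicator {x} (ct_walk X T s \<omega>)"

lemma ct_local_time_eq: "ct_local_time X T t x \<omega> = (\<integral>s. occupied t x \<omega> s \<partial>lborel)"
  by (simp add: ct_local_time_def set_lebesgue_integral_def occupied_def)

lemma occupied_measurable:
  "(\<lambda>(\<omega>, s). occupied t x \<omega> s) \<in> borel_measurable (M \<Otimes>\<^sub>M lborel)"
proof -
  have "(\<lambda>p. indicator {x} ((\<lambda>(\<omega>, s). ct_walk X T s \<omega>) p) :: real) \<in> borel_measurable (M \<Otimes>\<^sub>M lborel)"
    by (rule measurable_compose[OF ct_walk_measurable]) simp
  then have [measurable]: "(\<lambda>p. indicator {x} (ct_walk X T (snd p) (fst p)) :: real) \<in> borel_measurable (M \<Otimes>\<^sub>M lborel)"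
    by (simp add: case_prod_beta')
  show ?thesis unfolding occupied_def case_prod_beta' by measurable
qed

lemma ct_local_time_measurable [measurable]: "ct_local_time X T t x \<in> borel_measurable M"
proof -
  have "ct_local_time X T t x = (\<lambda>\<omega>. \<integral>s. occupied t x \<omega> s \<partial>lborel)"
    by (rule ext) (rule ct_local_time_eq)
  then show ?thesis
    using lborel.borel_measurable_lebesgue_integral[OF occupied_measurable] by simp
qed

lemma occupied_integrable:
  assumes "\<omega> \<in> space M"
  shows "integrable lborel (occupied t x \<omega>)"
proof (rule Bochner_Integration.integrable_bound)
  show "integrable lborel (indicator {0..t} :: real \<Rightarrow> real)"
    by (cases "0 \<le> t") auto
  have "(\<lambda>s. (\<lambda>(\<omega>, s). occupied t x \<omega> s) (\<omega>, s)) \<in> borel_measurable lborel"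
    by (rule measurable_compose[OF _ occupied_measurable]) (use assms in simp)
  then show "occupied t x \<omega> \<in> borel_measurable lborel" by simp
qed (auto simp: occupied_def indicator_def)

lemma ct_local_time_le:
  assumes "\<omega> \<in> space M" "0 \<le> t"
  shows "ct_local_time X T t x \<omega> \<le> t"
proof -
  have "ct_local_time X T t x \<omega> \<le> (\<integral>s. indicator {0..t} s \<partial>lborel)"
    unfolding ct_local_time_eq
  proof (rule integral_mono[OF occupied_integrable[OF assms(1)]])
    show "integrable lborel (indicator {0..t} :: real \<Rightarrow> real)" using assms(2) by simp
  qed (auto simp: occupied_def indicator_def)
  then show ?thesis using assms by simp
qed

lemma max_ct_local_time_le_iff:
  assumes "\<omega> \<in> space M" "0 \<le> t"
  shows "max_ct_local_time X T t \<omega> \<le> c \<longleftrightarrow> (\<forall>x. ct_local_time X T t x \<omega> \<le> c)"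
  unfolding max_ct_local_time_def using ct_local_time_le[OF assms]
  by (subst cSUP_le_iff) (auto intro!: bdd_aboveI[of _ t])

lemma max_ct_local_time_event:
  assumes "0 \<le> t"
  shows "{\<omega>\<in>space M. max_ct_local_time X T t \<omega> \<le> c} \<in> events"
proof -
  have "{\<omega>\<in>space M. max_ct_local_time X T t \<omega> \<le> c} = {\<omega>\<in>space M. \<forall>x. ct_local_time X T t x \<omega> \<le> c}"
    using max_ct_local_time_le_iff[OF _ assms] by auto
  then show ?thesis by simp
qed

section \<open>Comparison of local times along a path with positive holding times\<close>

context
  fixes \<omega>
  assumes \<omega>: "\<omega> \<in> space M" "\<And>k. 0 < T k \<omega>"
begin

lemma jump_time_mono: "m \<le> n \<Longrightarrow> jump_time T m \<omega> \<le> jump_time T n \<omega>"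
  unfolding jump_time_def using \<omega> by (intro sum_mono2) (auto simp: less_imp_le)

lemma jump_index_eq:
  assumes "jump_time T k \<omega> \<le> s" "s < jump_time T (Suc k) \<omega>"
  shows "(LEAST n. s < jump_time T (Suc n) \<omega>) = k"
proof (rule Least_equality)
  fix i assume "s < jump_time T (Suc i) \<omega>"
  then show "k \<le> i" using jump_time_mono[of "Suc i" k] assms by (rule_tac ccontr) auto
qed (rule assms)

text \<open>A step function of time whose integral is \<open>weighted_time\<close>; comparing it
  pointwise with \<open>occupied\<close> gives both inequalities between the local times.\<close>

definition visit_profile :: "nat \<Rightarrow> int ^ 'd \<Rightarrow> real \<Rightarrow> real" where
  "visit_profile n x s = (\<Sum>k\<le>n. of_bool (walk X k \<omega> = x)
     * indicator {jump_time T k \<omega>..<jump_time T (Suc k) \<omega>} s)"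

lemma visit_profile_integrable: "integrable lborel (visit_profile n x)"
  unfolding visit_profile_def
  by (intro Bochner_Integration.integrable_sum integrable_mult_right integrable_real_indicator)
    (use jump_time_mono in \<open>auto simp: emeasure_lborel_Ico\<close>)

lemma visit_profile_integral: "(\<integral>s. visit_profile n x s \<partial>lborel) = weighted_time n x \<omega>"
proof -
  have "(\<integral>s. visit_profile n x s \<partial>lborel) = (\<Sum>k\<le>n. of_bool (walk X k \<omega> = x)
      * (\<integral>s. indicator {jump_time T k \<omega>..<jump_time T (Suc k) \<omega>} s \<partial>lborel))"
    unfolding visit_profile_def
    by (subst Bochner_Integration.integral_sum)
      (use jump_time_mono in \<open>auto simp: emeasure_lborel_Ico intro!: integrable_mult_right integrable_real_indicator\<close>)
  also have "\<dots> = (\<Sum>k\<le>n. of_bool (walk X k \<omega> = x) * T k \<omega>)"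
    using jump_time_mono \<omega> by (intro sum.cong) (auto simp: jump_time_def less_imp_le)
  finally show ?thesis by (simp add: weighted_time_def mult.commute)
qed

lemma weighted_time_le_ct:
  assumes "jump_time T (Suc n) \<omega> \<le> t"
  shows "weighted_time n x \<omega> \<le> ct_local_time X T t x \<omega>"
  unfolding visit_profile_integral[symmetric] ct_local_time_eq
proof (rule integral_mono[OF visit_profile_integrable occupied_integrable[OF \<omega>(1)]])
  fix s
  show "visit_profile n x s \<le> occupied t x \<omega> s"
  proof (cases "\<exists>k\<le>n. jump_time T k \<omega> \<le> s \<and> s < jump_time T (Suc k) \<omega>")
    case True
    then obtain k where k: "k \<le> n" "jump_time T k \<omega> \<le> s" "s < jump_time T (Suc k) \<omega>" by blast
    \<comment> \<open>The stays are disjoint intervals, so only the one containing \<open>s\<close>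
      survives in the sum.\<close>
    have "indicator {jump_time T j \<omega>..<jump_time T (Suc j) \<omega>} s = (of_bool (j = k) :: real)" for j
    proof (cases "j = k")
      case True
      then show ?thesis using k by (simp add: indicator_def)
    next
      case False
      then have "\<not> (jump_time T j \<omega> \<le> s \<and> s < jump_time T (Suc j) \<omega>)"
        using jump_index_eq[OF k(2,3)] jump_index_eq[of j s] by metis
      then show ?thesis using False by (simp add: indicator_def)
    qed
    then have "visit_profile n x s = (\<Sum>j\<le>n. of_bool (walk X j \<omega> = x) * of_bool (j = k))"
      by (simp only: visit_profile_def)
    also have "\<dots> = (\<Sum>j\<in>{k}. of_bool (walk X j \<omega> = x) * of_bool (j = k))"
      using k(1) by (intro sum.mono_neutral_right) auto
    finally have "visit_profile n x s = of_bool (walk X k \<omega> = x)" by simp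
    moreover have "ct_walk X T s \<omega> = walk X k \<omega>"
      using jump_index_eq[OF k(2,3)] by (simp add: ct_walk_def)
    moreover have "s \<le> t" using k(3) jump_time_mono[of "Suc k" "Suc n"] k(1) assms by simp
    moreover have "0 \<le> s" using jump_time_mono[of 0 k] k(2) by (simp add: jump_time_def)
    ultimately show ?thesis by (simp add: occupied_def indicator_def)
  next
    case False
    then have "visit_profile n x s = 0"
      unfolding visit_profile_def by (intro sum.neutral) (auto simp: indicator_def)
    then show ?thesis by (simp add: occupied_def)
  qed
qed

lemma ct_le_weighted_time:
  assumes "t < jump_time T (Suc n) \<omega>"
  shows "ct_local_time X T t x \<omega> \<le> weighted_time n x \<omega>"
  unfolding visit_profile_integral[symmetric] ct_local_time_eq
proof (rule integral_mono[OF occupied_integrable[OF \<omega>(1)] visit_profile_integrable])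
  fix s
  have nn: "0 \<le> visit_profile n x s"
    unfolding visit_profile_def by (intro sum_nonneg) auto
  show "occupied t x \<omega> s \<le> visit_profile n x s"
  proof (cases "0 \<le> s \<and> s \<le> t")
    case True
    define k where "k = (LEAST i. s < jump_time T (Suc i) \<omega>)"
    have n: "s < jump_time T (Suc n) \<omega>" using True assms by simp
    have k1: "s < jump_time T (Suc k) \<omega>" unfolding k_def using n by (rule LeastI)
    have kn: "k \<le> n" unfolding k_def using n by (rule Least_le)
    have k2: "jump_time T k \<omega> \<le> s"
    proof (cases k)
      case 0
      then show ?thesis using True by (simp add: jump_time_def)
    next
      case (Suc i)
      then have "\<not> s < jump_time T (Suc i) \<omega>" unfolding k_def by (intro not_less_Least) simp
      then show ?thesis using Suc by simp
    qed
    have "occupied t x \<omega> s = of_bool (walk X k \<omega> = x)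
        * indicator {jump_time T k \<omega>..<jump_time T (Suc k) \<omega>} s"
      using True k1 k2 by (simp add: occupied_def ct_walk_def k_def[symmetric] indicator_def)
    also have "\<dots> \<le> visit_profile n x s"
      unfolding visit_profile_def by (rule member_le_sum) (use kn in auto)
    finally show ?thesis .
  next
    case False
    then show ?thesis using nn by (auto simp: occupied_def)
  qed
qed

end

lemma jump_time_le_prob:
  assumes "0 < t"
  shows "prob {\<omega>\<in>space M. jump_time T n \<omega> \<le> t} = poisson_tail t n"
  using holding_sum_le[of "{..<n}" t] assms by (simp add: jump_time_def)

lemma jump_time_greater_prob:
  assumes "0 < t"
  shows "prob {\<omega>\<in>space M. t < jump_time T n \<omega>} = 1 - poisson_tail t n"
proof -
  have "{\<omega>\<in>space M. t < jump_time T n \<omega>} = space M - {\<omega>\<in>space M. jump_time T n \<omega> \<le> t}" by auto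
  then show ?thesis using jump_time_le_prob[OF assms, of n] by (simp add: prob_compl)
qed

text \<open>Unless the clock needs more than \<open>t\<close> for \<open>Suc n\<close> stays, the
  local times at \<open>t\<close> dominate those after these stays; the second term is the
  probability of this exception.\<close>

lemma max_ct_prob_upper:
  assumes "0 < t" "0 < b"
  shows "prob {\<omega>\<in>space M. max_ct_local_time X T t \<omega> \<le> b}
    \<le> lattice.mean n (lattice.surv (poisson_tail b) (0 :: int ^ 'd)) + (1 - poisson_tail t (Suc n))"
proof -
  let ?W = "{\<omega>\<in>space M. \<forall>x. weighted_time n x \<omega> \<le> b}" and ?J = "{\<omega>\<in>space M. t < jump_time T (Suc n) \<omega>}"
  have ev: "?W \<in> events" "?J \<in> events" using weighted_time_prob(1)[OF assms(2)] by auto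
  have "prob {\<omega>\<in>space M. max_ct_local_time X T t \<omega> \<le> b} \<le> prob (?W \<union> ?J)"
  proof (rule finite_measure_mono_AE)
    show "AE \<omega> in M. \<omega> \<in> {\<omega>\<in>space M. max_ct_local_time X T t \<omega> \<le> b} \<longrightarrow> \<omega> \<in> ?W \<union> ?J"
      using holding_pos_AE AE_space
    proof eventually_elim
      case (elim \<omega>)
      have "\<omega> \<in> ?W" if "max_ct_local_time X T t \<omega> \<le> b" "\<not> t < jump_time T (Suc n) \<omega>"
        using that elim assms weighted_time_le_ct[of \<omega> n t] max_ct_local_time_le_iff[of \<omega> t b]
        by (simp add: not_less) (meson order_trans)
      then show ?case using elim by blast
    qed
  qed (use ev in auto)
  also have "\<dots> \<le> prob ?W + prob ?J" by (rule measure_Un_le) (use ev in auto)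
  finally show ?thesis
    using weighted_time_prob(2)[OF assms(2), of n] jump_time_greater_prob[OF assms(1), of "Suc n"] by simp
qed

lemma max_ct_prob_lower:
  assumes "0 < t" "0 < b"
  shows "lattice.mean n (lattice.surv (poisson_tail b) (0 :: int ^ 'd)) - poisson_tail t (Suc n)
    \<le> prob {\<omega>\<in>space M. max_ct_local_time X T t \<omega> \<le> b}"
proof -
  let ?W = "{\<omega>\<in>space M. \<forall>x. weighted_time n x \<omega> \<le> b}" and ?J = "{\<omega>\<in>space M. jump_time T (Suc n) \<omega> \<le> t}"
  let ?L = "{\<omega>\<in>space M. max_ct_local_time X T t \<omega> \<le> b}"
  have ev: "?L \<in> events" "?J \<in> events" using max_ct_local_time_event[of t b] assms by auto
  have "prob ?W \<le> prob (?L \<union> ?J)"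
  proof (rule finite_measure_mono_AE)
    show "AE \<omega> in M. \<omega> \<in> ?W \<longrightarrow> \<omega> \<in> ?L \<union> ?J"
      using holding_pos_AE AE_space
    proof eventually_elim
      case (elim \<omega>)
      have "\<omega> \<in> ?L" if "\<forall>x. weighted_time n x \<omega> \<le> b" "\<not> jump_time T (Suc n) \<omega> \<le> t"
        using that elim assms ct_le_weighted_time[of \<omega> t n] max_ct_local_time_le_iff[of \<omega> t b]
        by (simp add: not_le) (meson order_trans)
      then show ?case using elim by blast
    qed
  qed (use ev in auto)
  also have "\<dots> \<le> prob ?L + prob ?J" by (rule measure_Un_le) (use ev in auto)
  finally show ?thesis
    using weighted_time_prob(2)[OF assms(2), of n] jump_time_le_prob[OF assms(1), of "Suc n"] by simp
qed

end

section \<open>Combination of level, number of steps and clock error\<close>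

lemma log_power5_over_tendsto_0:
  fixes a v :: real
  assumes "0 < a"
  shows "((\<lambda>t. (a * ln t + v) ^ 5 / t) \<longlongrightarrow> 0) at_top"
  using assms by real_asymp

text \<open>For \<open>\<beta> = 1\<close> the exponent stays bounded and the first term is
  comparable with the right side. The gap between \<open>a\<close> and \<open>a'\<close> leaves the
  first term at most the share \<open>1 - \<kappa>\<close> of it, and the second, exponentially
  small in \<open>t\<close>, fits into the share \<open>\<kappa>\<close>.\<close>

lemma eventually_exp_absorb:
  fixes C \<beta> d a a' :: real
  assumes "0 < C" "0 < \<beta>" "\<beta> \<le> 1" "0 < d" "a < a'"
  shows "\<forall>\<^sub>F t in at_top. exp (- (a' * (C * t powr (1 - \<beta>)))) + exp (- (t * d))
    \<le> exp (- (a * (C * t powr (1 - \<beta>))))"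
proof -
  define \<kappa> where "\<kappa> = 1 - exp (- ((a' - a) * C))"
  have \<kappa>: "0 < \<kappa>" using assms by (simp add: \<kappa>_def)
  have "((\<lambda>t. a * C * (t powr (1 - \<beta>) / t) - ln \<kappa> * (1 / t)) \<longlongrightarrow> a * C * 0 - ln \<kappa> * 0) at_top"
  proof (intro tendsto_intros)
    show "((\<lambda>t. t powr (1 - \<beta>) / t) \<longlongrightarrow> 0) at_top" using assms(2) by real_asymp
    show "((\<lambda>t. 1 / t :: real) \<longlongrightarrow> 0) at_top" by real_asymp
  qed
  then have "((\<lambda>t. (a * (C * t powr (1 - \<beta>)) - ln \<kappa>) / t) \<longlongrightarrow> 0) at_top"
    by (simp add: diff_divide_distrib mult.assoc)
  then have "\<forall>\<^sub>F t in at_top. (a * (C * t powr (1 - \<beta>)) - ln \<kappa>) / t < d"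
    using assms(4) by (rule order_tendstoD)
  then show ?thesis using eventually_ge_at_top[of 1]
  proof eventually_elim
    case (elim t)
    define x where "x = C * t powr (1 - \<beta>)"
    have "1 \<le> t powr (1 - \<beta>)" using elim assms by (intro ge_one_powr_ge_zero) auto
    then have x: "C \<le> x" using assms by (simp add: x_def)
    have "a * x - ln \<kappa> \<le> t * d" using elim by (simp add: x_def field_simps)
    then have "exp (- (t * d)) \<le> exp (- (a * x) + ln \<kappa>)" by simp
    also have "\<dots> = exp (- (a * x)) * \<kappa>" using \<kappa> by (simp only: exp_add exp_ln)
    finally have 1: "exp (- (t * d)) \<le> exp (- (a * x)) * \<kappa>" .
    have "(a' - a) * C \<le> (a' - a) * x" using x assms by (intro mult_left_mono) auto
    then have "exp (- ((a' - a) * x)) \<le> 1 - \<kappa>" by (simp add: \<kappa>_def)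
    then have "exp (- (a * x)) * exp (- ((a' - a) * x)) \<le> exp (- (a * x)) * (1 - \<kappa>)"
      by (intro mult_left_mono) auto
    moreover have "exp (- (a * x)) * exp (- ((a' - a) * x)) = exp (- (a' * x))"
      by (simp add: algebra_simps flip: exp_add)
    ultimately show ?case using 1 unfolding x_def[symmetric] by (simp add: right_diff_distrib)
  qed
qed

context walk_with_holding_times
begin

lemma escape_prob_eq:
  assumes "3 \<le> CARD('d)"
  shows "escape_prob M X = sym_steps.\<gamma> (unit_steps :: (int ^ 'd) set)"
proof -
  interpret L: lattice_steps "unit_steps :: (int ^ 'd) set" "2 * (real CARD('d))\<^sup>2 + real CARD('d)" "CARD('d)"
    by (rule lattice_steps_unit_steps[OF assms])
  show ?thesis by (rule LIMSEQ_unique[OF esc_tendsto_escape_prob L.esc_tendsto])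
qed

lemma ct_bounds:
  fixes u \<beta> \<gamma> :: real
  assumes d3: "3 \<le> CARD('d)" and \<gamma>: "\<gamma> = escape_prob M X" and \<beta>: "0 < \<beta>" "\<beta> \<le> 1"
    and \<epsilon>: "0 < \<epsilon>" "\<epsilon> < 1"
  defines "P \<equiv> \<lambda>t. prob {\<omega>\<in>space M. max_ct_local_time X T t \<omega> \<le> \<beta> * inverse \<gamma> * ln t + u}"
    and "x \<equiv> \<lambda>t. \<gamma> * exp (- \<gamma> * u) * t powr (1 - \<beta>)"
  shows "\<forall>\<^sub>F t in at_top. exp (- ((1 + \<epsilon>) * x t)) \<le> P t \<and> P t \<le> exp (- ((1 - \<epsilon>) * x t))"
proof -
  interpret L: lattice_steps "unit_steps :: (int ^ 'd) set" "2 * (real CARD('d))\<^sup>2 + real CARD('d)" "CARD('d)"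
    by (rule lattice_steps_unit_steps[OF d3])
  have \<gamma>L: "L.\<gamma> = \<gamma>" using escape_prob_eq[OF d3] \<gamma> by simp
  have \<gamma>0: "0 < \<gamma>" using L.\<gamma>_pos \<gamma>L by simp
  define b where "b t = \<beta> * inverse \<gamma> * ln t + u" for t
  have c0: "0 < \<beta> * inverse \<gamma>" using \<beta> \<gamma>0 by simp
  have b_lim: "filterlim b at_top at_top"
    unfolding b_def using c0 by real_asymp
  define C where "C = \<gamma> * exp (- \<gamma> * u)"
  have C: "0 < C" using \<gamma>0 by (simp add: C_def)
  have xC: "x t = C * t powr (1 - \<beta>)" for t by (simp add: x_def C_def)
  \<comment> \<open>The choice of the level: \<open>exp (- \<gamma> * b t)\<close> is
    \<open>exp (- \<gamma> * u) * t powr (- \<beta>)\<close>, and about \<open>t\<close> steps are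
    made.\<close>
  have x_eq: "\<gamma> * exp (- (\<gamma> * b t)) * t = x t" if "0 < t" for t
  proof -
    have "\<gamma> * b t = \<beta> * ln t + \<gamma> * u" using \<gamma>0 by (simp add: b_def field_simps)
    then have "exp (- (\<gamma> * b t)) = exp (- \<gamma> * u) * t powr (- \<beta>)"
      using that by (simp add: powr_def algebra_simps flip: exp_add)
    moreover have "t powr (1 - \<beta>) = t powr (- \<beta>) * t"
      using that by (simp add: powr_diff powr_minus field_simps)
    ultimately show ?thesis by (simp add: x_def)
  qed
  have b_pos: "\<forall>\<^sub>F t in at_top. 0 < b t"
    using b_lim by (simp add: filterlim_at_top_dense)
  have upper: "\<forall>\<^sub>F t in at_top. P t \<le> exp (- ((1 - \<epsilon>) * x t))"
  proof -
    \<comment> \<open>One \<eta> is lost in \<open>poisson_upper\<close> and three in the number of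
      steps (\<open>n\<close> below \<open>t\<close>, rounding, block length), together half of
      \<epsilon>; the other half absorbs the clock error.\<close>
    define \<eta> where "\<eta> = \<epsilon> / 8"
    have \<eta>: "0 < \<eta>" "\<eta> < 1 / 8" using \<epsilon> by (auto simp: \<eta>_def)
    \<comment> \<open>\<open>Suc n <= (1 - \<eta>) * t + 1\<close> stays below \<open>c * t\<close>
      once \<open>\<eta> * t >= 2\<close>.\<close>
    define c where "c = 1 - \<eta> / 2"
    have c: "0 < c" "c < 1" using \<eta> by (auto simp: c_def)
    define d where "d = 1 - c + c * ln c"
    have d: "0 < d" unfolding d_def using c by (intro one_minus_add_ln_pos) auto
    have "\<forall>\<^sub>F t in at_top. \<forall>n. lattice.mean n (lattice.surv (poisson_tail (b t)) (0 :: int ^ 'd))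
      \<le> exp (- ((1 - \<eta>) * L.\<gamma> * exp (- (L.\<gamma> * b t)) * (real n - real (nat \<lceil>4 * b t\<rceil> ^ 5))))"
      using \<eta> by (intro eventually_compose_filterlim[OF L.poisson_upper b_lim] poisson_tail_submult) auto
    moreover have "\<forall>\<^sub>F t in at_top. (4 * b t + 1) ^ 5 / t < \<eta>"
    proof -
      have "((\<lambda>t. (4 * b t + 1) ^ 5 / t) \<longlongrightarrow> 0) at_top"
        using log_power5_over_tendsto_0[of "4 * (\<beta> * inverse \<gamma>)" "4 * u + 1"] c0
        by (simp add: b_def algebra_simps)
      then show ?thesis using \<eta>(1) by (rule order_tendstoD)
    qed
    moreover have "\<forall>\<^sub>F t in at_top. exp (- ((1 - \<epsilon> / 2) * (C * t powr (1 - \<beta>)))) + exp (- (t * d))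
        \<le> exp (- ((1 - \<epsilon>) * (C * t powr (1 - \<beta>))))"
      using C \<beta> d \<epsilon> by (intro eventually_exp_absorb) auto
    ultimately show ?thesis using b_pos eventually_ge_at_top[of "2 / \<eta>"]
    proof eventually_elim
      case (elim t)
      have "0 < 2 / \<eta>" using \<eta> by simp
      then have t: "0 < t" using elim(5) by linarith
      have \<eta>t: "2 \<le> \<eta> * t" using elim(5) \<eta> by (simp add: field_simps)
      define n where "n = nat \<lfloor>(1 - \<eta>) * t\<rfloor>"
      have "0 \<le> (1 - \<eta>) * t" using \<eta> t by simp
      then have n: "(1 - \<eta>) * t - 1 \<le> real n" "real n \<le> (1 - \<eta>) * t" unfolding n_def by linarith+
      have "real (nat \<lceil>4 * b t\<rceil> ^ 5) \<le> (4 * b t + 1) ^ 5"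
      proof -
        have "real (nat \<lceil>4 * b t\<rceil>) \<le> 4 * b t + 1" using elim(4) by linarith
        then show ?thesis unfolding of_nat_power by (intro power_mono) auto
      qed
      also have "\<dots> \<le> \<eta> * t" using elim(2) t by (simp add: field_simps)
      finally have nk: "(1 - 3 * \<eta>) * t \<le> real n - real (nat \<lceil>4 * b t\<rceil> ^ 5)"
        using n(1) \<eta>t by (simp add: algebra_simps)
      have "(1 - \<epsilon> / 2) * x t \<le> ((1 - \<eta>) * (1 - 3 * \<eta>)) * x t"
      proof (rule mult_right_mono)
        have "(1 - \<eta>) * (1 - 3 * \<eta>) = 1 - 4 * \<eta> + 3 * (\<eta> * \<eta>)" by (simp add: algebra_simps)
        then show "1 - \<epsilon> / 2 \<le> (1 - \<eta>) * (1 - 3 * \<eta>)" by (simp add: \<eta>_def)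
        show "0 \<le> x t" using C by (simp add: xC)
      qed
      also have "\<dots> = (1 - \<eta>) * \<gamma> * exp (- (\<gamma> * b t)) * ((1 - 3 * \<eta>) * t)"
        unfolding x_eq[OF t, symmetric] by simp
      also have "\<dots> \<le> (1 - \<eta>) * \<gamma> * exp (- (\<gamma> * b t)) * (real n - real (nat \<lceil>4 * b t\<rceil> ^ 5))"
        using \<eta> \<gamma>0 by (intro mult_left_mono nk) auto
      finally have "exp (- ((1 - \<eta>) * \<gamma> * exp (- (\<gamma> * b t)) * (real n - real (nat \<lceil>4 * b t\<rceil> ^ 5))))
          \<le> exp (- ((1 - \<epsilon> / 2) * x t))" by simp
      moreover have "lattice.mean n (lattice.surv (poisson_tail (b t)) (0 :: int ^ 'd))
          \<le> exp (- ((1 - \<eta>) * \<gamma> * exp (- (\<gamma> * b t)) * (real n - real (nat \<lceil>4 * b t\<rceil> ^ 5))))"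
        using elim(1) unfolding \<gamma>L by blast
      moreover have "1 - poisson_tail t (Suc n) \<le> exp (- (t * d))"
        unfolding d_def
      proof (rule one_minus_poisson_tail_le[OF t c])
        show "real (Suc n) \<le> c * t" using n(2) \<eta>t by (simp add: c_def algebra_simps)
      qed
      moreover have "P t \<le> lattice.mean n (lattice.surv (poisson_tail (b t)) (0 :: int ^ 'd)) + (1 - poisson_tail t (Suc n))"
        unfolding P_def b_def[symmetric] by (rule max_ct_prob_upper[OF t elim(4)])
      ultimately show ?case using elim(3) unfolding xC by linarith
    qed
  qed
  have lower: "\<forall>\<^sub>F t in at_top. exp (- ((1 + \<epsilon>) * x t)) \<le> P t"
  proof -
    \<comment> \<open>\<open>(1 + \<eta>) * (1 + 2 * \<eta>) <= 1 + 5 * \<eta> = 1 + \<epsilon> /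
      2\<close>; now \<open>n\<close> slightly exceeds \<open>t\<close>, and the other half of
      \<epsilon> again pays for the clock.\<close>
    define \<eta> where "\<eta> = \<epsilon> / 10"
    have \<eta>: "0 < \<eta>" "\<eta> < 1 / 10" using \<epsilon> by (auto simp: \<eta>_def)
    define c where "c = 1 + \<eta>"
    have c: "1 < c" using \<eta> by (auto simp: c_def)
    define d where "d = 1 - c + c * ln c"
    have d: "0 < d" unfolding d_def using c by (intro one_minus_add_ln_pos) auto
    obtain N where N: "\<forall>\<^sub>F b in at_top. \<forall>n\<ge>N.
        exp (- ((1 + \<eta>) * L.\<gamma> * exp (- (L.\<gamma> * b)) * real n)) \<le> lattice.mean n (lattice.surv (poisson_tail b) (0 :: int ^ 'd))"
      using L.poisson_lower[OF poisson_tail_submult \<eta>(1)] by blast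
    have "\<forall>\<^sub>F t in at_top. \<forall>n\<ge>N.
        exp (- ((1 + \<eta>) * L.\<gamma> * exp (- (L.\<gamma> * b t)) * real n)) \<le> lattice.mean n (lattice.surv (poisson_tail (b t)) (0 :: int ^ 'd))"
      by (rule eventually_compose_filterlim[OF N b_lim])
    moreover have "\<forall>\<^sub>F t in at_top. exp (- ((1 + \<epsilon>) * (C * t powr (1 - \<beta>)))) + exp (- (t * d))
        \<le> exp (- ((1 + \<epsilon> / 2) * (C * t powr (1 - \<beta>))))"
      using C \<beta> d \<epsilon> by (intro eventually_exp_absorb) auto
    ultimately show ?thesis using b_pos eventually_ge_at_top[of "2 / \<eta>"] eventually_ge_at_top[of "real N"]
    proof eventually_elim
      case (elim t)
      have "0 < 2 / \<eta>" using \<eta> by simp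
      then have t: "0 < t" using elim(4) by linarith
      have \<eta>t: "2 \<le> \<eta> * t" using elim(4) \<eta> by (simp add: field_simps)
      define n where "n = nat \<lceil>(1 + \<eta>) * t\<rceil>"
      have "0 \<le> (1 + \<eta>) * t" using \<eta> t by simp
      then have n: "(1 + \<eta>) * t \<le> real n" "real n \<le> (1 + \<eta>) * t + 1" unfolding n_def by linarith+
      have "t \<le> (1 + \<eta>) * t" using \<eta> t by simp
      then have "N \<le> n" using elim(5) n(1) by linarith
      have "(1 + \<eta>) * \<gamma> * exp (- (\<gamma> * b t)) * real n \<le> (1 + \<eta>) * \<gamma> * exp (- (\<gamma> * b t)) * ((1 + 2 * \<eta>) * t)"
        using \<eta> \<gamma>0 n(2) \<eta>t by (intro mult_left_mono) (auto simp: algebra_simps)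
      also have "\<dots> = ((1 + \<eta>) * (1 + 2 * \<eta>)) * x t"
        unfolding x_eq[OF t, symmetric] by simp
      also have "\<dots> \<le> (1 + \<epsilon> / 2) * x t"
      proof (rule mult_right_mono)
        have "(1 + \<eta>) * (1 + 2 * \<eta>) = 1 + 3 * \<eta> + 2 * (\<eta> * \<eta>)" by (simp add: algebra_simps)
        moreover have "\<eta> * \<eta> \<le> \<eta> * 1" using \<eta> by (intro mult_left_mono) auto
        ultimately show "(1 + \<eta>) * (1 + 2 * \<eta>) \<le> 1 + \<epsilon> / 2" by (simp add: \<eta>_def)
        show "0 \<le> x t" using C by (simp add: xC)
      qed
      finally have "exp (- ((1 + \<epsilon> / 2) * x t)) \<le> exp (- ((1 + \<eta>) * \<gamma> * exp (- (\<gamma> * b t)) * real n))"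
        by simp
      moreover have "exp (- ((1 + \<eta>) * \<gamma> * exp (- (\<gamma> * b t)) * real n)) \<le> lattice.mean n (lattice.surv (poisson_tail (b t)) (0 :: int ^ 'd))"
        using elim(1) \<open>N \<le> n\<close> unfolding \<gamma>L by blast
      moreover have "poisson_tail t (Suc n) \<le> exp (- (t * d))"
        unfolding d_def
      proof (rule poisson_tail_le[OF t c])
        show "c * t \<le> real (Suc n)" using n(1) by (simp add: c_def)
      qed
      moreover have "lattice.mean n (lattice.surv (poisson_tail (b t)) (0 :: int ^ 'd)) - poisson_tail t (Suc n) \<le> P t"
        unfolding P_def b_def[symmetric] by (rule max_ct_prob_lower[OF t elim(3)])
      ultimately show ?case using elim(2) unfolding xC by linarith
    qed
  qed
  show ?thesis using eventually_conj[OF lower upper] .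
qed

text \<open>Local times are integers, so the level acts through its floor \<open>k n\<close>. The
  constant \<open>c_const\<close> is the effect of this rounding: its powers cancel and the exponent
  becomes \<open>\<gamma> * (1 - \<gamma>) ^ k n * n\<close>.\<close>

lemma dt_bound:
  fixes u \<beta> \<gamma> :: real
  assumes d3: "3 \<le> CARD('d)" and \<gamma>: "\<gamma> = escape_prob M X" and \<alpha>: "\<alpha> = log_const \<gamma>"
    and \<beta>: "0 < \<beta>" "\<beta> \<le> 1" and \<epsilon>: "0 < \<epsilon>" "\<epsilon> < 1"
  shows "\<forall>\<^sub>F n in sequentially.
    prob {\<omega>\<in>space M. real (max_local_time X n \<omega>) \<le> \<beta> * \<alpha> * ln (real n) + u}
      \<le> exp (- ((1 - \<epsilon>) * (c_const \<gamma> \<beta> n u * \<gamma> * (1 - \<gamma>) powr u * real n powr (1 - \<beta>))))"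
proof -
  interpret L: lattice_steps "unit_steps :: (int ^ 'd) set" "2 * (real CARD('d))\<^sup>2 + real CARD('d)" "CARD('d)"
    by (rule lattice_steps_unit_steps[OF d3])
  have \<gamma>L: "L.\<gamma> = \<gamma>" using escape_prob_eq[OF d3] \<gamma> by simp
  have \<gamma>01: "0 < \<gamma>" "\<gamma> < 1" using L.\<gamma>_pos L.\<gamma>_less_1 \<gamma>L by auto
  have "0 < \<alpha>" using \<gamma>01 by (simp add: \<alpha> log_const_def divide_neg_neg)
  then have c0: "0 < \<beta> * \<alpha>" using \<beta> by simp
  define v where "v n = \<beta> * \<alpha> * ln (real n) + u" for n
  define k where "k n = nat \<lfloor>v n\<rfloor>" for n
  have v_lim: "filterlim v at_top sequentially"
    unfolding v_def using c0 by real_asymp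
  have k_lim: "filterlim k at_top sequentially"
    unfolding k_def v_def using c0 by real_asymp
  define \<eta> where "\<eta> = \<epsilon> / 2"
  have \<eta>: "0 < \<eta>" "\<eta> < 1" using \<epsilon> by (auto simp: \<eta>_def)
  have "\<forall>\<^sub>F n in sequentially. \<forall>m. lattice.mean m (lattice.surv (\<lambda>j. of_bool (j \<le> k n)) (0 :: int ^ 'd))
      \<le> exp (- ((1 - \<eta>) * L.\<gamma> * L.h ^ k n * (real m - real (k n ^ 5))))"
    by (rule eventually_compose_filterlim[OF L.unit_upper[OF \<eta>] k_lim])
  moreover have "\<forall>\<^sub>F n in sequentially. v n ^ 5 / real n < \<eta>"
  proof -
    have "(\<lambda>n. v n ^ 5 / real n) \<longlonglongrightarrow> 0"
      unfolding v_def
      by (rule filterlim_compose[OF log_power5_over_tendsto_0[OF c0] filterlim_real_sequentially])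
    then show ?thesis using \<eta>(1) by (rule order_tendstoD)
  qed
  moreover have "\<forall>\<^sub>F n in sequentially. 0 < v n"
    using v_lim by (simp add: filterlim_at_top_dense)
  ultimately show ?thesis using eventually_gt_at_top[of 0]
  proof eventually_elim
    case (elim n)
    have kv: "real (k n) \<le> v n" using elim(3) unfolding k_def by linarith
    have fl: "\<lfloor>v n\<rfloor> = int (k n)" using elim(3) unfolding k_def by simp
    have "c_const \<gamma> \<beta> n u * \<gamma> * (1 - \<gamma>) powr u * real n powr (1 - \<beta>)
       = (real n powr \<beta> * real n powr (1 - \<beta>)) * ((1 - \<gamma>) powr (- u) * (1 - \<gamma>) powr u) * \<gamma> * (1 - \<gamma>) ^ k n"
      unfolding c_const_def \<alpha>[symmetric] v_def[symmetric] fl by (simp add: power_int_of_nat)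
    also have "\<dots> = real n * \<gamma> * (1 - \<gamma>) ^ k n"
      using elim(4) \<gamma>01 by (simp flip: powr_add)
    finally have y: "c_const \<gamma> \<beta> n u * \<gamma> * (1 - \<gamma>) powr u * real n powr (1 - \<beta>) = \<gamma> * (1 - \<gamma>) ^ k n * real n"
      by (simp only: mult_ac)
    have "real (k n ^ 5) \<le> v n ^ 5" unfolding of_nat_power using kv by (intro power_mono) auto
    also have "\<dots> \<le> \<eta> * real n" using elim(2,4) by (simp add: field_simps)
    finally have nk: "(1 - \<eta>) * real n \<le> real n - real (k n ^ 5)" by (simp add: algebra_simps)
    have "(1 - \<epsilon>) * (\<gamma> * (1 - \<gamma>) ^ k n * real n) \<le> ((1 - \<eta>) * (1 - \<eta>)) * (\<gamma> * (1 - \<gamma>) ^ k n * real n)"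
    proof (rule mult_right_mono)
      have "(1 - \<eta>) * (1 - \<eta>) = 1 - 2 * \<eta> + \<eta> * \<eta>" by (simp add: algebra_simps)
      then show "1 - \<epsilon> \<le> (1 - \<eta>) * (1 - \<eta>)" by (simp add: \<eta>_def)
    qed (use \<gamma>01 in auto)
    also have "\<dots> = (1 - \<eta>) * \<gamma> * (1 - \<gamma>) ^ k n * ((1 - \<eta>) * real n)" by simp
    also have "\<dots> \<le> (1 - \<eta>) * \<gamma> * (1 - \<gamma>) ^ k n * (real n - real (k n ^ 5))"
      using \<eta> \<gamma>01 by (intro mult_left_mono nk) auto
    finally have le: "exp (- ((1 - \<eta>) * \<gamma> * (1 - \<gamma>) ^ k n * (real n - real (k n ^ 5))))
        \<le> exp (- ((1 - \<epsilon>) * (\<gamma> * (1 - \<gamma>) ^ k n * real n)))" by simp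
    have "real m \<le> v n \<longleftrightarrow> m \<le> k n" for m :: nat
      using elim(3) unfolding k_def by linarith
    then have "prob {\<omega>\<in>space M. real (max_local_time X n \<omega>) \<le> v n}
        = lattice.mean n (lattice.surv (\<lambda>j. of_bool (j \<le> k n)) (0 :: int ^ 'd))"
      using max_local_time_prob[of n "k n"] by simp
    also have "\<dots> \<le> exp (- ((1 - \<eta>) * \<gamma> * (1 - \<gamma>) ^ k n * (real n - real (k n ^ 5))))"
      using elim(1) unfolding \<gamma>L L.h_def by blast
    also note le
    finally show ?case unfolding y v_def .
  qed
qed

end

section \<open>From bounds for each fixed \<epsilon> to an error that tends to zero\<close>

lemma ex_relative_error:
  fixes P x :: "real \<Rightarrow> real"
  assumes x: "\<forall>\<^sub>F t in at_top. 0 < x t"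
    and P: "\<And>\<epsilon>. 0 < \<epsilon> \<Longrightarrow> \<epsilon> < 1 \<Longrightarrow>
      \<forall>\<^sub>F t in at_top. exp (- ((1 + \<epsilon>) * x t)) \<le> P t \<and> P t \<le> exp (- ((1 - \<epsilon>) * x t))"
  shows "\<exists>\<epsilon>. (\<epsilon> \<longlongrightarrow> 0) at_top \<and> (\<forall>\<^sub>F t in at_top. P t = exp (- ((1 + \<epsilon> t) * x t)))"
proof (intro exI conjI)
  \<comment> \<open>Solves the required equation for the error; the equation is exact as soon as
    \<open>P t\<close> and \<open>x t\<close> are positive.\<close>
  define \<epsilon> where "\<epsilon> t = - ln (P t) / x t - 1" for t
  show "(\<epsilon> \<longlongrightarrow> 0) at_top"
  proof (rule tendstoI)
    fix e :: real assume "0 < e"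
    define e' where "e' = min (e / 2) (1 / 2)"
    have e': "0 < e'" "e' < 1" "e' < e" using \<open>0 < e\<close> by (auto simp: e'_def)
    show "\<forall>\<^sub>F t in at_top. dist (\<epsilon> t) 0 < e"
      using x P[OF e'(1,2)]
    proof eventually_elim
      case (elim t)
      have "0 < P t" using elim by (intro less_le_trans[OF exp_gt_zero]) auto
      then have "- ((1 + e') * x t) \<le> ln (P t)" "ln (P t) \<le> - ((1 - e') * x t)"
        using elim ln_ge_iff[of "P t"] ln_le_cancel_iff[of "P t" "exp (- ((1 - e') * x t))"] by auto
      then have "- e' \<le> \<epsilon> t" "\<epsilon> t \<le> e'" using elim(1) by (auto simp: \<epsilon>_def field_simps)
      then show ?case using e' by (simp add: dist_real_def)
    qed
  qed
  show "\<forall>\<^sub>F t in at_top. P t = exp (- ((1 + \<epsilon> t) * x t))"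
    using x P[of "1 / 2", simplified]
  proof eventually_elim
    case (elim t)
    have "0 < P t" using elim by (intro less_le_trans[OF exp_gt_zero]) auto
    then show ?case using elim(1) by (simp add: \<epsilon>_def)
  qed
qed

lemma ex_relative_error_upper:
  fixes P y :: "nat \<Rightarrow> real"
  assumes y: "\<forall>\<^sub>F n in sequentially. 0 < y n" and P0: "\<And>n. 0 \<le> P n"
    and P: "\<And>\<epsilon>. 0 < \<epsilon> \<Longrightarrow> \<epsilon> < 1 \<Longrightarrow> \<forall>\<^sub>F n in sequentially. P n \<le> exp (- ((1 - \<epsilon>) * y n))"
  shows "\<exists>\<epsilon>. \<epsilon> \<longlonglongrightarrow> 0 \<and> (\<forall>\<^sub>F n in sequentially. P n \<le> exp (- ((1 + \<epsilon> n) * y n)))"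
proof (intro exI conjI)
  \<comment> \<open>\<open>P n\<close> may vanish or lie far below the bound, where the logarithm
    carries no information or the solved error is large; truncation at 0 keeps a valid inequality,
    and probability zero gets error 0.\<close>
  define \<epsilon> where "\<epsilon> n = (if P n = 0 then 0 else min 0 (- ln (P n) / y n - 1))" for n
  show "\<epsilon> \<longlonglongrightarrow> 0"
  proof (rule tendstoI)
    fix e :: real assume "0 < e"
    define e' where "e' = min (e / 2) (1 / 2)"
    have e': "0 < e'" "e' < 1" "e' < e" using \<open>0 < e\<close> by (auto simp: e'_def)
    show "\<forall>\<^sub>F n in sequentially. dist (\<epsilon> n) 0 < e"
      using y P[OF e'(1,2)]
    proof eventually_elim
      case (elim n)
      show ?case
      proof (cases "P n = 0")
        case False
        then have "0 < P n" using P0[of n] by simp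
        then have "ln (P n) \<le> - ((1 - e') * y n)"
          using elim ln_le_cancel_iff[of "P n" "exp (- ((1 - e') * y n))"] by simp
        then have "- e' \<le> - ln (P n) / y n - 1" using elim(1) by (simp add: field_simps)
        then show ?thesis using e' False by (simp add: \<epsilon>_def dist_real_def)
      qed (use \<open>0 < e\<close> in \<open>simp add: \<epsilon>_def\<close>)
    qed
  qed
  show "\<forall>\<^sub>F n in sequentially. P n \<le> exp (- ((1 + \<epsilon> n) * y n))"
    using y
  proof eventually_elim
    case (elim n)
    show ?case
    proof (cases "P n = 0")
      case False
      then have "0 < P n" using P0[of n] by simp
      have "1 + \<epsilon> n \<le> - ln (P n) / y n" using False by (simp add: \<epsilon>_def)
      then have "(1 + \<epsilon> n) * y n \<le> - ln (P n)" using elim by (simp add: field_simps)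
      then have "exp (ln (P n)) \<le> exp (- ((1 + \<epsilon> n) * y n))" by simp
      then show ?thesis using \<open>0 < P n\<close> by simp
    qed simp
  qed
qed

theorem theorem1p2:
  fixes M :: "'w measure"
    and X :: "nat \<Rightarrow> 'w \<Rightarrow> int ^ 'd::finite"
    and T :: "nat \<Rightarrow> 'w \<Rightarrow> real"
    and \<beta> u \<gamma> \<alpha> :: real
  assumes "CARD('d) \<ge> 3"
    and "walk_with_holding_times M X T"
    and "0 < \<beta>" and "\<beta> \<le> 1"
    and "\<gamma> = escape_prob M X"
    and "\<alpha> = log_const \<gamma>"
  shows
    "(\<exists>\<epsilon> :: real \<Rightarrow> real. (\<epsilon> \<longlongrightarrow> 0) at_top \<and>
        (\<forall>\<^sub>F t in at_top.
           \<P>(\<omega> in M. max_ct_local_time X T t \<omega> \<le> \<beta> * inverse \<gamma> * ln t + u)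
             = exp (- ((1 + \<epsilon> t) * \<gamma> * exp (- \<gamma> * u) * t powr (1 - \<beta>)))))
     \<and>
     (\<exists>\<epsilon> :: nat \<Rightarrow> real. \<epsilon> \<longlonglongrightarrow> 0 \<and>
        (\<forall>\<^sub>F n in sequentially.
           \<P>(\<omega> in M. real (max_local_time X n \<omega>) \<le> \<beta> * \<alpha> * ln (real n) + u)
             \<le> exp (- ((1 + \<epsilon> n) * c_const \<gamma> \<beta> n u * \<gamma> * (1 - \<gamma>) powr u
                        * real n powr (1 - \<beta>)))))"
proof -
  interpret walk_with_holding_times M X T by (rule assms)
  interpret L: lattice_steps "unit_steps :: (int ^ 'd) set" "2 * (real CARD('d))\<^sup>2 + real CARD('d)" "CARD('d)"
    by (rule lattice_steps_unit_steps[OF assms(1)])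
  have \<gamma>: "0 < \<gamma>" "\<gamma> < 1"
    using L.\<gamma>_pos L.\<gamma>_less_1 escape_prob_eq[OF assms(1)] assms(5) by auto
  have "\<exists>\<epsilon>. (\<epsilon> \<longlongrightarrow> 0) at_top \<and> (\<forall>\<^sub>F t in at_top.
      \<P>(\<omega> in M. max_ct_local_time X T t \<omega> \<le> \<beta> * inverse \<gamma> * ln t + u)
        = exp (- ((1 + \<epsilon> t) * (\<gamma> * exp (- \<gamma> * u) * t powr (1 - \<beta>)))))"
  proof (rule ex_relative_error)
    show "\<forall>\<^sub>F t in at_top. 0 < \<gamma> * exp (- \<gamma> * u) * t powr (1 - \<beta>)"
      using eventually_gt_at_top[of 0] by eventually_elim (use \<gamma> in simp)
  qed (rule ct_bounds[OF assms(1,5,3,4)])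
  moreover have "\<exists>\<epsilon>. \<epsilon> \<longlonglongrightarrow> 0 \<and> (\<forall>\<^sub>F n in sequentially.
      \<P>(\<omega> in M. real (max_local_time X n \<omega>) \<le> \<beta> * \<alpha> * ln (real n) + u)
        \<le> exp (- ((1 + \<epsilon> n) * (c_const \<gamma> \<beta> n u * \<gamma> * (1 - \<gamma>) powr u * real n powr (1 - \<beta>)))))"
  proof (rule ex_relative_error_upper)
    show "\<forall>\<^sub>F n in sequentially. 0 < c_const \<gamma> \<beta> n u * \<gamma> * (1 - \<gamma>) powr u * real n powr (1 - \<beta>)"
      using eventually_gt_at_top[of 0] by eventually_elim (use \<gamma> in \<open>simp add: c_const_def\<close>)
  qed (auto intro: dt_bound[OF assms(1,5,6,3,4)])
  ultimately show ?thesis by (simp only: mult.assoc)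
qed

end
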